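(* Let a $d$-dimensional diagonal Gaussian mixture model have parameters $\{(\omega_i,\mu_i,\Sigma_i):i\in[r]\}$, where $\omega_i>0$, $\sum_i\omega_i=1$, $\mu_i\in\mathbb R^d$, and each $\Sigma_i$ is a diagonal covariance matrix. Let $n=d-1$, let $m\ge3$ be the moment order used, and suppose $r\le r_{\max}$, where $$r_{\max}=\max\left(\binom{k^*}{p^*},\binom{n-2-k^*}{m-1-p^*}\right),\quad p^*=\left\lfloor\tfrac{m-1}{2}\right\rfloor,$$ and $k^*$ is the largest integer $k$ such that $\binom{k}{p^*}\le\binom{n-k-1}{m-p^*-1}$. Let $t$ be the smallest number with $\binom{d}{t}\ge r$. Let $\{(\omega_i^*,\mu_i^*,\Sigma_i^* ):i\in[r]\}$ be the output of the Gaussian mixture learning algorithm (described in the context) applied to the sample moment tensors $\widehat M_m,\widehat M_t$. Suppose that $(\mu_1^{\otimes t})_{\Omega_t},\dots,(\mu_r^{\otimes t})_{\Omega_t}$ are linearly independent and that the tensor $\mathcal F_m=\sum_{i=1}^r\omega_i\mu_i^{\otimes m}$ satisfies the following conditions, for the constants $p,k$ used in the algorithm ($1\le p\le m-2$, $p\le k\le n-m+p$, $\min(\binom kp,\binom{n-k-1}{m-p-1})\ge r$): (i) the scalars $\omega_i$ and the leading entry of each $\mu_i$ are nonzero; (ii) the vectors $\{[(\mu_i)_{1:n}]_{\mathscr B_0}\}_{i=1}^r$ are linearly independent; (iii) the vectors $\{[(\mu_i)_{1:n}]_{\mathcal O_\alpha}\}_{i=1}^r$ are linearly independent for all $\alpha\in\mathscr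 B_1$; (iv) the eigenvalues of the matrix $N(\xi)$ are distinct from each other. If $\epsilon:=\max(\|\widehat M_m-M_m\|,\|\widehat M_t-M_t\|)$ is small enough, then, up to a permutation of the components, $$\|\mu_i^*-\mu_i\|=O(\epsilon),\qquad |\omega_i^*-\omega_i|=O(\epsilon),\qquad \|\Sigma_i^*-\Sigma_i\|=O(\epsilon),\qquad i=1,\dots,r,$$ where the constants inside $O(\cdot)$ depend on the parameters $\{(\omega_i,\mu_i,\Sigma_i):i\in[r]\}$ and the choice of $\xi$ in the algorithm.
   Context: The mixture is the random vector $y\in\mathbb R^d$ that with probability $\omega_i$ is distributed as $\mathcal N(\mu_i,\Sigma_i)$, $\Sigma_i=\mathrm{diag}(\sigma_{ij}^2)_j$. $M_s=\mathbb E[y^{\otimes s}]$, and $\widehat M_s=\frac1N\sum_{a=1}^Ny_a^{\otimes s}$ for i.i.d. samples $y_1,\dots,y_N$. $\|\cdot\|$ is the Euclidean/Frobenius/Hilbert–Schmidt norm; $c^{1/m}$ is the principal $m$th root. Vector and tensor indices run over $0,1,\dots,n$ with $n=d-1$; $v_{1:n}=(v_1,\dots,v_n)$. $\Omega_s$ is the set of $s$-tuples of pairwise distinct indices and $(\cdot)_{\Omega_s}$ denotes restriction to these entries. With $x=(x_1,\dots,x_n)$, $x_0:=1$, entries of a symmetric tensor $\mathcal F$ of order $m$ over $\mathbb C^{n+1}$ are also labelled by $\alpha\in\mathbb N^n$ with $|\alpha|\le m$ (or by $x^\alpha$): $\mathcal F_\alpha=\mathcal F_{i_1\dots i_m}$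 whenever $x_0^{m-|\alpha|}x^\alpha=x_{i_1}\cdots x_{i_m}$. Monomials are identified with exponents. $\mathscr B_0$: the first $r$ monomials, in graded lexicographic order, of $\{x_{i_1}\cdots x_{i_p}:1\le i_1<\dots<i_p\le k\}$. $\mathscr B_1=\{x_{j_1}\cdots x_{j_{p+1}}:1\le j_1<\dots<j_p\le k<j_{p+1}\le n\}$. For $\alpha=e_{j_1}+\dots+e_{j_{p+1}}\in\mathscr B_1$ (with $j_{p+1}>k$), $\mathcal O_\alpha$ is the set of tuples $(s_1,\dots,s_{m-p-1})$ with $k+1\le s_1<\dots<s_{m-p-1}\le n$, all $s_t\ne j_{p+1}$, identified with monomials $x_{s_1}\cdots x_{s_{m-p-1}}$. For a finite set $\mathscr B$ of monomials, $[v]_{\mathscr B}=(f(v))_{f\in\mathscr B}$. For a tensor $\mathcal F$: $A[\alpha,\mathcal F]_{\gamma,\beta}=\mathcal F_{\beta+\gamma}$, $b[\alpha,\mathcal F]_\gamma=\mathcal F_{\alpha+\gamma}$ ($\gamma\in\mathcal O_\alpha,\beta\in\mathscr B_0$). For $G\in\mathbb C^{\mathscr B_0\times\mathscr B_1}$, $l=k+1,\dots,n$: $N_l(G)_{\nu,\beta}=G(\beta,\nu+e_l)$, $\nu,\beta\in\mathscr B_0$. In (iv), $N(\xi)=\sum_{l=k+1}^n\xi_lN_l(G)$ with $G$ determined by $A[\alpha,\mathcal F_m]G(:,\alpha)=b[\alpha,\mathcal F_m]$ for all $\alpha\in\mathscr B_1$ (uniquely solvable under (i)–(iii)), and $\xi$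 the vector chosen in the algorithm. Index sets: $J_1=\{x_{i_1}\cdots x_{i_p}:1\le i_1<\dots<i_p\le k\}$; $J_1^{-j}$: monomials of $J_1$ not involving $x_j$; $J_2=\{x_{i_1}\cdots x_{i_{m-p-1}}:k+1\le i_1<\dots<i_{m-p-1}\le n\}$; $J_3=\{x_{i_1-k}\cdots x_{i_{m-p-1}-k}:x_{i_1}\cdots x_{i_{m-p-1}}\in J_2\}$. Products of such sets are sets of products of monomials. Tensor approximation subroutine (input $(\widehat{\mathcal F}_m)_{\Omega_m}$): (1) for each $\alpha\in\mathscr B_1$ let $\widehat G(:,\alpha)$ minimize $\|A[\alpha,\widehat{\mathcal F}_m]g-b[\alpha,\widehat{\mathcal F}_m]\|^2$ over $g\in\mathbb C^{\mathscr B_0}$; (2) for a generic $\xi=(\xi_{k+1},\dots,\xi_n)$ let $\hat z_1,\dots,\hat z_r$ be unit-length eigenvectors of $\sum_l\xi_lN_l(\widehat G)$ and $\hat w_i=(\hat z_i^HN_{k+1}(\widehat G)\hat z_i,\dots,\hat z_i^HN_n(\widehat G)\hat z_i)$; (3) let $(\hat\gamma_i)_i$ minimize $\|(\widehat{\mathcal F}_m)_{J_1\cdot J_2}-\sum_i\gamma_i\otimes[\hat w_i]_{J_3}\|^2$; for each $j=1,\dots,k$ let $((\hat v_i)_j)_i$ minimize $\|(\widehat{\mathcal F}_m)_{x_j\cdot J_1^{-j}\cdot J_2}-\sum_i(v_i)_j\hat\gamma_i\otimes[\hat w_i]_{J_3}\|^2$ ($\hat\gamma_i$ restricted to $J_1^{-j}$);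 let $(\hat\lambda_i)_i$ minimize $\|(\widehat{\mathcal F}_m)_{\Omega_m}-\sum_i\lambda_i((1,\hat v_i,\hat w_i)^{\otimes m})_{\Omega_m}\|^2$; (4) starting from $\hat q_i=(\hat\lambda_i)^{1/m}(1,\hat v_i,\hat w_i)$, let $(q_1^*,\dots,q_r^* )$ be the minimizer of $\|(\widehat{\mathcal F}_m)_{\Omega_m}-\sum_i(q_i^{\otimes m})_{\Omega_m}\|^2$. Learning algorithm (input $\widehat M_m,\widehat M_t,r$): Step 1. Apply the subroutine to $(\widehat{\mathcal F}_m)_{\Omega_m}:=(\widehat M_m)_{\Omega_m}$, obtaining $q_1^*,\dots,q_r^*$. Step 2. For each $i$ choose $\eta_i$ with $\eta_i^m=1$ minimizing $\|\mathrm{Im}(\eta_iq_i^* )\|$ and set $\check q_i=\mathrm{Re}(\eta_iq_i^* )$. Step 3. Let $(\beta_1^*,\dots,\beta_r^* )$ minimize $\|(\widehat M_t)_{\Omega_t}-\sum_i\beta_i(\check q_i^{\otimes t})_{\Omega_t}\|^2$ over $\beta\in\mathbb R^r_+$; set $\hat\omega_i=(\beta_i^* )^{m/(m-t)}$, $\hat\mu_i=\check q_i/(\beta_i^* )^{1/(m-t)}$. Step 4. Starting from $(\hat\omega_i,\hat\mu_i)_i$, let $(\omega_i^*,\mu_i^* )_i$ be the optimizer of $\min\ \|(\widehat M_m)_{\Omega_m}-\sum_i\omega_i(\mu_i^{\otimes m})_{\Omega_m}\|^2+\|(\widehat M_t)_{\Omega_t}-\sum_i\omega_i(\mu_i^{\otimes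 t})_{\Omega_t}\|^2$ subject to $\sum_i\omega_i=1$, $\omega_i\ge0$. Step 5. Let $\widehat{\mathcal A}=\widehat M_m-\sum_i\check q_i^{\otimes m}$. For each coordinate index $j$ let $L_j$ be the set of tuples $(j,j,i_1,\dots,i_{m-2})$ with $i_1<\dots<i_{m-2}$ all different from $j$, and $\hat L_j$ the set of the corresponding $(i_1,\dots,i_{m-2})$. Let $(\theta_{1j}^*,\dots,\theta_{rj}^* )$ minimize $\|(\widehat{\mathcal A})_{L_j}-\sum_i\theta_{ij}\omega_i^*((\mu_i^* )^{\otimes(m-2)})_{\hat L_j}\|^2$ subject to $\theta_{ij}\ge0$, and set $\Sigma_i^*=\mathrm{diag}(\theta_{ij}^* )_j$. Output: $(\omega_i^*,\mu_i^*,\Sigma_i^* )$, $i\in[r]$.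
   Formalization: If m and t are both even, the moments and the algorithm cannot distinguish a mean μ_i from −μ_i, so the bound on the means is then claimed only up to a sign for each component; if m or t is odd, the claim is as stated. *)

theory Defs
  imports "HOL-Probability.Probability"
begin

text \<open>
  Vectors of length \<open>d = n + 1\<close> are functions on \<open>nat\<close> of which only the values on \<open>0, \<dots>, n\<close> matter,
  families of \<open>r\<close> objects are indexed by \<open>0, \<dots>, r - 1\<close>, and a tensor of order \<open>s\<close> is a function on
  index tuples (lists of length \<open>s\<close> over \<open>{..<d}\<close>). A matrix whose rows and columns are labelled by
  monomials is a function of two monomials.
\<close>

section \<open>Tensors, norms and linear independence\<close>

definition nrm :: "'i set \<Rightarrow> ('i \<Rightarrow> 'a::real_normed_vector) \<Rightarrow> real" where
  "nrm I f = L2_set (\<lambda>i. norm (f i)) I"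

definition lin_indep :: "nat \<Rightarrow> 'i set \<Rightarrow> (nat \<Rightarrow> 'i \<Rightarrow> 'a::field) \<Rightarrow> bool" where
  "lin_indep r I u \<longleftrightarrow>
     (\<forall>c. (\<forall>x\<in>I. (\<Sum>i<r. c i * u i x) = 0) \<longrightarrow> (\<forall>i<r. c i = 0))"

definition tuples :: "nat \<Rightarrow> nat \<Rightarrow> nat list set" where
  "tuples d s = {is. length is = s \<and> set is \<subseteq> {..<d}}"

definition Omega :: "nat \<Rightarrow> nat \<Rightarrow> nat list set" where
  "Omega d s = {is \<in> tuples d s. distinct is}"

text \<open>The entries of all powers \<open>x\<^sup>\<otimes>\<^sup>s\<close>; the order \<open>s\<close> is the length of the index tuple.\<close>

definition tpow :: "(nat \<Rightarrow> 'a::comm_semiring_1) \<Rightarrow> nat list \<Rightarrow> 'a" where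
  "tpow x is = prod_list (map x is)"

definition diagm :: "(nat \<Rightarrow> real) \<Rightarrow> nat \<Rightarrow> nat \<Rightarrow> real" where
  "diagm v j l = (if j = l then v j else 0)"

section \<open>The mixture and its moments\<close>

text \<open>
  The univariate normal law with mean \<open>a\<close> and standard deviation \<open>s \<ge> 0\<close>, the Dirac measure if
  \<open>s = 0\<close>. A Gaussian vector with diagonal covariance has independent normal coordinates, so its law
  is the product measure; this includes singular covariances, which have no density.
\<close>

definition normal_law :: "real \<Rightarrow> real \<Rightarrow> real measure" where
  "normal_law a s =
     (if s = 0 then return borel a else density lborel (\<lambda>x. ennreal (normal_density a s x)))"

definition diag_gaussian :: "nat \<Rightarrow> (nat \<Rightarrow> real) \<Rightarrow> (nat \<Rightarrow> real) \<Rightarrow> (nat \<Rightarrow> real) measure" where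
  "diag_gaussian d a s = PiM {..<d} (\<lambda>j. normal_law (a j) (s j))"

definition mixture ::
    "nat \<Rightarrow> nat \<Rightarrow> (nat \<Rightarrow> real) \<Rightarrow> (nat \<Rightarrow> nat \<Rightarrow> real) \<Rightarrow> (nat \<Rightarrow> nat \<Rightarrow> real) \<Rightarrow> (nat \<Rightarrow> real) measure"
where
  "mixture d r \<omega> \<mu> \<sigma> =
     point_measure {..<r} (\<lambda>i. ennreal (\<omega> i)) \<bind> (\<lambda>i. diag_gaussian d (\<mu> i) (\<sigma> i))"

definition moment :: "(nat \<Rightarrow> real) measure \<Rightarrow> nat list \<Rightarrow> real" where
  "moment P is = (LINT y|P. tpow y is)"

definition sample_moment :: "nat \<Rightarrow> (nat \<Rightarrow> nat \<Rightarrow> real) \<Rightarrow> nat list \<Rightarrow> real" where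
  "sample_moment N y is = (\<Sum>a<N. tpow (y a) is) / real N"

section \<open>Monomials\<close>

text \<open>
  The monomial \<open>x\<^sup>\<alpha>\<close> in \<open>x\<^sub>1, \<dots>, x\<^sub>n\<close> is the multiset in which \<open>i\<close> occurs \<open>\<alpha>\<^sub>i\<close> times; products are
  sums of multisets.
\<close>

type_synonym mon = "nat multiset"

definition mon_eval :: "mon \<Rightarrow> (nat \<Rightarrow> 'a::comm_semiring_1) \<Rightarrow> 'a" where
  "mon_eval f v = (\<Prod>i\<in>#f. v i)"

text \<open>
  The entry \<open>F\<^sub>\<alpha>\<close> of a symmetric tensor of order \<open>m\<close>, read off at the sorted tuple of indices of
  \<open>x\<^sub>0\<^bsup>m-|\<alpha>|\<^esup> x\<^sup>\<alpha>\<close>.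
\<close>

definition entry :: "nat \<Rightarrow> (nat list \<Rightarrow> 'a) \<Rightarrow> mon \<Rightarrow> 'a" where
  "entry m F \<alpha> = F (sorted_list_of_multiset (replicate_mset (m - size \<alpha>) 0 + \<alpha>))"

definition sqfree_mons :: "nat set \<Rightarrow> nat \<Rightarrow> mon set" where
  "sqfree_mons A s = mset_set ` {S. S \<subseteq> A \<and> finite S \<and> card S = s}"

text \<open>
  Graded lexicographic order with the listing
  \<open>1, x\<^sub>1, \<dots>, x\<^sub>n, x\<^sub>1\<^sup>2, x\<^sub>1x\<^sub>2, \<dots>\<close>: \<open>f\<close> is listed before \<open>g\<close>.
\<close>

definition grlex_before :: "mon \<Rightarrow> mon \<Rightarrow> bool" where
  "grlex_before f g \<longleftrightarrow>
     size f < size g \<or>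
     size f = size g \<and> (\<exists>i. count g i < count f i \<and> (\<forall>j<i. count f j = count g j))"

definition J1 :: "nat \<Rightarrow> nat \<Rightarrow> mon set" where
  "J1 k p = sqfree_mons {1..k} p"

definition J1_without :: "nat \<Rightarrow> nat \<Rightarrow> nat \<Rightarrow> mon set" where
  "J1_without k p j = {\<beta> \<in> J1 k p. j \<notin># \<beta>}"

definition J2 :: "nat \<Rightarrow> nat \<Rightarrow> nat \<Rightarrow> nat \<Rightarrow> mon set" where
  "J2 n m p k = sqfree_mons {k+1..n} (m - p - 1)"

text \<open>\<open>shift k\<close> maps \<open>x\<^sub>i\<close> to \<open>x\<^bsub>i-k\<^esub>\<close>, so that \<open>J\<^sub>3\<close> is the image of \<open>J\<^sub>2\<close>.\<close>

definition shift :: "nat \<Rightarrow> mon \<Rightarrow> mon" where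
  "shift k \<delta> = image_mset (\<lambda>i. i - k) \<delta>"

definition B0 :: "nat \<Rightarrow> nat \<Rightarrow> nat \<Rightarrow> mon set" where
  "B0 k p r = {\<beta> \<in> J1 k p. card {f \<in> J1 k p. grlex_before f \<beta>} < r}"

definition B1 :: "nat \<Rightarrow> nat \<Rightarrow> nat \<Rightarrow> mon set" where
  "B1 n p k = {\<beta> + {#l#} | \<beta> l. \<beta> \<in> J1 k p \<and> l \<in> {k+1..n}}"

text \<open>For \<open>\<alpha> \<in> B1 n p k\<close> the only index of \<open>\<alpha>\<close> above \<open>k\<close> is \<open>j\<^bsub>p+1\<^esub>\<close>.\<close>

definition Oset :: "nat \<Rightarrow> nat \<Rightarrow> nat \<Rightarrow> nat \<Rightarrow> mon \<Rightarrow> mon set" where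
  "Oset n m p k \<alpha> = sqfree_mons ({k+1..n} - set_mset \<alpha>) (m - p - 1)"

section \<open>Generating matrices\<close>

text \<open>\<open>gen_residual m B F \<alpha> g \<gamma>\<close> is the entry at \<open>\<gamma>\<close> of \<open>A[\<alpha>,F] g - b[\<alpha>,F]\<close>, where \<open>B\<close> labels the columns.\<close>

definition gen_residual ::
    "nat \<Rightarrow> mon set \<Rightarrow> (nat list \<Rightarrow> complex) \<Rightarrow> mon \<Rightarrow> (mon \<Rightarrow> complex) \<Rightarrow> mon \<Rightarrow> complex" where
  "gen_residual m B F \<alpha> g \<gamma> = (\<Sum>\<beta>\<in>B. entry m F (\<beta> + \<gamma>) * g \<beta>) - entry m F (\<alpha> + \<gamma>)"

definition Nl :: "(mon \<Rightarrow> mon \<Rightarrow> complex) \<Rightarrow> nat \<Rightarrow> mon \<Rightarrow> mon \<Rightarrow> complex" where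
  "Nl G l \<nu> \<beta> = G \<beta> (\<nu> + {#l#})"

definition Nxi ::
    "nat \<Rightarrow> nat \<Rightarrow> (nat \<Rightarrow> complex) \<Rightarrow> (mon \<Rightarrow> mon \<Rightarrow> complex) \<Rightarrow> mon \<Rightarrow> mon \<Rightarrow> complex" where
  "Nxi n k \<xi> G \<nu> \<beta> = (\<Sum>l=k+1..n. \<xi> l * Nl G l \<nu> \<beta>)"

definition eigenvector_on ::
    "'i set \<Rightarrow> ('i \<Rightarrow> 'i \<Rightarrow> complex) \<Rightarrow> ('i \<Rightarrow> complex) \<Rightarrow> complex \<Rightarrow> bool" where
  "eigenvector_on B M z c \<longleftrightarrow>
     (\<exists>\<nu>\<in>B. z \<nu> \<noteq> 0) \<and> (\<forall>\<nu>\<in>B. (\<Sum>\<beta>\<in>B. M \<nu> \<beta> * z \<beta>) = c * z \<nu>)"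

text \<open>The \<open>card B\<close> eigenvalues of a matrix with rows and columns labelled by \<open>B\<close> are distinct.\<close>

definition distinct_eigenvalues :: "'i set \<Rightarrow> ('i \<Rightarrow> 'i \<Rightarrow> complex) \<Rightarrow> bool" where
  "distinct_eigenvalues B M \<longleftrightarrow> card {c. \<exists>z. eigenvector_on B M z c} = card B"

section \<open>The tensor approximation subroutine\<close>

text \<open>The vector \<open>(1, v, w)\<close>, where \<open>v\<close> is indexed by \<open>1, \<dots>, k\<close> and \<open>w\<close> by \<open>1, \<dots>, n - k\<close>.\<close>

definition one_v_w :: "nat \<Rightarrow> (nat \<Rightarrow> complex) \<Rightarrow> (nat \<Rightarrow> complex) \<Rightarrow> nat \<Rightarrow> complex" where
  "one_v_w k v w j = (if j = 0 then 1 else if j \<le> k then v j else w (j - k))"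

text \<open>
  The starting points \<open>q\<close> that the algebraic part of the subroutine can produce. Minimizers of the
  least squares problems need not be unique; every choice is admitted. The products in
  \<open>J\<^sub>1 \<sqdot> J\<^sub>2\<close> are labelled by their pairs of factors, which they determine. On complex numbers
  \<open>powr\<close> is the principal power.
\<close>

definition subroutine_start ::
    "nat \<Rightarrow> nat \<Rightarrow> nat \<Rightarrow> nat \<Rightarrow> nat \<Rightarrow> (nat \<Rightarrow> complex) \<Rightarrow> (nat list \<Rightarrow> complex) \<Rightarrow>
     (nat \<Rightarrow> nat \<Rightarrow> complex) \<Rightarrow> bool" where
  "subroutine_start n m p k r \<xi> F q \<longleftrightarrow>
     (\<exists>G z w \<gamma> v lam.
        (\<forall>\<alpha>\<in>B1 n p k.
           is_arg_min (\<lambda>g. (nrm (Oset n m p k \<alpha>) (gen_residual m (B0 k p r) F \<alpha> g))\<^sup>2)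
             (\<lambda>_. True) (\<lambda>\<beta>. G \<beta> \<alpha>)) \<and>
        (\<forall>i<r. nrm (B0 k p r) (z i) = 1 \<and> (\<exists>c. eigenvector_on (B0 k p r) (Nxi n k \<xi> G) (z i) c)) \<and>
        lin_indep r (B0 k p r) z \<and>
        (\<forall>i<r. \<forall>l\<in>{1..n-k}.
           w i l = (\<Sum>\<nu>\<in>B0 k p r. \<Sum>\<beta>\<in>B0 k p r. cnj (z i \<nu>) * Nl G (k + l) \<nu> \<beta> * z i \<beta>)) \<and>
        is_arg_min
          (\<lambda>g. (nrm (J1 k p \<times> J2 n m p k)
             (\<lambda>(\<beta>, \<delta>). entry m F (\<beta> + \<delta>) - (\<Sum>i<r. g i \<beta> * mon_eval (shift k \<delta>) (w i))))\<^sup>2)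
          (\<lambda>_. True) \<gamma> \<and>
        (\<forall>j\<in>{1..k}.
           is_arg_min
             (\<lambda>u. (nrm (J1_without k p j \<times> J2 n m p k)
                (\<lambda>(\<beta>, \<delta>). entry m F ({#j#} + \<beta> + \<delta>) -
                   (\<Sum>i<r. u i * \<gamma> i \<beta> * mon_eval (shift k \<delta>) (w i))))\<^sup>2)
             (\<lambda>_. True) (\<lambda>i. v i j)) \<and>
        is_arg_min
          (\<lambda>c. (nrm (Omega (n + 1) m)
             (\<lambda>is. F is - (\<Sum>i<r. c i * tpow (one_v_w k (v i) (w i)) is)))\<^sup>2)
          (\<lambda>_. True) lam \<and>
        (\<forall>i<r. \<forall>j\<le>n. q i j = lam i powr (1 / of_nat m) * one_v_w k (v i) (w i) j))"

text \<open>
  The starting point only tells an optimization routine where to begin. The result is required to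
  be a (global) minimizer, and any minimizer is admitted.
\<close>

definition subroutine_output ::
    "nat \<Rightarrow> nat \<Rightarrow> nat \<Rightarrow> nat \<Rightarrow> nat \<Rightarrow> (nat \<Rightarrow> complex) \<Rightarrow> (nat list \<Rightarrow> complex) \<Rightarrow>
     (nat \<Rightarrow> nat \<Rightarrow> complex) \<Rightarrow> bool" where
  "subroutine_output n m p k r \<xi> F qs \<longleftrightarrow>
     (\<exists>qh. subroutine_start n m p k r \<xi> F qh) \<and>
     is_arg_min (\<lambda>q. (nrm (Omega (n + 1) m) (\<lambda>is. F is - (\<Sum>i<r. tpow (q i) is)))\<^sup>2)
       (\<lambda>_. True) qs"

section \<open>The learning algorithm\<close>

text \<open>\<open>Lhat d m j\<close> lists the tuples \<open>(i\<^sub>1, \<dots>, i\<^bsub>m-2\<^esub>)\<close> of \<open>L\<^sub>j\<close> without the leading \<open>j, j\<close>.\<close>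

definition Lhat :: "nat \<Rightarrow> nat \<Rightarrow> nat \<Rightarrow> nat list set" where
  "Lhat d m j = {is. length is = m - 2 \<and> sorted_wrt (<) is \<and> set is \<subseteq> {..<d} - {j}}"

text \<open>
  \<open>learning_output\<close> relates the inputs \<open>Mm, Mt\<close> to every possible output \<open>(ws, ms, Ss)\<close> (weights,
  means, covariance matrices). The pair \<open>(wh, mh)\<close> is the starting point of the last nonlinear
  optimization; as above, its result \<open>(ws, ms)\<close> may be any global optimizer.
  If \<open>m\<close> and \<open>t\<close> are both even, replacing any \<open>ms i\<close> by its negative gives another output, since
  neither the objective of that optimization nor the tensor powers of order \<open>m - 2\<close> change.
\<close>

definition learning_output ::
    "nat \<Rightarrow> nat \<Rightarrow> nat \<Rightarrow> nat \<Rightarrow> nat \<Rightarrow> nat \<Rightarrow> (nat \<Rightarrow> complex) \<Rightarrow>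
     (nat list \<Rightarrow> real) \<Rightarrow> (nat list \<Rightarrow> real) \<Rightarrow>
     (nat \<Rightarrow> real) \<Rightarrow> (nat \<Rightarrow> nat \<Rightarrow> real) \<Rightarrow> (nat \<Rightarrow> nat \<Rightarrow> nat \<Rightarrow> real) \<Rightarrow> bool" where
  "learning_output d m t p k r \<xi> Mm Mt ws ms Ss \<longleftrightarrow>
     (\<exists>qs \<eta> qc b wh mh \<theta>.
        subroutine_output (d - 1) m p k r \<xi> (\<lambda>is. complex_of_real (Mm is)) qs \<and>
        (\<forall>i<r. is_arg_min (\<lambda>e. nrm {..<d} (\<lambda>j. Im (e * qs i j))) (\<lambda>e. e ^ m = 1) (\<eta> i)) \<and>
        (\<forall>i<r. \<forall>j<d. qc i j = Re (\<eta> i * qs i j)) \<and>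
        is_arg_min (\<lambda>c. (nrm (Omega d t) (\<lambda>is. Mt is - (\<Sum>i<r. c i * tpow (qc i) is)))\<^sup>2)
          (\<lambda>c. \<forall>i<r. 0 \<le> c i) b \<and>
        (\<forall>i<r. wh i = b i powr (real m / (real m - real t))) \<and>
        (\<forall>i<r. \<forall>j<d. mh i j = qc i j / b i powr (1 / (real m - real t))) \<and>
        is_arg_min
          (\<lambda>(w, u). (nrm (Omega d m) (\<lambda>is. Mm is - (\<Sum>i<r. w i * tpow (u i) is)))\<^sup>2 +
                    (nrm (Omega d t) (\<lambda>is. Mt is - (\<Sum>i<r. w i * tpow (u i) is)))\<^sup>2)
          (\<lambda>(w, u). (\<Sum>i<r. w i) = 1 \<and> (\<forall>i<r. 0 \<le> w i)) (ws, ms) \<and>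
        (\<forall>j<d.
           is_arg_min
             (\<lambda>c. (nrm (Lhat d m j)
                (\<lambda>is. (Mm (j # j # is) - (\<Sum>i<r. tpow (qc i) (j # j # is))) -
                      (\<Sum>i<r. c i * ws i * tpow (ms i) is)))\<^sup>2)
             (\<lambda>c. \<forall>i<r. 0 \<le> c i) (\<lambda>i. \<theta> i j)) \<and>
        (\<forall>i<r. Ss i = diagm (\<theta> i)))"

section \<open>The bound on the number of components\<close>

text \<open>
  For \<open>m \<ge> 3\<close> the lower argument \<open>m - p\<^sup>* - 1\<close> is positive, so a binomial coefficient whose upper
  argument is truncated at \<open>0\<close> has its conventional value \<open>0\<close>; the set below is then finite.
\<close>

definition p_star :: "nat \<Rightarrow> nat" where
  "p_star m = (m - 1) div 2"

definition k_star :: "nat \<Rightarrow> nat \<Rightarrow> nat" where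
  "k_star n m = Max {k. k choose p_star m \<le> (n - k - 1) choose (m - p_star m - 1)}"

definition r_max :: "nat \<Rightarrow> nat \<Rightarrow> nat" where
  "r_max n m =
     max (k_star n m choose p_star m) ((n - 2 - k_star n m) choose (m - 1 - p_star m))"

end

theory Submission
  imports Defs
begin

text \<open>
  On tuples of distinct indices the moments of a diagonal Gaussian see only the mean, so there
  \<open>M\<^sub>m\<close> agrees with \<open>F = \<Sum>\<^sub>i \<omega>\<^sub>i \<mu>\<^sub>i\<^sup>\<otimes>\<^sup>m\<close>, and the algorithm fits symmetric decompositions to a
  perturbation of the part of \<open>F\<close> with distinct indices. Every fit is a global minimizer, hence its
  residual is at most that of the true parameters, which is \<open>O(\<epsilon>)\<close>. What remains to be shown is
  that families of vectors whose power sums on distinct indices are \<open>O(\<epsilon>)\<close>-close to those of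
  \<open>q\<^sub>i = \<omega>\<^sub>i\<^bsup>1/m\<^esup> \<mu>\<^sub>i\<close> are themselves \<open>O(\<epsilon>)\<close>-close to the \<open>q\<^sub>i\<close>, up to order and \<open>m\<close>-th roots of
  unity. This is \<open>decomposition_stability\<close>. It concerns arbitrary competitors \<open>q'\<close> and so applies
  to all global minimizers, no matter where an optimization starts.

  The proof of \<open>decomposition_stability\<close> runs through the generating polynomials. Pair the power
  sum with functionals dual to the families \<open>[q\<^sub>i]\<close> on \<open>\<B>\<^sub>0\<close> and on \<open>\<O>\<^sub>\<alpha>\<close>. The entries with an extra
  factor \<open>x\<^sub>0\<close> give matrices close to the identity, and those with an extra factor \<open>x\<^sub>l\<close> give matrices
  close to \<open>diag(q\<^sub>i\<^sub>l/q\<^sub>i\<^sub>0)\<close>; for \<open>q'\<close> all of them are diagonalized by one and the same change of basis,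
  with eigenvalues \<open>q'\<^sub>i\<^sub>l/q'\<^sub>i\<^sub>0\<close>. Since the combination with coefficients \<open>\<xi>\<^sub>l\<close> has distinct
  eigenvalues, the eigenvectors of the perturbed matrix have distinct dominant entries, which
  matches the components (\<open>simultaneous_diagonalization\<close>). Once the ratios with \<open>l > k\<close> are known,
  the other coordinates solve well-posed linear systems, and the leading entry is determined up to an
  \<open>m\<close>-th root of unity (\<open>aligned_decomposition\<close>).

  For the output \<open>q\<^sup>*\<close> of the subroutine the rotation by \<open>\<eta>\<^sub>i\<close> removes the roots of unity up to
  those that are real, and these disappear in \<open>m\<close>-th powers (\<open>corrected_power_sums\<close>). For the real
  pairs \<open>(\<omega>\<^sup>*, \<mu>\<^sup>*)\<close> only a sign remains; comparing the moments of order \<open>t < m\<close> then separates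
  weights from means and leaves the sign undetermined only if \<open>m\<close> and \<open>t\<close> are even
  (\<open>weights_and_means_stability\<close>). Finally the moments at \<open>(j, j, i\<^sub>1, \<dots>, i\<^bsub>m-2\<^esub>)\<close> contain the
  variances linearly, with coefficient vectors that stay linearly independent
  (\<open>lin_indep_Lhat\<close>, \<open>covariance_stability\<close>).

  All estimates are made along a filter on the possible runs of the algorithm, on which \<open>\<epsilon>\<close> tends
  to \<open>0\<close>. The relation \<open>f \<simeq> g\<close>, meaning that \<open>f - g = O(\<epsilon>)\<close> with \<open>g\<close> bounded, is then a congruence
  for the ring operations, so that no explicit constants have to be carried along.
\<close>

section \<open>Linear independence and dual functionals\<close>

lemma lin_indepD:
  "lin_indep r I u \<Longrightarrow> (\<And>x. x \<in> I \<Longrightarrow> (\<Sum>i<r. c i * u i x) = 0) \<Longrightarrow> i < r \<Longrightarrow> c i = 0"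
  unfolding lin_indep_def by blast

lemma lin_indep_nonzero:
  fixes u :: "nat \<Rightarrow> 'i \<Rightarrow> 'a::field"
  assumes "lin_indep r I u" "i < r"
  shows "\<exists>x\<in>I. u i x \<noteq> 0"
proof (rule ccontr)
  assume "\<not> ?thesis"
  then have "(\<Sum>h<r. (if h = i then 1 else 0) * u h x) = 0" if "x \<in> I" for x
    using that by (intro sum.neutral) auto
  from lin_indepD[OF assms(1) this assms(2)] show False by simp
qed

lemma lin_indep_scale:
  fixes u :: "nat \<Rightarrow> 'i \<Rightarrow> 'a::field"
  assumes "lin_indep r I u" "\<And>i. i < r \<Longrightarrow> b i \<noteq> 0"
    and v: "\<And>i x. i < r \<Longrightarrow> x \<in> I \<Longrightarrow> v i x = b i * u i x"
  shows "lin_indep r I v"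
  unfolding lin_indep_def
proof (intro allI impI)
  fix c i assume c: "\<forall>x\<in>I. (\<Sum>i<r. c i * v i x) = 0" and i: "i < r"
  have "(\<Sum>i<r. (c i * b i) * u i x) = 0" if "x \<in> I" for x
    using c that v by (simp add: mult.assoc)
  from lin_indepD[OF assms(1) this i] assms(2)[OF i] show "c i = 0" by simp
qed

lemma lin_indep_reindex:
  assumes "lin_indep r (g ` I) u"
  shows "lin_indep r I (\<lambda>i x. u i (g x))"
  using assms unfolding lin_indep_def by simp

lemma lin_indep_complex:
  fixes u :: "nat \<Rightarrow> 'i \<Rightarrow> real"
  assumes "lin_indep r I u"
  shows "lin_indep r I (\<lambda>i x. complex_of_real (u i x))"
  unfolding lin_indep_def
proof (intro allI impI)
  fix c i assume c: "\<forall>x\<in>I. (\<Sum>i<r. c i * complex_of_real (u i x)) = 0" and i: "i < r"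
  have "(\<Sum>i<r. Re (c i) * u i x) = 0" if "x \<in> I" for x
    using arg_cong[OF bspec[OF c that], of Re] by simp
  moreover have "(\<Sum>i<r. Im (c i) * u i x) = 0" if "x \<in> I" for x
    using arg_cong[OF bspec[OF c that], of Im] by simp
  ultimately show "c i = 0"
    using lin_indepD[OF assms, of "\<lambda>i. Re (c i)"] lin_indepD[OF assms, of "\<lambda>i. Im (c i)"] i
    by (simp add: complex_eq_iff)
qed

text \<open>
  Dual functionals turn linear independence into equations, which survive perturbation. In the
  induction step the new vector differs from its interpolation by the old functionals at some
  index \<open>y\<close>; evaluation at \<open>y\<close>, corrected by the old functionals, gives the new one.
\<close>
lemma dual_functionals:
  fixes u :: "nat \<Rightarrow> 'i \<Rightarrow> 'a::field"
  assumes "finite I" "lin_indep r I u"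
  shows "\<exists>\<phi>. \<forall>i<r. \<forall>j<r. (\<Sum>x\<in>I. \<phi> j x * u i x) = (if i = j then 1 else 0)"
  using assms(2)
proof (induction r)
  case 0
  then show ?case by simp
next
  case (Suc r)
  have "lin_indep r I u"
    unfolding lin_indep_def
  proof (intro allI impI)
    fix c i assume c: "\<forall>x\<in>I. (\<Sum>i<r. c i * u i x) = 0" and i: "i < r"
    have "(\<Sum>i<Suc r. (if i < r then c i else 0) * u i x) = 0" if "x \<in> I" for x
      using c that by simp
    from lin_indepD[OF Suc.prems this, of i] i show "c i = 0" by simp
  qed
  then obtain \<phi> where \<phi>: "\<And>i j. i < r \<Longrightarrow> j < r \<Longrightarrow> (\<Sum>x\<in>I. \<phi> j x * u i x) = (if i = j then 1 else 0)"
    using Suc.IH by blast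
  define p where "p j = (\<Sum>x\<in>I. \<phi> j x * u r x)" for j
  define v where "v x = u r x - (\<Sum>i<r. p i * u i x)" for x
  \<comment> \<open>\<open>v\<close> is \<open>u r\<close> minus its interpolation; if it vanished, \<open>u r\<close> would depend on the other vectors.\<close>
  have "\<exists>x\<in>I. v x \<noteq> 0"
  proof (rule ccontr)
    assume *: "\<not> ?thesis"
    have "(\<Sum>i<Suc r. (if i < r then - p i else 1) * u i x) = 0" if "x \<in> I" for x
      using * that by (simp add: v_def sum_negf)
    from lin_indepD[OF Suc.prems this, of r] show False by simp
  qed
  then obtain y where y: "y \<in> I" "v y \<noteq> 0" by blast
  define \<kappa> where "\<kappa> x = ((if x = y then 1 else 0) - (\<Sum>i<r. u i y * \<phi> i x)) / v y" for x
  have \<kappa>: "(\<Sum>x\<in>I. \<kappa> x * w x) = (w y - (\<Sum>i<r. u i y * (\<Sum>x\<in>I. \<phi> i x * w x))) / v y" for w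
  proof -
    have "(\<Sum>x\<in>I. \<kappa> x * w x) = (\<Sum>x\<in>I. (if x = y then w x else 0) - (\<Sum>i<r. u i y * \<phi> i x * w x)) / v y"
      unfolding \<kappa>_def sum_divide_distrib
      by (intro sum.cong refl) (simp add: sum_distrib_left algebra_simps)
    also have "\<dots> = (w y - (\<Sum>x\<in>I. \<Sum>i<r. u i y * \<phi> i x * w x)) / v y"
      using y(1) assms(1) by (simp add: sum_subtractf)
    also have "(\<Sum>x\<in>I. \<Sum>i<r. u i y * \<phi> i x * w x) = (\<Sum>i<r. u i y * (\<Sum>x\<in>I. \<phi> i x * w x))"
      by (subst sum.swap) (simp add: sum_distrib_left mult.assoc)
    finally show ?thesis .
  qed
  have \<kappa>r: "(\<Sum>x\<in>I. \<kappa> x * u r x) = 1"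
    unfolding \<kappa> using y(2) by (simp add: v_def p_def[symmetric] mult.commute)
  have \<kappa>i: "(\<Sum>x\<in>I. \<kappa> x * u i x) = 0" if "i < r" for i
  proof -
    have "(\<Sum>h<r. u h y * (\<Sum>x\<in>I. \<phi> h x * u i x)) = (\<Sum>h<r. if h = i then u i y else 0)"
      using \<phi> that by (intro sum.cong refl) auto
    with that show ?thesis unfolding \<kappa> by simp
  qed
  define \<phi>' where "\<phi>' j x = (if j < r then \<phi> j x - p j * \<kappa> x else \<kappa> x)" for j x
  have *: "(\<Sum>x\<in>I. \<phi>' j x * w x) = (\<Sum>x\<in>I. \<phi> j x * w x) - p j * (\<Sum>x\<in>I. \<kappa> x * w x)" if "j < r" for j w
    using that by (simp add: \<phi>'_def left_diff_distrib sum_subtractf sum_distrib_left mult.assoc)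
  have "(\<Sum>x\<in>I. \<phi>' j x * u i x) = (if i = j then 1 else 0)" if "i < Suc r" "j < Suc r" for i j
  proof (cases "j < r")
    case True
    then show ?thesis
      using that \<phi> \<kappa>i \<kappa>r by (cases "i < r") (auto simp: * p_def less_Suc_eq)
  next
    case False
    then show ?thesis
      using that \<kappa>i \<kappa>r by (cases "i < r") (auto simp: \<phi>'_def less_Suc_eq)
  qed
  then show ?case by blast
qed

text \<open>
  Gaussian elimination on the coordinates: each coordinate removes at most one vector. The vectors
  are indexed by a set, since the removed one is arbitrary.
\<close>
lemma card_index_le_if_independent:
  fixes u :: "'j \<Rightarrow> 'i \<Rightarrow> 'a::field"
  assumes "finite I" "finite S"
    and "\<And>c. (\<And>x. x \<in> I \<Longrightarrow> (\<Sum>i\<in>S. c i * u i x) = 0) \<Longrightarrow> \<forall>i\<in>S. c i = 0"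
  shows "card S \<le> card I"
  using assms
proof (induction I arbitrary: S u)
  case empty
  have "\<forall>i\<in>S. (1::'a) = 0" by (rule empty.prems(2)) simp
  then show ?case by (cases "S = {}") auto
next
  case (insert y I)
  show ?case
  proof (cases "\<forall>i\<in>S. u i y = 0")
    case True
    have "card S \<le> card I"
    proof (rule insert.IH[OF insert.prems(1)])
      fix c assume "\<And>x. x \<in> I \<Longrightarrow> (\<Sum>i\<in>S. c i * u i x) = 0"
      then show "\<forall>i\<in>S. c i = 0"
        using True by (intro insert.prems(2)) auto
    qed
    then show ?thesis using insert.hyps by simp
  next
    case False
    then obtain s where s: "s \<in> S" "u s y \<noteq> 0" by blast
    define v where "v i x = u i x - u i y / u s y * u s x" for i x
    have "card (S - {s}) \<le> card I"
    proof (rule insert.IH)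
      show "finite (S - {s})" using insert.prems(1) by simp
      fix c assume c: "\<And>x. x \<in> I \<Longrightarrow> (\<Sum>i\<in>S - {s}. c i * v i x) = 0"
      define c' where "c' i = (if i = s then - (\<Sum>i\<in>S - {s}. c i * (u i y / u s y)) else c i)" for i
      have eq: "(\<Sum>i\<in>S. c' i * u i x) = (\<Sum>i\<in>S - {s}. c i * v i x)" for x
      proof -
        have "(\<Sum>i\<in>S. c' i * u i x) = c' s * u s x + (\<Sum>i\<in>S - {s}. c' i * u i x)"
          using s insert.prems(1) by (simp add: sum.remove)
        also have "(\<Sum>i\<in>S - {s}. c' i * u i x) = (\<Sum>i\<in>S - {s}. c i * u i x)"
          by (intro sum.cong) (auto simp: c'_def)
        also have "c' s * u s x = - (\<Sum>i\<in>S - {s}. c i * (u i y / u s y * u s x))"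
          by (simp add: c'_def sum_distrib_right mult.assoc)
        finally show ?thesis
          by (simp add: v_def right_diff_distrib sum_subtractf)
      qed
      have "(\<Sum>i\<in>S. c' i * u i x) = 0" if "x \<in> insert y I" for x
      proof (cases "x = y")
        case True
        then show ?thesis unfolding eq using s by (intro sum.neutral) (simp add: v_def)
      next
        case False
        then show ?thesis unfolding eq using that c by blast
      qed
      then have "\<forall>i\<in>S. c' i = 0" by (intro insert.prems(2)) blast
      then show "\<forall>i\<in>S - {s}. c i = 0" unfolding c'_def by (metis DiffE singletonI)
    qed
    then show ?thesis using s insert.hyps insert.prems(1) by simp
  qed
qed

lemma lin_indep_le_card:
  assumes "finite I" "lin_indep r I u"
  shows "r \<le> card I"
proof -
  have "card {..<r} \<le> card I"
    by (rule card_index_le_if_independent[of _ _ u])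
      (use assms lin_indepD[OF assms(2)] in auto)
  then show ?thesis by simp
qed

lemma lin_indep_spans:
  fixes u :: "nat \<Rightarrow> 'i \<Rightarrow> 'a::field"
  assumes "finite I" "lin_indep r I u" "card I \<le> r"
  shows "\<exists>c. \<forall>x\<in>I. w x = (\<Sum>i<r. c i * u i x)"
proof (rule ccontr)
  assume *: "\<not> ?thesis"
  have "lin_indep (Suc r) I (\<lambda>i x. if i < r then u i x else w x)"
    unfolding lin_indep_def
  proof (intro allI impI)
    fix c i assume c: "\<forall>x\<in>I. (\<Sum>i<Suc r. c i * (if i < r then u i x else w x)) = 0" and i: "i < Suc r"
    have c: "(\<Sum>i<r. c i * u i x) + c r * w x = 0" if "x \<in> I" for x
      using c that by simp
    have cr: "c r = 0"
    proof (rule ccontr)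
      assume "c r \<noteq> 0"
      have "\<forall>x\<in>I. w x = (\<Sum>i<r. (- c i / c r) * u i x)"
      proof
        fix x assume "x \<in> I"
        from c[OF this] have "c r * w x = - (\<Sum>i<r. c i * u i x)"
          by (simp add: eq_neg_iff_add_eq_0 add.commute)
        then have "w x = - (\<Sum>i<r. c i * u i x) / c r"
          using \<open>c r \<noteq> 0\<close> by (simp add: field_simps)
        then show "w x = (\<Sum>i<r. (- c i / c r) * u i x)"
          by (simp add: sum_negf sum_divide_distrib)
      qed
      with * show False by (metis (no_types))
    qed
    then have "c i = 0" if "i < r" for i
      using lin_indepD[OF assms(2) _ that, of c] c by simp
    with cr i show "c i = 0" by (auto simp: less_Suc_eq)
  qed
  from lin_indep_le_card[OF assms(1) this] assms(3) show False by simp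
qed

text \<open>
  With as many vectors as coordinates the dual functionals form the inverse matrix, so that the
  relation also holds in the other order of multiplication.
\<close>
lemma two_sided_dual:
  fixes u :: "nat \<Rightarrow> 'i \<Rightarrow> 'a::field"
  assumes "finite I" "lin_indep r I u" "card I \<le> r"
  shows "\<exists>\<phi>. (\<forall>i<r. \<forall>j<r. (\<Sum>x\<in>I. \<phi> j x * u i x) = (if i = j then 1 else 0)) \<and>
    (\<forall>x\<in>I. \<forall>y\<in>I. (\<Sum>i<r. \<phi> i x * u i y) = (if x = y then 1 else 0))"
proof -
  obtain \<phi> where \<phi>: "\<And>i j. i < r \<Longrightarrow> j < r \<Longrightarrow> (\<Sum>x\<in>I. \<phi> j x * u i x) = (if i = j then 1 else 0)"
    using dual_functionals[OF assms(1,2)] by blast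
  have "(\<Sum>i<r. \<phi> i x * u i y) = (if x = y then 1 else 0)" if xy: "x \<in> I" "y \<in> I" for x y
  proof -
    obtain c where c: "\<And>z. z \<in> I \<Longrightarrow> (if z = x then 1 else 0) = (\<Sum>i<r. c i * u i z)"
      using lin_indep_spans[OF assms, of "\<lambda>z. if z = x then 1 else 0"] by blast
    have "\<phi> j x = c j" if j: "j < r" for j
    proof -
      have "\<phi> j x = (\<Sum>z\<in>I. \<phi> j z * (if z = x then 1 else 0))"
        using assms(1) xy by (simp add: if_distrib cong: if_cong)
      also have "\<dots> = (\<Sum>z\<in>I. \<Sum>i<r. c i * (\<phi> j z * u i z))"
        by (intro sum.cong refl) (simp add: c sum_distrib_left mult_ac)
      also have "\<dots> = (\<Sum>i<r. c i * (\<Sum>z\<in>I. \<phi> j z * u i z))"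
        by (subst sum.swap) (simp add: sum_distrib_left)
      also have "\<dots> = (\<Sum>i<r. if i = j then c i else 0)"
        using \<phi> j by (intro sum.cong refl) auto
      finally show ?thesis using j by simp
    qed
    then have "(\<Sum>i<r. \<phi> i x * u i y) = (\<Sum>i<r. c i * u i y)" by simp
    then show ?thesis using c[OF xy(2)] by auto
  qed
  with \<phi> show ?thesis by blast
qed

section \<open>Quantities up to an error of order \<epsilon>\<close>

text \<open>
  All data depend on a point \<open>x\<close>, which stands for a run of the algorithm. Working along a filter,
  instead of with explicit thresholds and constants, leaves the constants in \<open>O(\<epsilon>)\<close> implicit.
\<close>
locale vanishing_error =
  fixes \<Phi> :: "'x filter" and \<epsilon> :: "'x \<Rightarrow> real"
  assumes tends: "(\<epsilon> \<longlongrightarrow> 0) \<Phi>" and nonneg: "\<forall>\<^sub>F x in \<Phi>. 0 \<le> \<epsilon> x"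
begin

definition bdd :: "('x \<Rightarrow> 'a::real_normed_vector) \<Rightarrow> bool" where
  "bdd f \<longleftrightarrow> (\<exists>B. \<forall>\<^sub>F x in \<Phi>. norm (f x) \<le> B)"

text \<open>
  Boundedness of the right-hand side is included to make the relation compatible with
  multiplication.
\<close>
definition approx :: "('x \<Rightarrow> 'a::real_normed_vector) \<Rightarrow> ('x \<Rightarrow> 'a) \<Rightarrow> bool" (infix "\<simeq>" 50) where
  "f \<simeq> g \<longleftrightarrow> (\<exists>C. \<forall>\<^sub>F x in \<Phi>. norm (f x - g x) \<le> C * \<epsilon> x) \<and> bdd g"

lemma bddI: "\<forall>\<^sub>F x in \<Phi>. norm (f x) \<le> B \<Longrightarrow> bdd f"
  unfolding bdd_def by blast

lemma bddE:
  assumes "bdd f"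
  obtains B where "0 < B" "\<forall>\<^sub>F x in \<Phi>. norm (f x) \<le> B"
proof -
  from assms obtain B where B: "\<forall>\<^sub>F x in \<Phi>. norm (f x) \<le> B" unfolding bdd_def by blast
  have "\<forall>\<^sub>F x in \<Phi>. norm (f x) \<le> max B 1" using B by eventually_elim auto
  then show thesis using that[of "max B 1"] by simp
qed

lemma bdd_const [simp, intro]: "bdd (\<lambda>_. c)"
  by (rule bddI[of _ "norm c"]) simp

lemma approxE:
  assumes "f \<simeq> g"
  obtains C where "0 < C" "\<forall>\<^sub>F x in \<Phi>. norm (f x - g x) \<le> C * \<epsilon> x"
proof -
  from assms obtain C where C: "\<forall>\<^sub>F x in \<Phi>. norm (f x - g x) \<le> C * \<epsilon> x"
    unfolding approx_def by blast
  have "\<forall>\<^sub>F x in \<Phi>. norm (f x - g x) \<le> max C 1 * \<epsilon> x"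
    using C nonneg
  proof eventually_elim
    case (elim x)
    have "C * \<epsilon> x \<le> max C 1 * \<epsilon> x" using elim(2) by (intro mult_right_mono) auto
    with elim(1) show ?case by simp
  qed
  then show thesis using that[of "max C 1"] by simp
qed

lemma approx_bddD: "f \<simeq> g \<Longrightarrow> bdd g"
  unfolding approx_def by blast

lemma approxI:
  "\<forall>\<^sub>F x in \<Phi>. norm (f x - g x) \<le> C * \<epsilon> x \<Longrightarrow> bdd g \<Longrightarrow> f \<simeq> g"
  unfolding approx_def by blast

lemma eventually_error_small:
  assumes "0 < c"
  shows "\<forall>\<^sub>F x in \<Phi>. C * \<epsilon> x < c"
proof -
  have "((\<lambda>x. C * \<epsilon> x) \<longlongrightarrow> C * 0) \<Phi>" by (intro tendsto_intros tends)
  then show ?thesis using assms by (auto dest: order_tendstoD)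
qed

lemma approx_dist_small:
  assumes "f \<simeq> g" "0 < c"
  shows "\<forall>\<^sub>F x in \<Phi>. norm (f x - g x) < c"
proof -
  obtain C where "\<forall>\<^sub>F x in \<Phi>. norm (f x - g x) \<le> C * \<epsilon> x" using approxE[OF assms(1)] .
  with eventually_error_small[OF assms(2), of C] show ?thesis by eventually_elim auto
qed

lemma approx_bdd_left:
  assumes "f \<simeq> g" shows "bdd f"
proof -
  obtain B where "\<forall>\<^sub>F x in \<Phi>. norm (g x) \<le> B" using approx_bddD[OF assms] bddE by blast
  with approx_dist_small[OF assms zero_less_one]
  have "\<forall>\<^sub>F x in \<Phi>. norm (f x) \<le> B + 1"
  proof eventually_elim
    case (elim x)
    have "norm (f x) \<le> norm (f x - g x) + norm (g x)" by (metis diff_add_cancel norm_triangle_ineq)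
    with elim show ?case by simp
  qed
  then show ?thesis by (rule bddI)
qed

lemma approx_refl: "bdd f \<Longrightarrow> f \<simeq> f"
  by (rule approxI[of _ _ 0]) auto

lemma approx_const [simp, intro]: "(\<lambda>_. c) \<simeq> (\<lambda>_. c)"
  by (simp add: approx_refl)

lemma approx_sym:
  assumes "f \<simeq> g" shows "g \<simeq> f"
proof -
  obtain C where "\<forall>\<^sub>F x in \<Phi>. norm (f x - g x) \<le> C * \<epsilon> x" using approxE[OF assms] .
  then show ?thesis
    by (intro approxI[of _ _ C] approx_bdd_left[OF assms]) (simp add: norm_minus_commute)
qed

lemma approx_trans [trans]:
  assumes "f \<simeq> g" "g \<simeq> h" shows "f \<simeq> h"
proof -
  obtain C where C: "\<forall>\<^sub>F x in \<Phi>. norm (f x - g x) \<le> C * \<epsilon> x" using approxE[OF assms(1)] .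
  obtain D where D: "\<forall>\<^sub>F x in \<Phi>. norm (g x - h x) \<le> D * \<epsilon> x" using approxE[OF assms(2)] .
  from C D have "\<forall>\<^sub>F x in \<Phi>. norm (f x - h x) \<le> (C + D) * \<epsilon> x"
  proof eventually_elim
    case (elim x)
    have "norm (f x - h x) \<le> norm (f x - g x) + norm (g x - h x)"
      using norm_triangle_ineq[of "f x - g x" "g x - h x"] by simp
    with elim show ?case by (simp add: distrib_right)
  qed
  then show ?thesis using approx_bddD[OF assms(2)] by (rule approxI)
qed

lemma approx_cong:
  assumes "f \<simeq> g" "\<forall>\<^sub>F x in \<Phi>. f x = f' x" "\<forall>\<^sub>F x in \<Phi>. g x = g' x"
  shows "f' \<simeq> g'"
proof -
  obtain C where C: "\<forall>\<^sub>F x in \<Phi>. norm (f x - g x) \<le> C * \<epsilon> x" using approxE[OF assms(1)] .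
  obtain B where B: "\<forall>\<^sub>F x in \<Phi>. norm (g x) \<le> B" using approx_bddD[OF assms(1)] bddE by blast
  from B assms(3) have "\<forall>\<^sub>F x in \<Phi>. norm (g' x) \<le> B" by eventually_elim simp
  moreover from C assms(2,3) have "\<forall>\<^sub>F x in \<Phi>. norm (f' x - g' x) \<le> C * \<epsilon> x" by eventually_elim simp
  ultimately show ?thesis by (intro approxI bddI)
qed

lemma bdd_mult:
  fixes f g :: "'x \<Rightarrow> 'a::real_normed_algebra"
  assumes "bdd f" "bdd g" shows "bdd (\<lambda>x. f x * g x)"
proof -
  obtain A where A: "0 < A" "\<forall>\<^sub>F x in \<Phi>. norm (f x) \<le> A" using bddE[OF assms(1)] .
  obtain B where B: "0 < B" "\<forall>\<^sub>F x in \<Phi>. norm (g x) \<le> B" using bddE[OF assms(2)] .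
  from A(2) B(2) have "\<forall>\<^sub>F x in \<Phi>. norm (f x * g x) \<le> A * B"
  proof eventually_elim
    case (elim x)
    have "norm (f x * g x) \<le> norm (f x) * norm (g x)" by (rule norm_mult_ineq)
    also have "\<dots> \<le> A * B" using elim A(1) by (intro mult_mono) auto
    finally show ?case .
  qed
  then show ?thesis by (rule bddI)
qed

lemma bdd_add:
  assumes "bdd f" "bdd g" shows "bdd (\<lambda>x. f x + g x)"
proof -
  obtain A where A: "0 < A" "\<forall>\<^sub>F x in \<Phi>. norm (f x) \<le> A" using bddE[OF assms(1)] .
  obtain B where B: "0 < B" "\<forall>\<^sub>F x in \<Phi>. norm (g x) \<le> B" using bddE[OF assms(2)] .
  from A(2) B(2) have "\<forall>\<^sub>F x in \<Phi>. norm (f x + g x) \<le> A + B"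
    by eventually_elim (use norm_triangle_mono in blast)
  then show ?thesis by (rule bddI)
qed

lemma approx_add:
  assumes "f \<simeq> f'" "g \<simeq> g'" shows "(\<lambda>x. f x + g x) \<simeq> (\<lambda>x. f' x + g' x)"
proof -
  obtain C where C: "\<forall>\<^sub>F x in \<Phi>. norm (f x - f' x) \<le> C * \<epsilon> x" using approxE[OF assms(1)] .
  obtain D where D: "\<forall>\<^sub>F x in \<Phi>. norm (g x - g' x) \<le> D * \<epsilon> x" using approxE[OF assms(2)] .
  from C D have "\<forall>\<^sub>F x in \<Phi>. norm (f x + g x - (f' x + g' x)) \<le> (C + D) * \<epsilon> x"
  proof eventually_elim
    case (elim x)
    have "norm (f x + g x - (f' x + g' x)) \<le> norm (f x - f' x) + norm (g x - g' x)"
      by (metis add_diff_add norm_triangle_ineq)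
    with elim show ?case by (simp add: distrib_right)
  qed
  then show ?thesis using bdd_add[OF approx_bddD[OF assms(1)] approx_bddD[OF assms(2)]] by (rule approxI)
qed

lemma approx_mult:
  fixes f g f' g' :: "'x \<Rightarrow> 'a::real_normed_algebra"
  assumes "f \<simeq> f'" "g \<simeq> g'" shows "(\<lambda>x. f x * g x) \<simeq> (\<lambda>x. f' x * g' x)"
proof -
  obtain C where C: "0 < C" "\<forall>\<^sub>F x in \<Phi>. norm (f x - f' x) \<le> C * \<epsilon> x" using approxE[OF assms(1)] .
  obtain D where D: "0 < D" "\<forall>\<^sub>F x in \<Phi>. norm (g x - g' x) \<le> D * \<epsilon> x" using approxE[OF assms(2)] .
  obtain A where A: "0 < A" "\<forall>\<^sub>F x in \<Phi>. norm (f x) \<le> A" using bddE[OF approx_bdd_left[OF assms(1)]] .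
  obtain B where B: "0 < B" "\<forall>\<^sub>F x in \<Phi>. norm (g' x) \<le> B" using bddE[OF approx_bddD[OF assms(2)]] .
  from A(2) B(2) C(2) D(2) nonneg
  have "\<forall>\<^sub>F x in \<Phi>. norm (f x * g x - f' x * g' x) \<le> (A * D + C * B) * \<epsilon> x"
  proof eventually_elim
    case (elim x)
    have "f x * g x - f' x * g' x = f x * (g x - g' x) + (f x - f' x) * g' x"
      by (simp add: algebra_simps)
    then have "norm (f x * g x - f' x * g' x) \<le> norm (f x) * norm (g x - g' x) + norm (f x - f' x) * norm (g' x)"
      by (metis add_mono norm_mult_ineq norm_triangle_mono)
    also have "\<dots> \<le> A * (D * \<epsilon> x) + (C * \<epsilon> x) * B"
      using elim A(1) B(1) C(1) D(1) by (intro add_mono mult_mono) auto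
    finally show ?case by (simp add: algebra_simps)
  qed
  then show ?thesis using bdd_mult[OF approx_bddD[OF assms(1)] approx_bddD[OF assms(2)]] by (rule approxI)
qed

lemma approx_linear:
  assumes "f \<simeq> g" "bounded_linear h" shows "(\<lambda>x. h (f x)) \<simeq> (\<lambda>x. h (g x))"
proof -
  obtain K where K: "\<And>x. norm (h x) \<le> norm x * K" and "0 < K"
    using bounded_linear.pos_bounded[OF assms(2)] by blast
  obtain C where C: "\<forall>\<^sub>F x in \<Phi>. norm (f x - g x) \<le> C * \<epsilon> x" using approxE[OF assms(1)] .
  obtain B where B: "\<forall>\<^sub>F x in \<Phi>. norm (g x) \<le> B" using bddE[OF approx_bddD[OF assms(1)]] .
  from C have "\<forall>\<^sub>F x in \<Phi>. norm (h (f x) - h (g x)) \<le> (C * K) * \<epsilon> x"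
  proof eventually_elim
    case (elim x)
    have "norm (h (f x) - h (g x)) \<le> norm (f x - g x) * K"
      using K[of "f x - g x"] bounded_linear.linear[OF assms(2)] by (simp add: linear_diff)
    also have "\<dots> \<le> (C * \<epsilon> x) * K" using elim \<open>0 < K\<close> by (intro mult_right_mono) auto
    finally show ?case by (simp add: algebra_simps)
  qed
  moreover from B have "\<forall>\<^sub>F x in \<Phi>. norm (h (g x)) \<le> B * K"
  proof eventually_elim
    case (elim x)
    with K[of "g x"] \<open>0 < K\<close> show ?case by (meson mult_right_mono order.trans less_imp_le)
  qed
  ultimately show ?thesis by (intro approxI bddI)
qed

lemma approx_diff:
  assumes "f \<simeq> f'" "g \<simeq> g'" shows "(\<lambda>x. f x - g x) \<simeq> (\<lambda>x. f' x - g' x)"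
  using approx_add[OF assms(1) approx_linear[OF assms(2) bounded_linear_minus[OF bounded_linear_ident]]] by simp

lemma approx_diff_zero_iff:
  assumes "bdd g" shows "(\<lambda>x. f x - g x) \<simeq> (\<lambda>_. 0) \<longleftrightarrow> f \<simeq> g"
  using assms unfolding approx_def by auto

lemma approx_sum:
  assumes "\<And>i. i \<in> I \<Longrightarrow> f i \<simeq> g i"
  shows "(\<lambda>x. \<Sum>i\<in>I. f i x) \<simeq> (\<lambda>x. \<Sum>i\<in>I. g i x)"
  using assms by (induction I rule: infinite_finite_induct) (auto intro: approx_add)

lemma approx_prod:
  fixes f g :: "'i \<Rightarrow> 'x \<Rightarrow> 'a::{real_normed_algebra, comm_ring_1}"
  assumes "\<And>i. i \<in> I \<Longrightarrow> f i \<simeq> g i"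
  shows "(\<lambda>x. \<Prod>i\<in>I. f i x) \<simeq> (\<lambda>x. \<Prod>i\<in>I. g i x)"
  using assms by (induction I rule: infinite_finite_induct) (auto intro: approx_mult)

lemma approx_power:
  fixes f g :: "'x \<Rightarrow> 'a::{real_normed_algebra, comm_ring_1}"
  assumes "f \<simeq> g" shows "(\<lambda>x. f x ^ k) \<simeq> (\<lambda>x. g x ^ k)"
  using approx_prod[of "{..<k}" "\<lambda>_. f" "\<lambda>_. g"] assms by simp

lemma approx_norm_zero: "f \<simeq> (\<lambda>_. 0) \<longleftrightarrow> (\<lambda>x. norm (f x)) \<simeq> (\<lambda>_. 0)"
  unfolding approx_def by simp

lemma approx_zero_mono:
  assumes "g \<simeq> (\<lambda>_. 0)" "\<forall>\<^sub>F x in \<Phi>. norm (f x) \<le> norm (g x)"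
  shows "f \<simeq> (\<lambda>_. 0)"
proof -
  obtain C where "\<forall>\<^sub>F x in \<Phi>. norm (g x - 0) \<le> C * \<epsilon> x" using approxE[OF assms(1)] .
  with assms(2) have "\<forall>\<^sub>F x in \<Phi>. norm (f x - 0) \<le> C * \<epsilon> x" by eventually_elim simp
  then show ?thesis by (rule approxI) simp
qed

lemma approx_const_ne:
  assumes "f \<simeq> (\<lambda>_. c)" "c \<noteq> d" shows "\<forall>\<^sub>F x in \<Phi>. f x \<noteq> d"
  using approx_dist_small[OF assms(1), of "norm (d - c)"] assms(2)
  by (auto elim: eventually_mono)

text \<open>
  The right-hand factor \<open>h'\<close> may vary with \<open>x\<close>; this is needed for limits that contain roots of
  unity depending on \<open>x\<close>.
\<close>
lemma approx_cancel:
  fixes f h h' :: "'x \<Rightarrow> 'a::real_normed_field"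
  assumes "f \<simeq> (\<lambda>_. c)" "c \<noteq> 0" "(\<lambda>x. f x * h x) \<simeq> (\<lambda>x. c * h' x)"
  shows "h \<simeq> h'"
proof -
  obtain C where C: "0 < C" "\<forall>\<^sub>F x in \<Phi>. norm (f x - c) \<le> C * \<epsilon> x" using approxE[OF assms(1)] .
  obtain D where D: "0 < D" "\<forall>\<^sub>F x in \<Phi>. norm (f x * h x - c * h' x) \<le> D * \<epsilon> x" using approxE[OF assms(3)] .
  obtain B where B: "0 < B" "\<forall>\<^sub>F x in \<Phi>. norm (c * h' x) \<le> B" using bddE[OF approx_bddD[OF assms(3)]] .
  have nc: "0 < norm c / 2" using assms(2) by simp
  from B(2) have B': "\<forall>\<^sub>F x in \<Phi>. norm (h' x) \<le> B / norm c"
    using assms(2) by (simp add: norm_mult field_simps)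
  from approx_dist_small[OF assms(1) nc] C(2) D(2) B'
  have "\<forall>\<^sub>F x in \<Phi>. norm (h x - h' x) \<le> ((D + C * (B / norm c)) * (2 / norm c)) * \<epsilon> x"
  proof eventually_elim
    case (elim x)
    have "f x * (h x - h' x) = (f x * h x - c * h' x) - (f x - c) * h' x" by (simp add: algebra_simps)
    then have "norm (f x) * norm (h x - h' x) \<le> norm (f x * h x - c * h' x) + norm (f x - c) * norm (h' x)"
      by (metis norm_mult norm_triangle_ineq4)
    also have "\<dots> \<le> D * \<epsilon> x + (C * \<epsilon> x) * (B / norm c)"
      using elim order.trans[OF norm_ge_zero elim(2)] by (intro add_mono mult_mono) auto
    finally have *: "norm (f x) * norm (h x - h' x) \<le> D * \<epsilon> x + (C * \<epsilon> x) * (B / norm c)" .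
    have "norm c \<le> norm (f x) + norm (f x - c)"
      using norm_triangle_ineq4[of "f x" "f x - c"] by simp
    with elim(1) have "norm c / 2 \<le> norm (f x)" by simp
    then have "norm c / 2 * norm (h x - h' x) \<le> norm (f x) * norm (h x - h' x)"
      by (intro mult_right_mono) auto
    from order.trans[OF this *]
    have "norm c / 2 * norm (h x - h' x) \<le> D * \<epsilon> x + (C * \<epsilon> x) * (B / norm c)" .
    then have "norm (h x - h' x) \<le> (D * \<epsilon> x + (C * \<epsilon> x) * (B / norm c)) / (norm c / 2)"
      using nc by (simp only: pos_le_divide_eq mult.commute)
    then show ?case by (simp add: algebra_simps add_divide_distrib)
  qed
  moreover have "bdd h'" using B' by (rule bddI)
  ultimately show ?thesis by (rule approxI)
qed

text \<open>
  Differentiability at the limit gives a Lipschitz bound there, which suffices since the limit does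
  not depend on \<open>x\<close>.
\<close>
lemma approx_field_differentiable:
  fixes g :: "'a::real_normed_field \<Rightarrow> 'a"
  assumes "(g has_field_derivative D) (at c)" "f \<simeq> (\<lambda>_. c)"
  shows "(\<lambda>x. g (f x)) \<simeq> (\<lambda>_. g c)"
proof -
  obtain \<delta> where \<delta>: "0 < \<delta>"
    "\<And>y. norm (y - c) < \<delta> \<Longrightarrow> norm (g y - g c - D * (y - c)) \<le> 1 * norm (y - c)"
    using assms(1) unfolding has_field_derivative_def has_derivative_at_alt by (meson zero_less_one)
  obtain C where C: "\<forall>\<^sub>F x in \<Phi>. norm (f x - c) \<le> C * \<epsilon> x" using approxE[OF assms(2)] .
  from C approx_dist_small[OF assms(2) \<delta>(1)]
  have "\<forall>\<^sub>F x in \<Phi>. norm (g (f x) - g c) \<le> ((1 + norm D) * C) * \<epsilon> x"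
  proof eventually_elim
    case (elim x)
    have "norm (g (f x) - g c) \<le> norm (g (f x) - g c - D * (f x - c)) + norm (D * (f x - c))"
      using norm_triangle_ineq[of "g (f x) - g c - D * (f x - c)" "D * (f x - c)"] by simp
    also have "\<dots> \<le> (1 + norm D) * norm (f x - c)"
      using \<delta>(2)[OF elim(2)] by (simp add: norm_mult distrib_right)
    also have "\<dots> \<le> (1 + norm D) * (C * \<epsilon> x)" using elim(1) by (intro mult_left_mono) auto
    finally show ?case by (simp add: mult.assoc)
  qed
  then show ?thesis by (rule approxI) simp
qed

end

section \<open>Perturbed linear systems and eigenvectors\<close>

text \<open>
  Write \<open>c\<^sub>j\<close> as the \<open>j\<close>-th residual minus the contribution of \<open>M - 1\<close> and sum over \<open>j\<close>: at most half
  of \<open>\<Sum>\<^sub>i |c\<^sub>i|\<close> is absorbed by the perturbation.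
\<close>
lemma near_identity_bound:
  fixes M :: "nat \<Rightarrow> nat \<Rightarrow> 'a::real_normed_field"
  assumes "(\<Sum>i<r. \<Sum>j<r. norm (M i j - (if i = j then 1 else 0))) \<le> 1 / 2"
  shows "(\<Sum>i<r. norm (c i)) \<le> 2 * (\<Sum>j<r. norm (\<Sum>i<r. c i * M i j))"
proof -
  define E where "E i j = norm (M i j - (if i = j then 1 else 0))" for i j
  define S where "S = (\<Sum>i<r. norm (c i))"
  have le: "norm (c i) \<le> S" if "i < r" for i
    unfolding S_def using that by (intro member_le_sum) auto
  have "norm (c j) \<le> norm (\<Sum>i<r. c i * M i j) + (\<Sum>i<r. S * E i j)" if "j < r" for j
  proof -
    have "(\<Sum>i<r. c i * M i j) - (\<Sum>i<r. c i * (M i j - (if i = j then 1 else 0)))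
        = (\<Sum>i<r. if i = j then c i else 0)"
      unfolding sum_subtractf[symmetric] by (intro sum.cong) (auto simp: algebra_simps)
    also have "\<dots> = c j" using that by simp
    finally have "norm (c j) \<le> norm (\<Sum>i<r. c i * M i j) + norm (\<Sum>i<r. c i * (M i j - (if i = j then 1 else 0)))"
      by (metis norm_triangle_ineq4)
    also have "norm (\<Sum>i<r. c i * (M i j - (if i = j then 1 else 0))) \<le> (\<Sum>i<r. S * E i j)"
      by (intro sum_norm_le) (auto simp: norm_mult E_def intro!: mult_right_mono le)
    finally show ?thesis by simp
  qed
  then have "S \<le> (\<Sum>j<r. norm (\<Sum>i<r. c i * M i j) + (\<Sum>i<r. S * E i j))"
    unfolding S_def by (intro sum_mono) simp
  also have "\<dots> = (\<Sum>j<r. norm (\<Sum>i<r. c i * M i j)) + S * (\<Sum>i<r. \<Sum>j<r. E i j)"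
    by (simp add: sum.distrib sum_distrib_left) (rule sum.swap)
  also have "S * (\<Sum>i<r. \<Sum>j<r. E i j) \<le> S * (1 / 2)"
    using assms by (intro mult_left_mono) (auto simp: E_def S_def sum_nonneg)
  finally show ?thesis by (simp add: S_def)
qed

text \<open>
  The rows of the eigenvalue equation bound \<open>(\<tau> - \<Lambda>\<^sub>j) z\<^sub>j\<close> by the perturbation times the largest
  entry \<open>z\<^sub>k\<close>. For \<open>j = k\<close> this locates the eigenvalue near \<open>\<Lambda>\<^sub>k\<close>; for the other \<open>j\<close> it shows that
  the eigenvector is concentrated at \<open>k\<close>.
\<close>
lemma perturbed_diagonal_eigenvector:
  fixes N :: "nat \<Rightarrow> nat \<Rightarrow> 'a::real_normed_field"
  assumes eig: "\<And>j. j < r \<Longrightarrow> (\<Sum>h<r. N j h * z h) = \<tau> * z j"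
    and max: "\<And>h. h < r \<Longrightarrow> norm (z h) \<le> norm (z k)" and "j < r"
  shows "norm (\<tau> - \<Lambda> j) * norm (z j) \<le>
    (\<Sum>j<r. \<Sum>h<r. norm (N j h - (if j = h then \<Lambda> j else 0))) * norm (z k)"
proof -
  let ?E = "\<lambda>j h. norm (N j h - (if j = h then \<Lambda> j else 0))"
  have "(\<tau> - \<Lambda> j) * z j = (\<Sum>h<r. N j h * z h) - (\<Sum>h<r. if j = h then \<Lambda> j * z h else 0)"
    using eig[OF \<open>j < r\<close>] \<open>j < r\<close> by (simp add: left_diff_distrib)
  also have "\<dots> = (\<Sum>h<r. (N j h - (if j = h then \<Lambda> j else 0)) * z h)"
    unfolding sum_subtractf[symmetric] by (intro sum.cong) (auto simp: algebra_simps)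
  finally have "norm (\<tau> - \<Lambda> j) * norm (z j) = norm (\<Sum>h<r. (N j h - (if j = h then \<Lambda> j else 0)) * z h)"
    by (metis norm_mult)
  also have "\<dots> \<le> (\<Sum>h<r. ?E j h * norm (z k))"
    by (intro sum_norm_le) (auto simp: norm_mult intro!: mult_left_mono max)
  also have "\<dots> = (\<Sum>h<r. ?E j h) * norm (z k)" by (simp add: sum_distrib_right)
  also have "\<dots> \<le> (\<Sum>j<r. \<Sum>h<r. ?E j h) * norm (z k)"
    using \<open>j < r\<close> by (intro mult_right_mono member_le_sum[of j "{..<r}" "\<lambda>j. \<Sum>h<r. ?E j h"]) (auto intro: sum_nonneg)
  finally show ?thesis .
qed

text \<open>
  Different eigenvectors of a small perturbation of a diagonal matrix with separated entries
  dominate at different places. Indeed the left eigenvectors \<open>c\<^sub>i\<close> belong to the same eigenvalues,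
  so \<open>c\<^sub>i\<close> is concentrated where \<open>a\<^sub>i\<close> is; if \<open>a\<^sub>i'\<close> were concentrated there as well, the pairing of
  \<open>c\<^sub>i\<close> with \<open>a\<^sub>i'\<close> could not vanish.
\<close>
lemma dominant_entries_distinct:
  fixes a c N :: "nat \<Rightarrow> nat \<Rightarrow> 'a::real_normed_field"
  assumes dual: "\<And>i i'. i < r \<Longrightarrow> i' < r \<Longrightarrow> (\<Sum>j<r. a i j * c i' j) = (if i = i' then 1 else 0)"
    and N: "\<And>j h. N j h = (\<Sum>i<r. \<tau> i * a i j * c i h)"
    and gap: "\<And>j h. j < r \<Longrightarrow> h < r \<Longrightarrow> j \<noteq> h \<Longrightarrow> g \<le> norm (\<Lambda> j - \<Lambda> h)"
    and small: "4 * real r * (\<Sum>j<r. \<Sum>h<r. norm (N j h - (if j = h then \<Lambda> j else 0))) < g"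
    and k: "\<And>i. i < r \<Longrightarrow> k i < r"
    and max: "\<And>i h. i < r \<Longrightarrow> h < r \<Longrightarrow> norm (a i h) \<le> norm (a i (k i))"
  shows "inj_on k {..<r}"
proof (rule inj_onI, rule ccontr)
  fix i i' assume i: "i \<in> {..<r}" "i' \<in> {..<r}" and eq: "k i = k i'" and "i \<noteq> i'"
  then have i: "i < r" "i' < r" by auto
  define E where "E = (\<Sum>j<r. \<Sum>h<r. norm (N j h - (if j = h then \<Lambda> j else 0)))"
  have E0: "0 \<le> E" unfolding E_def by (intro sum_nonneg) auto
  have rE: "4 * real r * E < g" using small by (simp add: E_def)
  have "1 * E \<le> real r * E" using E0 i by (intro mult_right_mono) auto
  with rE have Eg: "4 * E < g" by linarith
  have a_eig: "(\<Sum>h<r. N j h * a i h) = \<tau> i * a i j" if "i < r" for i j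
  proof -
    have "(\<Sum>h<r. N j h * a i h) = (\<Sum>h<r. \<Sum>l<r. \<tau> l * a l j * (a i h * c l h))"
      unfolding N sum_distrib_right by (simp add: mult_ac)
    also have "\<dots> = (\<Sum>l<r. \<tau> l * a l j * (\<Sum>h<r. a i h * c l h))"
      by (subst sum.swap) (simp add: sum_distrib_left)
    also have "\<dots> = (\<Sum>l<r. if l = i then \<tau> l * a l j else 0)"
      using dual that by (intro sum.cong refl) auto
    finally show ?thesis using that by simp
  qed
  have c_eig: "(\<Sum>h<r. N h j * c i h) = \<tau> i * c i j" if "i < r" for i j
  proof -
    have "(\<Sum>h<r. N h j * c i h) = (\<Sum>h<r. \<Sum>l<r. \<tau> l * c l j * (a l h * c i h))"
      unfolding N sum_distrib_right by (simp add: mult_ac)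
    also have "\<dots> = (\<Sum>l<r. \<tau> l * c l j * (\<Sum>h<r. a l h * c i h))"
      by (subst sum.swap) (simp add: sum_distrib_left)
    also have "\<dots> = (\<Sum>l<r. if l = i then \<tau> l * c l j else 0)"
      using dual that by (intro sum.cong refl) auto
    finally show ?thesis using that by simp
  qed
  have nz: "\<exists>h<r. a i h \<noteq> 0 \<and> c i h \<noteq> 0" if "i < r" for i
  proof (rule ccontr)
    assume "\<not> ?thesis"
    then have "(\<Sum>h<r. a i h * c i h) = 0" by (intro sum.neutral) auto
    with dual[OF that that] show False by simp
  qed
  have apos: "0 < norm (a i (k i))" if "i < r" for i
    using nz[OF that] max[OF that] by (metis less_le_trans zero_less_norm_iff)
  have a_near: "norm (\<tau> i - \<Lambda> (k i)) \<le> E" if "i < r" for i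
  proof -
    have "norm (\<tau> i - \<Lambda> (k i)) * norm (a i (k i)) \<le> E * norm (a i (k i))"
      unfolding E_def
      by (rule perturbed_diagonal_eigenvector[OF a_eig[OF that]]) (use max that k in auto)
    then show ?thesis using apos[OF that] by simp
  qed
  obtain l where l: "l < r" "\<And>h. h < r \<Longrightarrow> norm (c i h) \<le> norm (c i l)"
  proof -
    have "finite ((\<lambda>h. norm (c i h)) ` {..<r})" "(\<lambda>h. norm (c i h)) ` {..<r} \<noteq> {}" using i by auto
    from Max_in[OF this] obtain l where "l < r" "Max ((\<lambda>h. norm (c i h)) ` {..<r}) = norm (c i l)" by auto
    then show thesis using that[of l] by (metis Max_ge \<open>finite _\<close> image_eqI lessThan_iff)
  qed
  have cpos: "0 < norm (c i l)" using nz[OF i(1)] l(2) by (metis less_le_trans zero_less_norm_iff)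
  have swap: "(\<Sum>j<r. \<Sum>h<r. norm (N h j - (if j = h then \<Lambda> j else 0))) = E"
    unfolding E_def by (subst sum.swap) (auto intro!: sum.cong)
  have "norm (\<tau> i - \<Lambda> l) * norm (c i l) \<le> E * norm (c i l)"
    unfolding swap[symmetric]
    by (rule perturbed_diagonal_eigenvector[of r "\<lambda>j h. N h j"]) (use c_eig[OF i(1)] l in auto)
  then have c_near: "norm (\<tau> i - \<Lambda> l) \<le> E" using cpos by simp
  have "l = k i"
  proof (rule ccontr)
    assume "l \<noteq> k i"
    then have "g \<le> norm (\<Lambda> l - \<Lambda> (k i))" using gap l k i by blast
    also have "\<dots> \<le> norm (\<tau> i - \<Lambda> (k i)) + norm (\<tau> i - \<Lambda> l)"
      using norm_triangle_ineq4[of "\<tau> i - \<Lambda> (k i)" "\<tau> i - \<Lambda> l"] by simp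
    finally show False using a_near[OF i(1)] c_near Eg E0 by simp
  qed
  define X where "X = norm (a i' (k i)) * norm (c i (k i))"
  have Xpos: "0 < X" unfolding X_def using apos[OF i(2)] cpos \<open>l = k i\<close> eq by simp
  have offdiag: "norm (a i' h * c i h) \<le> (2 * E / g) * X" if h: "h < r" "h \<noteq> k i" for h
  proof -
    have g: "0 < g" using Eg E0 by simp
    have "g \<le> norm (\<Lambda> (k i) - \<Lambda> h)" using gap h k i by metis
    also have "\<dots> \<le> norm (\<tau> i' - \<Lambda> h) + norm (\<tau> i' - \<Lambda> (k i'))"
      using norm_triangle_ineq4[of "\<tau> i' - \<Lambda> h" "\<tau> i' - \<Lambda> (k i')"] eq by simp
    finally have "g / 2 \<le> norm (\<tau> i' - \<Lambda> h)" using a_near[OF i(2)] Eg E0 by simp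
    then have "g / 2 * norm (a i' h) \<le> norm (\<tau> i' - \<Lambda> h) * norm (a i' h)" by (intro mult_right_mono) auto
    also have "\<dots> \<le> E * norm (a i' (k i'))"
      unfolding E_def
      by (rule perturbed_diagonal_eigenvector[OF a_eig[OF i(2)]]) (use max i h in auto)
    finally have "norm (a i' h) \<le> (2 * E / g) * norm (a i' (k i))" using g eq by (simp add: field_simps)
    then have "norm (a i' h) * norm (c i h) \<le> ((2 * E / g) * norm (a i' (k i))) * norm (c i (k i))"
      using l(2)[OF h(1)] \<open>l = k i\<close> E0 g by (intro mult_mono) auto
    then show ?thesis by (simp add: X_def norm_mult mult.assoc)
  qed
  have "0 = (\<Sum>h<r. a i' h * c i h)" using dual[OF i(2,1)] \<open>i \<noteq> i'\<close> by auto
  also have "\<dots> = a i' (k i) * c i (k i) + (\<Sum>h\<in>{..<r} - {k i}. a i' h * c i h)"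
    using k[OF i(1)] by (simp add: sum.remove)
  finally have "X = norm (\<Sum>h\<in>{..<r} - {k i}. a i' h * c i h)"
    by (metis X_def add_eq_0_iff norm_minus_cancel norm_mult)
  also have "\<dots> \<le> (\<Sum>h\<in>{..<r} - {k i}. (2 * E / g) * X)"
    by (intro sum_norm_le offdiag) auto
  also have "\<dots> = real (r - 1) * (2 * E / g) * X" using k[OF i(1)] by simp
  also have "\<dots> \<le> real r * (2 * E / g) * X"
    using Xpos E0 Eg by (intro mult_right_mono) auto
  also have "\<dots> = (4 * real r * E) / g / 2 * X" by simp
  also have "\<dots> < 1 * X"
  proof (intro mult_strict_right_mono Xpos)
    have "(4 * real r * E) / g < 1" using rE Eg E0 by (simp add: field_simps)
    then have "(4 * real r * E) / g / 2 < 1 / 2" by (rule divide_strict_right_mono) simp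
    then show "(4 * real r * E) / g / 2 < 1" by (rule less_trans) simp
  qed
  finally show False by simp
qed

context vanishing_error
begin

lemma approx_norm_sum_zero:
  assumes "\<And>i. i \<in> I \<Longrightarrow> f i \<simeq> (\<lambda>_. 0)"
  shows "(\<lambda>x. \<Sum>i\<in>I. norm (f i x)) \<simeq> (\<lambda>_. 0)"
  using approx_sum[of I "\<lambda>i x. norm (f i x)" "\<lambda>_ _. 0"] assms by (simp add: approx_norm_zero[symmetric])

lemma approx_matrix_error:
  assumes "\<And>i j. i < r \<Longrightarrow> j < r \<Longrightarrow> (\<lambda>x. M x i j) \<simeq> (\<lambda>_. M0 i j)"
  shows "(\<lambda>x. \<Sum>i<r. \<Sum>j<r. norm (M x i j - M0 i j)) \<simeq> (\<lambda>_. 0)"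
proof -
  have "(\<lambda>x. \<Sum>i<r. norm (\<Sum>j<r. norm (M x i j - M0 i j))) \<simeq> (\<lambda>_. 0)"
    by (intro approx_norm_sum_zero) (auto simp: approx_diff_zero_iff assms)
  moreover have "norm (\<Sum>j<r. norm (M x i j - M0 i j)) = (\<Sum>j<r. norm (M x i j - M0 i j))" for x i
    by (simp add: sum_nonneg)
  ultimately show ?thesis by simp
qed

lemma approx_near_identity:
  fixes M :: "'x \<Rightarrow> nat \<Rightarrow> nat \<Rightarrow> 'a::real_normed_field"
  assumes M: "\<And>i j. i < r \<Longrightarrow> j < r \<Longrightarrow> (\<lambda>x. M x i j) \<simeq> (\<lambda>_. if i = j then 1 else 0)"
    and c: "\<And>j. j < r \<Longrightarrow> (\<lambda>x. \<Sum>i<r. c x i * M x i j) \<simeq> (\<lambda>_. 0)" and "i < r"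
  shows "(\<lambda>x. c x i) \<simeq> (\<lambda>_. 0)"
proof (rule approx_zero_mono)
  have "(\<lambda>x. \<Sum>j<r. norm (\<Sum>i<r. c x i * M x i j)) \<simeq> (\<lambda>_. 0)"
    by (intro approx_norm_sum_zero c) simp
  from approx_mult[OF approx_const[of 2] this]
  show "(\<lambda>x. 2 * (\<Sum>j<r. norm (\<Sum>i<r. c x i * M x i j))) \<simeq> (\<lambda>_. 0)" by simp
  have "(\<lambda>x. \<Sum>i<r. \<Sum>j<r. norm (M x i j - (if i = j then 1 else 0))) \<simeq> (\<lambda>_. 0)"
    by (rule approx_matrix_error[OF M])
  then have "\<forall>\<^sub>F x in \<Phi>. norm ((\<Sum>i<r. \<Sum>j<r. norm (M x i j - (if i = j then 1 else 0))) - 0) < 1 / 2"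
    by (rule approx_dist_small) simp
  then show "\<forall>\<^sub>F x in \<Phi>. norm (c x i) \<le> norm (2 * (\<Sum>j<r. norm (\<Sum>i<r. c x i * M x i j)))"
  proof eventually_elim
    case (elim x)
    have "norm (c x i) \<le> (\<Sum>i<r. norm (c x i))" using \<open>i < r\<close> by (intro member_le_sum) auto
    also have "\<dots> \<le> 2 * (\<Sum>j<r. norm (\<Sum>i<r. c x i * M x i j))"
      by (rule near_identity_bound) (use elim in simp)
    finally show ?case by simp
  qed
qed

text \<open>
  Linear least squares problems with full column rank are well posed: if the columns are perturbed
  by \<open>O(\<epsilon>)\<close> and the residual is \<open>O(\<epsilon>)\<close>, so are the coefficients. Applying the dual functionals of
  the unperturbed columns makes the system a square one, close to the identity. Boundedness of the
  coefficients is part of the conclusion.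
\<close>
lemma approx_coefficients:
  fixes u :: "nat \<Rightarrow> 'i \<Rightarrow> 'a::real_normed_field"
  assumes "finite I" "lin_indep r I u"
    and v: "\<And>i y. i < r \<Longrightarrow> y \<in> I \<Longrightarrow> (\<lambda>x. v x i y) \<simeq> (\<lambda>_. u i y)"
    and c: "\<And>y. y \<in> I \<Longrightarrow> (\<lambda>x. \<Sum>i<r. c x i * v x i y) \<simeq> (\<lambda>_. 0)" and "i < r"
  shows "(\<lambda>x. c x i) \<simeq> (\<lambda>_. 0)"
proof -
  obtain \<phi> where \<phi>: "\<And>i j. i < r \<Longrightarrow> j < r \<Longrightarrow> (\<Sum>y\<in>I. \<phi> j y * u i y) = (if i = j then 1 else 0)"
    using dual_functionals[OF assms(1,2)] by blast
  show ?thesis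
  proof (rule approx_near_identity[where M = "\<lambda>x i j. \<Sum>y\<in>I. \<phi> j y * v x i y", OF _ _ \<open>i < r\<close>])
    fix i j assume "i < r" "j < r"
    then have "(\<lambda>x. \<Sum>y\<in>I. \<phi> j y * v x i y) \<simeq> (\<lambda>_. \<Sum>y\<in>I. \<phi> j y * u i y)"
      by (intro approx_sum approx_mult approx_const v)
    with \<phi> \<open>i < r\<close> \<open>j < r\<close> show "(\<lambda>x. \<Sum>y\<in>I. \<phi> j y * v x i y) \<simeq> (\<lambda>_. if i = j then 1 else 0)" by simp
  next
    fix j assume "j < r"
    have "(\<lambda>x. \<Sum>y\<in>I. \<phi> j y * (\<Sum>i<r. c x i * v x i y)) \<simeq> (\<lambda>_. \<Sum>y\<in>I. \<phi> j y * 0)"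
      by (intro approx_sum approx_mult approx_const c)
    moreover have "(\<Sum>y\<in>I. \<phi> j y * (\<Sum>i<r. c x i * v x i y)) = (\<Sum>i<r. c x i * (\<Sum>y\<in>I. \<phi> j y * v x i y))" for x
      unfolding sum_distrib_left by (subst sum.swap) (simp add: mult_ac)
    ultimately show "(\<lambda>x. \<Sum>i<r. c x i * (\<Sum>y\<in>I. \<phi> j y * v x i y)) \<simeq> (\<lambda>_. 0)" by simp
  qed
qed


text \<open>
  The matrices \<open>A\<^sup>T b\<^sub>l\<close> with \<open>A\<^sub>i\<^sub>j = w\<^sub>i a\<^sub>i\<^sub>j\<close> are close to \<open>1\<close>, hence \<open>A\<close> has an inverse \<open>c\<close> and no
  \<open>w\<^sub>i\<close> vanishes. Dividing the second family of matrices by the first yields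
  \<open>N\<^sub>l = A\<^sup>T diag(y\<^sub>i\<^sub>l/w\<^sub>i) c\<close>, which is close to \<open>diag(t\<^sub>j\<^sub>l)\<close> and has eigenvectors \<open>A\<^sub>i\<close> that are the
  same for all \<open>l\<close>. The combination \<open>\<Sum>\<^sub>l \<xi>\<^sub>l N\<^sub>l\<close> separates the dominant entries \<open>k i\<close> of the
  \<open>A\<^sub>i\<close>, and reading the eigenvalue equation of each \<open>N\<^sub>l\<close> at the dominant entry gives the estimate.
  The permutation is the inverse of \<open>k\<close>.
\<close>
lemma simultaneous_diagonalization:
  fixes a :: "'x \<Rightarrow> nat \<Rightarrow> nat \<Rightarrow> complex" and b :: "'l \<Rightarrow> 'x \<Rightarrow> nat \<Rightarrow> nat \<Rightarrow> complex"
    and y :: "'x \<Rightarrow> nat \<Rightarrow> 'l \<Rightarrow> complex" and w :: "'x \<Rightarrow> nat \<Rightarrow> complex"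
  assumes "L \<noteq> {}"
    and unit: "\<And>l j h. l \<in> L \<Longrightarrow> j < r \<Longrightarrow> h < r \<Longrightarrow>
      (\<lambda>x. \<Sum>i<r. w x i * a x i j * b l x i h) \<simeq> (\<lambda>_. if j = h then 1 else 0)"
    and act: "\<And>l j h. l \<in> L \<Longrightarrow> j < r \<Longrightarrow> h < r \<Longrightarrow>
      (\<lambda>x. \<Sum>i<r. y x i l * a x i j * b l x i h) \<simeq> (\<lambda>_. if j = h then t j l else 0)"
    and distinct: "inj_on (\<lambda>j. \<Sum>l\<in>L. \<xi> l * t j l) {..<r}"
  shows "\<exists>\<pi>. (\<forall>x. \<pi> x permutes {..<r}) \<and>
    (\<forall>i<r. \<forall>l\<in>L. (\<lambda>x. y x (\<pi> x i) l / w x (\<pi> x i)) \<simeq> (\<lambda>_. t i l)) \<and>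
    (\<forall>\<^sub>F x in \<Phi>. \<forall>i<r. w x i \<noteq> 0)"
proof -
  define A where "A x i j = w x i * a x i j" for x i j
  define M where "M l x j h = (\<Sum>i<r. A x i j * b l x i h)" for l x j h
  define two_sided where "two_sided x c \<longleftrightarrow>
    (\<forall>j<r. \<forall>h<r. (\<Sum>i<r. c i h * A x i j) = (if j = h then 1 else 0)) \<and>
    (\<forall>i<r. \<forall>i'<r. (\<Sum>j<r. A x i j * c i' j) = (if i = i' then 1 else 0))" for x and c :: "nat \<Rightarrow> nat \<Rightarrow> complex"
  define c where "c x = (SOME c. two_sided x c)" for x
  have M: "(\<lambda>x. M l x j h) \<simeq> (\<lambda>_. if j = h then 1 else 0)" if "l \<in> L" "j < r" "h < r" for l j h
    using unit[OF that] by (simp add: M_def A_def)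
  obtain l0 where l0: "l0 \<in> L" using \<open>L \<noteq> {}\<close> by blast
  have "(\<lambda>x. \<Sum>i<r. \<Sum>j<r. norm (M l0 x i j - (if i = j then 1 else 0))) \<simeq> (\<lambda>_. 0)"
    by (rule approx_matrix_error[OF M[OF l0]])
  then have "\<forall>\<^sub>F x in \<Phi>. norm ((\<Sum>i<r. \<Sum>j<r. norm (M l0 x i j - (if i = j then 1 else 0))) - 0) < 1 / 2"
    by (rule approx_dist_small) simp
  then have dual: "\<forall>\<^sub>F x in \<Phi>. two_sided x (c x)"
  proof eventually_elim
    case (elim x)
    have "lin_indep r {..<r} (\<lambda>j i. A x i j)"
      unfolding lin_indep_def
    proof (intro allI impI)
      fix d j assume d: "\<forall>i\<in>{..<r}. (\<Sum>j<r. d j * A x i j) = 0" and j: "j < r"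
      have "(\<Sum>j<r. d j * M l0 x j h) = 0" for h
      proof -
        have "(\<Sum>j<r. d j * M l0 x j h) = (\<Sum>i<r. (\<Sum>j<r. d j * A x i j) * b l0 x i h)"
          unfolding M_def sum_distrib_left sum_distrib_right by (subst sum.swap) (simp add: mult_ac)
        then show ?thesis using d by simp
      qed
      then have "(\<Sum>j<r. norm (d j)) \<le> 0"
        using near_identity_bound[where r = r and M = "M l0 x" and c = d] elim by simp
      then have "(\<Sum>j<r. norm (d j)) = 0" by (intro antisym sum_nonneg) auto
      then show "d j = 0" using j by (simp add: sum_nonneg_eq_0_iff)
    qed
    then obtain \<phi> where
      "\<forall>i<r. \<forall>j<r. (\<Sum>h<r. \<phi> j h * A x h i) = (if i = j then 1 else 0)"
      "\<forall>g<r. \<forall>h<r. (\<Sum>i<r. \<phi> i g * A x h i) = (if g = h then 1 else 0)"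
      using two_sided_dual[of "{..<r}" r "\<lambda>j i. A x i j"] by auto
    then have "two_sided x (\<lambda>i j. \<phi> j i)"
      unfolding two_sided_def by (auto simp: mult.commute)
    then have "\<exists>c. two_sided x c" by blast
    then show ?case unfolding c_def by (rule someI_ex)
  qed
  have w: "\<forall>\<^sub>F x in \<Phi>. \<forall>i<r. w x i \<noteq> 0"
    using dual
  proof eventually_elim
    case (elim x)
    show ?case
    proof (intro allI impI notI)
      fix i assume "i < r" "w x i = 0"
      then have "(\<Sum>j<r. A x i j * c x i j) = 0" by (simp add: A_def)
      with elim \<open>i < r\<close> show False by (simp add: two_sided_def)
    qed
  qed
  define \<tau> where "\<tau> x i l = y x i l / w x i" for x i l
  define N where "N l x j h = (\<Sum>i<r. \<tau> x i l * A x i j * c x i h)" for l x j h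
  have N: "(\<lambda>x. N l x j h) \<simeq> (\<lambda>_. if j = h then t j l else 0)" if "l \<in> L" "j < r" "h < r" for l j h
  proof -
    have "(\<lambda>x. N l x j h - (if j = h then t j l else 0)) \<simeq> (\<lambda>_. 0)"
    proof (rule approx_near_identity[where M = "M l", OF M[OF \<open>l \<in> L\<close>] _ \<open>h < r\<close>])
      fix g assume g: "g < r"
      have "(\<lambda>x. (\<Sum>i<r. y x i l * a x i j * b l x i g) - t j l * M l x j g) \<simeq>
            (\<lambda>_. (if j = g then t j l else 0) - t j l * (if j = g then 1 else 0))"
        using g that by (intro approx_diff approx_mult act M approx_const)
      then have "(\<lambda>x. (\<Sum>i<r. y x i l * a x i j * b l x i g) - t j l * M l x j g) \<simeq> (\<lambda>_. 0)"
        by (cases "j = g") simp_all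
      then show "(\<lambda>x. \<Sum>h<r. (N l x j h - (if j = h then t j l else 0)) * M l x h g) \<simeq> (\<lambda>_. 0)"
      proof (rule approx_cong)
        show "\<forall>\<^sub>F x in \<Phi>. (\<Sum>i<r. y x i l * a x i j * b l x i g) - t j l * M l x j g =
            (\<Sum>h<r. (N l x j h - (if j = h then t j l else 0)) * M l x h g)"
          using dual w
        proof eventually_elim
          case (elim x)
          have "(\<Sum>h<r. N l x j h * M l x h g)
              = (\<Sum>h<r. \<Sum>i<r. \<Sum>i'<r. \<tau> x i l * A x i j * b l x i' g * (A x i' h * c x i h))"
            unfolding N_def M_def sum_product by (simp add: mult_ac)
          also have "\<dots> = (\<Sum>i<r. \<Sum>i'<r. \<Sum>h<r. \<tau> x i l * A x i j * b l x i' g * (A x i' h * c x i h))"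
            by (subst sum.swap) (intro sum.cong refl sum.swap)
          also have "\<dots> = (\<Sum>i<r. \<Sum>i'<r. if i' = i then \<tau> x i l * A x i j * b l x i' g else 0)"
            unfolding sum_distrib_left[symmetric]
            using elim(1) by (intro sum.cong refl) (auto simp: two_sided_def)
          also have "\<dots> = (\<Sum>i<r. y x i l * a x i j * b l x i g)"
            using elim(2) by (simp add: \<tau>_def A_def)
          moreover have "(\<Sum>h<r. (if j = h then t j l else 0) * M l x h g) = (\<Sum>h<r. if j = h then t j l * M l x h g else 0)"
            by (intro sum.cong) auto
          ultimately show ?case
            using \<open>j < r\<close> by (simp add: left_diff_distrib sum_subtractf)
        qed
      qed simp
    qed
    then show ?thesis by (simp add: approx_diff_zero_iff)
  qed
  define \<Lambda> where "\<Lambda> j = (\<Sum>l\<in>L. \<xi> l * t j l)" for j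
  define N\<xi> where "N\<xi> x j h = (\<Sum>l\<in>L. \<xi> l * N l x j h)" for x j h
  have N\<xi>: "(\<lambda>x. N\<xi> x j h) \<simeq> (\<lambda>_. if j = h then \<Lambda> j else 0)" if "j < r" "h < r" for j h
  proof -
    have "(\<lambda>x. N\<xi> x j h) \<simeq> (\<lambda>_. \<Sum>l\<in>L. \<xi> l * (if j = h then t j l else 0))"
      unfolding N\<xi>_def using that by (intro approx_sum approx_mult approx_const N)
    then show ?thesis by (cases "j = h") (simp_all add: \<Lambda>_def)
  qed
  \<comment> \<open>The element \<open>1\<close> keeps the set nonempty when there is at most one component.\<close>
  define G where "G = insert 1 ((\<lambda>(j, h). norm (\<Lambda> j - \<Lambda> h)) ` {(j, h). j < r \<and> h < r \<and> j \<noteq> h})"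
  have "finite {(j, h). j < r \<and> h < r \<and> j \<noteq> h}"
    by (rule finite_subset[of _ "{..<r} \<times> {..<r}"]) auto
  then have G: "finite G" "G \<noteq> {}" by (auto simp: G_def)
  have Gpos: "0 < Min G"
    using G distinct by (auto simp: G_def \<Lambda>_def inj_on_def)
  have gap: "Min G \<le> norm (\<Lambda> j - \<Lambda> h)" if "j < r" "h < r" "j \<noteq> h" for j h
    using that by (intro Min_le G) (auto simp: G_def)
  \<comment> \<open>The place of the dominant entry of the eigenvector \<open>A x i\<close>.\<close>
  define k where "k x i = (SOME j. j < r \<and> (\<forall>h<r. norm (A x i h) \<le> norm (A x i j)))" for x i
  have k: "k x i < r \<and> (\<forall>h<r. norm (A x i h) \<le> norm (A x i (k x i)))" if "i < r" for x i
  proof -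
    have fin: "finite ((\<lambda>h. norm (A x i h)) ` {..<r})" "(\<lambda>h. norm (A x i h)) ` {..<r} \<noteq> {}"
      using that by auto
    from Max_in[OF this] obtain j where "j < r" "Max ((\<lambda>h. norm (A x i h)) ` {..<r}) = norm (A x i j)" by auto
    then have "j < r \<and> (\<forall>h<r. norm (A x i h) \<le> norm (A x i j))" by (metis Max_ge fin(1) image_eqI lessThan_iff)
    then show ?thesis unfolding k_def by (rule someI)
  qed
  have "(\<lambda>x. \<Sum>j<r. \<Sum>h<r. norm (N\<xi> x j h - (if j = h then \<Lambda> j else 0))) \<simeq> (\<lambda>_. 0)"
    by (rule approx_matrix_error[OF N\<xi>])
  from approx_mult[OF approx_const[of "4 * real r"] this]
  have "\<forall>\<^sub>F x in \<Phi>. norm (4 * real r * (\<Sum>j<r. \<Sum>h<r. norm (N\<xi> x j h - (if j = h then \<Lambda> j else 0))) - 4 * real r * 0) < Min G"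
    by (rule approx_dist_small[OF _ Gpos])
  with dual have inj: "\<forall>\<^sub>F x in \<Phi>. inj_on (k x) {..<r}"
  proof eventually_elim
    case (elim x)
    show ?case
    proof (rule dominant_entries_distinct[where a = "A x" and c = "c x" and N = "N\<xi> x" and g = "Min G"
          and \<Lambda> = \<Lambda> and \<tau> = "\<lambda>i. \<Sum>l\<in>L. \<xi> l * \<tau> x i l"])
      show "N\<xi> x j h = (\<Sum>i<r. (\<Sum>l\<in>L. \<xi> l * \<tau> x i l) * A x i j * c x i h)" for j h
        unfolding N\<xi>_def N_def sum_distrib_left sum_distrib_right by (subst sum.swap) (simp add: mult_ac)
      show "4 * real r * (\<Sum>j<r. \<Sum>h<r. norm (N\<xi> x j h - (if j = h then \<Lambda> j else 0))) < Min G"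
        using elim(2) by simp
    qed (use elim(1) k gap in \<open>auto simp: two_sided_def\<close>)
  qed
  define \<pi> where "\<pi> x i = (if inj_on (k x) {..<r} \<and> i < r then inv_into {..<r} (k x) i else i)" for x i
  have bij: "bij_betw (k x) {..<r} {..<r}" if "inj_on (k x) {..<r}" for x
  proof -
    have "k x ` {..<r} = {..<r}" using that k by (intro endo_inj_surj) auto
    with that show ?thesis by (simp add: bij_betw_def)
  qed
  have perm: "\<pi> x permutes {..<r}" for x
  proof (rule bij_imp_permutes)
    show "bij_betw (\<pi> x) {..<r} {..<r}"
    proof (cases "inj_on (k x) {..<r}")
      case True
      from bij_betw_inv_into[OF bij[OF this]] show ?thesis
        by (rule bij_betw_cong[THEN iffD1, rotated]) (simp add: \<pi>_def True)
    next
      case False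
      then have "\<pi> x = id" by (auto simp: \<pi>_def)
      then show ?thesis by simp
    qed
  qed (auto simp: \<pi>_def)
  have k\<pi>: "k x (\<pi> x i) = i" if "inj_on (k x) {..<r}" "i < r" for x i
    using bij_betw_inv_into_right[OF bij[OF that(1)]] that by (simp add: \<pi>_def)
  have \<tau>: "(\<lambda>x. \<tau> x (\<pi> x i) l) \<simeq> (\<lambda>_. t i l)" if "i < r" "l \<in> L" for i l
  proof -
    have "(\<lambda>x. \<tau> x (\<pi> x i) l - t i l) \<simeq> (\<lambda>_. 0)"
    proof (rule approx_zero_mono)
      show "(\<lambda>x. \<Sum>j<r. \<Sum>h<r. norm (N l x j h - (if j = h then t j l else 0))) \<simeq> (\<lambda>_. 0)"
        by (rule approx_matrix_error[OF N[OF \<open>l \<in> L\<close>]])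
      show "\<forall>\<^sub>F x in \<Phi>. norm (\<tau> x (\<pi> x i) l - t i l) \<le> norm (\<Sum>j<r. \<Sum>h<r. norm (N l x j h - (if j = h then t j l else 0)))"
        using inj dual
      proof eventually_elim
        case (elim x)
        define s where "s = \<pi> x i"
        have s: "s < r" "k x s = i" using permutes_in_image[OF perm[of x]] k\<pi>[OF elim(1)] \<open>i < r\<close> by (auto simp: s_def)
        have eig: "(\<Sum>h<r. N l x j h * A x s h) = \<tau> x s l * A x s j" for j
        proof -
          have "(\<Sum>h<r. N l x j h * A x s h) = (\<Sum>h<r. \<Sum>g<r. \<tau> x g l * A x g j * (A x s h * c x g h))"
            unfolding N_def sum_distrib_right by (simp add: mult_ac)
          also have "\<dots> = (\<Sum>g<r. \<tau> x g l * A x g j * (\<Sum>h<r. A x s h * c x g h))"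
            by (subst sum.swap) (simp add: sum_distrib_left)
          also have "\<dots> = (\<Sum>g<r. if g = s then \<tau> x g l * A x g j else 0)"
            using elim(2) s by (intro sum.cong refl) (auto simp: two_sided_def)
          finally show ?thesis using s by simp
        qed
        have "norm (\<tau> x s l - t i l) * norm (A x s i) \<le>
          (\<Sum>j<r. \<Sum>h<r. norm (N l x j h - (if j = h then t j l else 0))) * norm (A x s i)"
          by (rule perturbed_diagonal_eigenvector[where z = "A x s" and k = i]) (use eig k[OF s(1), of x] s \<open>i < r\<close> in auto)
        moreover have "A x s i \<noteq> 0"
        proof
          assume "A x s i = 0"
          then have "A x s h = 0" if "h < r" for h using k[OF s(1), of x] s(2) that by auto
          then have "(\<Sum>j<r. A x s j * c x s j) = 0" by simp
          with elim(2) s(1) show False by (simp add: two_sided_def)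
        qed
        ultimately show ?case by (simp add: s_def sum_nonneg)
      qed
    qed
    then show ?thesis by (simp add: approx_diff_zero_iff)
  qed
  have "\<forall>i<r. \<forall>l\<in>L. (\<lambda>x. y x (\<pi> x i) l / w x (\<pi> x i)) \<simeq> (\<lambda>_. t i l)"
    using \<tau> by (simp add: \<tau>_def)
  with perm w show ?thesis by blast
qed

end

section \<open>Stability of incomplete symmetric decompositions\<close>
lemma nonzero_product_avoiding:
  assumes "S \<subseteq> K" "card S = p" "prod f S \<noteq> 0" "1 \<le> p"
  shows "\<exists>\<beta>. \<beta> \<subseteq> K - {j} \<and> card \<beta> + 1 = p \<and> prod f \<beta> \<noteq> (0 :: 'a :: idom)"
proof -
  have fin: "finite S" using assms(2,4) by (metis card.infinite not_one_le_zero)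
  from assms(2,4) have "S \<noteq> {}" by auto
  then obtain e where e: "e \<in> S" "j \<in> S \<longrightarrow> e = j" by blast
  have "S - {e} \<subseteq> K - {j}" "card (S - {e}) + 1 = p" using assms e fin by auto
  moreover have "prod f (S - {e}) \<noteq> 0" using assms(3) fin by (auto simp: prod_zero_iff)
  ultimately show ?thesis by blast
qed

lemma norm_root_of_unity:
  fixes z :: complex
  assumes "z ^ m = 1" "0 < m"
  shows "norm z = 1"
proof -
  have "norm z ^ m = 1 ^ m" using assms(1) by (metis norm_one norm_power power_one)
  then show ?thesis using assms(2) by (metis norm_ge_zero power_eq_imp_eq_base zero_le_one)
qed

lemma prod_times_disjoint:
  assumes "A \<inter> B = {}" "finite A" "finite B"
  shows "prod f A * prod f B = prod f (A \<union> B)"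
  using assms by (simp add: prod.union_disjoint)

context vanishing_error
begin

text \<open>
  If the ratios \<open>q'\<^sub>i\<^sub>l/q'\<^sub>i\<^sub>0\<close> with \<open>l > k\<close> are already known, then for a fixed index set \<open>A\<close> of size
  \<open>p + 1\<close> the entries at \<open>A \<union> T\<close>, as \<open>T\<close> varies, form a linear system with known matrix for the
  numbers \<open>q'\<^sub>i\<^sub>0\<^bsup>m-p-1\<^esup> \<Prod>\<^bsub>a\<in>A\<^esub> q'\<^sub>i\<^sub>a\<close> (\<open>block\<close>). Taking \<open>A = {0, f} \<union> \<beta>\<close> with \<open>f = l > k\<close> and \<open>q\<^sub>i\<^sub>l \<noteq> 0\<close>
  determines the factor \<open>H'\<close> that does not involve \<open>f\<close>; taking \<open>f = j \<le> k\<close> then determines the ratio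
  \<open>q'\<^sub>i\<^sub>j/q'\<^sub>i\<^sub>0\<close> (\<open>core\<close>). The detour over \<open>l\<close> avoids the need for a nonvanishing product of \<open>p\<close>
  coordinates among \<open>1, \<dots>, k\<close> without \<open>j\<close>, which does not exist if \<open>k = p\<close>.
\<close>
lemma aligned_decomposition:
  fixes q :: "nat \<Rightarrow> nat \<Rightarrow> complex" and q' :: "'x \<Rightarrow> nat \<Rightarrow> nat \<Rightarrow> complex"
  assumes near: "\<And>S. S \<subseteq> {..n} \<Longrightarrow> card S = m \<Longrightarrow>
      (\<lambda>x. \<Sum>i<r. prod (q' x i) S) \<simeq> (\<lambda>_. \<Sum>i<r. prod (q i) S)"
    and lead: "\<And>i. i < r \<Longrightarrow> q i 0 \<noteq> 0"
    and lead': "\<forall>\<^sub>F x in \<Phi>. \<forall>i<r. q' x i 0 \<noteq> 0"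
    and ratio: "\<And>i l. i < r \<Longrightarrow> l \<in> {k+1..n} \<Longrightarrow> (\<lambda>x. q' x i l / q' x i 0) \<simeq> (\<lambda>_. q i l / q i 0)"
    and p: "1 \<le> p" "p + 2 \<le> m" and "k < n"
    and B: "\<And>i. i < r \<Longrightarrow> \<exists>S. S \<subseteq> {1..k} \<and> card S = p \<and> prod (q i) S \<noteq> 0"
    and O: "\<And>l. l \<in> {k+1..n} \<Longrightarrow>
      lin_indep r {T. T \<subseteq> {k+1..n} - {l} \<and> card T = m - p - 1} (\<lambda>i T. prod (q i) T)"
  shows "\<exists>\<zeta>. (\<forall>x i. \<zeta> x i ^ m = 1) \<and>
    (\<forall>i<r. \<forall>j\<le>n. (\<lambda>x. q' x i j) \<simeq> (\<lambda>x. \<zeta> x i * q i j))"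
proof -
  define v where "v i j = q i j / q i 0" for i j
  define v' where "v' x i j = q' x i j / q' x i 0" for x i j
  define s where "s = m - p - 1"
  have s: "m = s + p + 1" "1 \<le> s" using p by (auto simp: s_def)
  have ratio: "(\<lambda>x. v' x i l) \<simeq> (\<lambda>_. v i l)" if "i < r" "l \<in> {k+1..n}" for i l
    using ratio[OF that] by (simp add: v_def v'_def)
  have v: "prod (q i) T = q i 0 ^ card T * prod (v i) T" if "i < r" for i T
    using lead[OF that] by (simp add: v_def prod_dividef field_simps)
  have v': "\<forall>\<^sub>F x in \<Phi>. \<forall>i<r. \<forall>T. prod (q' x i) T = q' x i 0 ^ card T * prod (v' x i) T"
    using lead' by eventually_elim (simp add: v'_def prod_dividef)
  have block: "(\<lambda>x. q' x i 0 ^ s * prod (q' x i) A) \<simeq> (\<lambda>_. q i 0 ^ s * prod (q i) A)"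
    if A: "A \<subseteq> insert l {..k}" "card A = p + 1" and l: "l \<in> {k+1..n}" and "i < r" for A l i
  proof -
    let ?O = "{T. T \<subseteq> {k+1..n} - {l} \<and> card T = s}"
    define c where "c x i = q' x i 0 ^ s * prod (q' x i) A - q i 0 ^ s * prod (q i) A" for x i
    have finA: "finite A" using A(2) by (metis Suc_eq_plus1 card.infinite nat.distinct(1))
    have "(\<lambda>x. c x i) \<simeq> (\<lambda>_. 0)"
    proof (rule approx_coefficients[where I = ?O and u = "\<lambda>i T. prod (v i) T" and v = "\<lambda>x i T. prod (v' x i) T",
            OF _ _ _ _ \<open>i < r\<close>])
      show "finite ?O" by (rule finite_subset[of _ "Pow {k+1..n}"]) auto
      show "lin_indep r ?O (\<lambda>i T. prod (v i) T)"
      proof (rule lin_indep_scale[where b = "\<lambda>i. inverse (q i 0 ^ s)"])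
        show "lin_indep r ?O (\<lambda>i T. prod (q i) T)" using O[OF l] by (simp add: s_def)
      qed (use lead v in auto)
    next
      fix i T assume "i < r" "T \<in> ?O"
      then show "(\<lambda>x. prod (v' x i) T) \<simeq> (\<lambda>_. prod (v i) T)"
        by (intro approx_prod ratio) auto
    next
      fix T assume T: "T \<in> ?O"
      have finT: "finite T" using T by (auto intro: finite_subset)
      have "insert l {..k} \<inter> ({k+1..n} - {l}) = {}" by auto
      then have disj: "A \<inter> T = {}" using A T by blast
      have sub: "A \<union> T \<subseteq> {..n}" using A T l \<open>k < n\<close> by auto
      have card: "card (A \<union> T) = m" using A T disj finA finT s by (simp add: card_Un_disjoint)
      have "(\<lambda>x. (\<Sum>i<r. prod (q' x i) (A \<union> T)) - (\<Sum>i<r. q i 0 ^ s * prod (q i) A * prod (v' x i) T)) \<simeq>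
            (\<lambda>_. (\<Sum>i<r. prod (q i) (A \<union> T)) - (\<Sum>i<r. q i 0 ^ s * prod (q i) A * prod (v i) T))"
        using T by (intro approx_diff near[OF sub card] approx_sum approx_mult approx_const approx_prod ratio) auto
      also have "(\<Sum>i<r. prod (q i) (A \<union> T)) = (\<Sum>i<r. q i 0 ^ s * prod (q i) A * prod (v i) T)"
        using v T by (intro sum.cong refl)
          (simp add: prod_times_disjoint[OF disj finA finT, symmetric])
      finally have "(\<lambda>x. (\<Sum>i<r. prod (q' x i) (A \<union> T)) - (\<Sum>i<r. q i 0 ^ s * prod (q i) A * prod (v' x i) T)) \<simeq> (\<lambda>_. 0)"
        by simp
      then show "(\<lambda>x. \<Sum>i<r. c x i * prod (v' x i) T) \<simeq> (\<lambda>_. 0)"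
      proof (rule approx_cong)
        show "\<forall>\<^sub>F x in \<Phi>. (\<Sum>i<r. prod (q' x i) (A \<union> T)) - (\<Sum>i<r. q i 0 ^ s * prod (q i) A * prod (v' x i) T)
            = (\<Sum>i<r. c x i * prod (v' x i) T)"
          using v'
        proof eventually_elim
          case (elim x)
          have "prod (q' x i) (A \<union> T) = q' x i 0 ^ s * prod (q' x i) A * prod (v' x i) T" if "i < r" for i
          proof -
            have "prod (q' x i) (A \<union> T) = prod (q' x i) A * prod (q' x i) T"
              by (simp add: prod_times_disjoint[OF disj finA finT])
            also have "prod (q' x i) T = q' x i 0 ^ s * prod (v' x i) T" using elim that T by auto
            finally show ?thesis by simp
          qed
          then show ?case by (simp add: c_def left_diff_distrib sum_subtractf)
        qed
      qed simp
    qed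
    then show ?thesis by (simp add: c_def approx_diff_zero_iff)
  qed
  have nonzero_above: "\<exists>l\<in>{k+1..n}. v i l \<noteq> 0" if "i < r" for i
  proof -
    have "k + 1 \<in> {k+1..n}" using \<open>k < n\<close> by simp
    from lin_indep_nonzero[OF O[OF this] that] obtain T
      where T: "T \<subseteq> {k+1..n}" "card T = s" "prod (q i) T \<noteq> 0" by (auto simp: s_def)
    have "finite T" using T(1) finite_subset by blast
    have "T \<noteq> {}" using T(2) s(2) by auto
    then obtain l where l: "l \<in> T" by blast
    with T(3) \<open>finite T\<close> have "q i l \<noteq> 0" by (auto simp: prod_zero_iff)
    with l T(1) lead[OF that] show ?thesis by (intro bexI[of _ l]) (auto simp: v_def)
  qed
  have k1: "1 \<le> k" if i: "i < r" for i
  proof -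
    obtain S where "S \<subseteq> {1..k}" "card S = p" using B[OF i] by blast
    have "card S \<le> card {1..k}" using \<open>S \<subseteq> {1..k}\<close> by (intro card_mono) auto
    with p \<open>card S = p\<close> show ?thesis by simp
  qed
  have core: "(\<lambda>x. v' x i j) \<simeq> (\<lambda>_. v i j) \<and> (\<lambda>x. q' x i 0 ^ (s + 2) * prod (q' x i) \<beta>) \<simeq> (\<lambda>_. q i 0 ^ (s + 2) * prod (q i) \<beta>)
      \<and> prod (q i) \<beta> \<noteq> 0"
    if i: "i < r" and j: "j \<in> {1..k}" and \<beta>: "\<beta> \<subseteq> {1..k} - {j}" "card \<beta> + 1 = p" "prod (q i) \<beta> \<noteq> 0" for i j \<beta>
  proof -
    have fin: "finite \<beta>" using \<beta>(1) finite_subset by blast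
    obtain l where l: "l \<in> {k+1..n}" "v i l \<noteq> 0" using nonzero_above[OF i] by blast
    define H' where "H' x = q' x i 0 ^ (s + 2) * prod (q' x i) \<beta>" for x
    define H where "H = q i 0 ^ (s + 2) * prod (q i) \<beta>"
    have key: "(\<lambda>x. v' x i f * H' x) \<simeq> (\<lambda>_. v i f * H)" if "f = l \<or> f = j" for f
    proof -
      have f: "f \<notin> \<beta>" "f \<noteq> 0" using that l j \<beta>(1) by auto
      have 0: "0 \<notin> insert f \<beta>" using f \<beta>(1) by auto
      have "(\<lambda>x. q' x i 0 ^ s * prod (q' x i) (insert 0 (insert f \<beta>))) \<simeq>
          (\<lambda>_. q i 0 ^ s * prod (q i) (insert 0 (insert f \<beta>)))"
      proof (rule block[OF _ _ l(1) i])
        show "insert 0 (insert f \<beta>) \<subseteq> insert l {..k}" using that j \<beta>(1) by auto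
        show "card (insert 0 (insert f \<beta>)) = p + 1" using 0 f fin \<beta>(2) by simp
      qed
      then show ?thesis
      proof (rule approx_cong)
        show "\<forall>\<^sub>F x in \<Phi>. q' x i 0 ^ s * prod (q' x i) (insert 0 (insert f \<beta>)) = v' x i f * H' x"
          using lead'
        proof eventually_elim
          case (elim x)
          with i have "q' x i 0 \<noteq> 0" by blast
          then show ?case using 0 f fin by (simp add: v'_def H'_def power_add power2_eq_square)
        qed
        show "\<forall>\<^sub>F x in \<Phi>. q i 0 ^ s * prod (q i) (insert 0 (insert f \<beta>)) = v i f * H"
          using 0 f fin lead[OF i] by (simp add: v_def H_def power_add power2_eq_square)
      qed
    qed
    have "H' \<simeq> (\<lambda>_. H)"
      by (rule approx_cancel[OF ratio[OF i l(1)] l(2)]) (use key in blast)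
    moreover have "H \<noteq> 0" using lead[OF i] \<beta>(3) by (simp add: H_def)
    moreover have "(\<lambda>x. H' x * v' x i j) \<simeq> (\<lambda>_. H * v i j)"
      using key[of j] by (simp add: mult.commute)
    ultimately have "(\<lambda>x. v' x i j) \<simeq> (\<lambda>_. v i j)" by (rule approx_cancel)
    with \<open>H' \<simeq> (\<lambda>_. H)\<close> \<beta>(3) show ?thesis unfolding H'_def H_def by blast
  qed
  have choose: "\<exists>\<beta>. \<beta> \<subseteq> {1..k} - {j} \<and> card \<beta> + 1 = p \<and> prod (q i) \<beta> \<noteq> 0" if i: "i < r" for i j
  proof -
    obtain S where "S \<subseteq> {1..k}" "card S = p" "prod (q i) S \<noteq> 0" using B[OF i] by blast
    then show ?thesis using p(1) by (rule nonzero_product_avoiding)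
  qed
  have all_ratio: "(\<lambda>x. v' x i j) \<simeq> (\<lambda>_. v i j)" if ij: "i < r" "j \<in> {1..n}" for i j
  proof (cases "j \<le> k")
    case True
    obtain \<beta> where "\<beta> \<subseteq> {1..k} - {j}" "card \<beta> + 1 = p" "prod (q i) \<beta> \<noteq> 0"
      using choose[OF ij(1)] by blast
    moreover have "j \<in> {1..k}" using True that(2) by simp
    ultimately show ?thesis using core[OF that(1)] by blast
  next
    case False
    then show ?thesis using that by (intro ratio) auto
  qed
  have lead_power: "(\<lambda>x. q' x i 0 ^ m) \<simeq> (\<lambda>_. q i 0 ^ m)" if i: "i < r" for i
  proof -
    obtain \<beta> where \<beta>: "\<beta> \<subseteq> {1..k} - {1}" "card \<beta> + 1 = p" "prod (q i) \<beta> \<noteq> 0" using choose[OF i] by blast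
    have m: "s + 2 + card \<beta> = m" using \<beta>(2) s by simp
    have "1 \<in> {1..k}" using k1[OF i] by simp
    then have c: "(\<lambda>x. q' x i 0 ^ (s + 2) * prod (q' x i) \<beta>) \<simeq> (\<lambda>_. q i 0 ^ (s + 2) * prod (q i) \<beta>)"
      using core[OF i _ \<beta>, THEN conjunct2, THEN conjunct1] by simp
    have exponents: "z ^ (s + 2) * (z ^ card \<beta> * w) = w * z ^ m" for z w :: complex
    proof -
      have "z ^ m = z ^ (s + 2) * z ^ card \<beta>" by (subst m[symmetric], rule power_add)
      then show ?thesis by simp
    qed
    have product: "(\<lambda>x. prod (v' x i) \<beta> * q' x i 0 ^ m) \<simeq> (\<lambda>_. prod (v i) \<beta> * q i 0 ^ m)"
    proof (rule approx_cong[OF c])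
      show "\<forall>\<^sub>F x in \<Phi>. q' x i 0 ^ (s + 2) * prod (q' x i) \<beta> = prod (v' x i) \<beta> * q' x i 0 ^ m"
      proof (rule eventually_mono[OF v'])
        fix x assume "\<forall>i<r. \<forall>T. prod (q' x i) T = q' x i 0 ^ card T * prod (v' x i) T"
        from this[rule_format, OF i, of \<beta>] show "q' x i 0 ^ (s + 2) * prod (q' x i) \<beta> = prod (v' x i) \<beta> * q' x i 0 ^ m"
          by (simp only: exponents)
      qed
      show "\<forall>\<^sub>F x in \<Phi>. q i 0 ^ (s + 2) * prod (q i) \<beta> = prod (v i) \<beta> * q i 0 ^ m"
        unfolding v[OF i, of \<beta>] by (intro always_eventually allI exponents)
    qed
    have "(\<lambda>x. prod (v' x i) \<beta>) \<simeq> (\<lambda>_. prod (v i) \<beta>)"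
      using \<beta>(1) \<open>k < n\<close> by (intro approx_prod all_ratio i) auto
    moreover have "prod (v i) \<beta> \<noteq> 0" using \<beta>(3) unfolding v[OF i, of \<beta>] by simp
    ultimately show ?thesis using product by (rule approx_cancel)
  qed
  have m0: "0 < m" using s by simp
  define w where "w x i = q' x i 0 ^ m / q i 0 ^ m" for x i
  \<comment> \<open>The principal \<open>m\<close>-th root is differentiable at \<open>1\<close>, the limit of \<open>w\<close>; the quotient of the leading
    entries by it is the root of unity. The case distinction makes \<open>\<zeta>\<close> a root of unity everywhere.\<close>
  define \<rho> where "\<rho> z = exp (Ln z / of_nat m)" for z
  have \<rho>: "\<rho> z ^ m = z" if "z \<noteq> 0" for z
    using that m0 by (simp add: \<rho>_def exp_of_nat_mult[symmetric])
  define \<zeta> where "\<zeta> x i = (if w x i \<noteq> 0 \<and> q i 0 \<noteq> 0 then q' x i 0 / (q i 0 * \<rho> (w x i)) else 1)" for x i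
  have \<zeta>: "\<zeta> x i ^ m = 1" for x i
    by (auto simp: \<zeta>_def power_divide power_mult_distrib \<rho>) (simp add: w_def)
  have norm\<zeta>: "norm (\<zeta> x i) = 1" for x i using norm_root_of_unity[OF \<zeta> m0] .
  have bdd: "bdd (\<lambda>x. \<zeta> x i * q i j)" for i j
    by (rule bddI[of _ "norm (q i j)"]) (simp add: norm_mult norm\<zeta>)
  have lead_root: "(\<lambda>x. q' x i 0) \<simeq> (\<lambda>x. \<zeta> x i * q i 0)" if i: "i < r" for i
  proof -
    have "(\<lambda>x. q' x i 0 ^ m * inverse (q i 0 ^ m)) \<simeq> (\<lambda>_. q i 0 ^ m * inverse (q i 0 ^ m))"
      by (intro approx_mult lead_power i approx_const)
    then have w: "(\<lambda>x. w x i) \<simeq> (\<lambda>_. 1)" using lead[OF i] by (simp add: w_def divide_inverse)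
    have "(\<rho> has_field_derivative exp (Ln 1 / of_nat m) * (inverse 1 / of_nat m)) (at 1)"
      unfolding \<rho>_def using m0 by (auto intro!: derivative_eq_intros)
    from approx_field_differentiable[OF this w] have "(\<lambda>x. \<rho> (w x i)) \<simeq> (\<lambda>_. 1)" by (simp add: \<rho>_def)
    from approx_mult[OF this approx_refl[OF bdd[of i 0]]]
    have "(\<lambda>x. \<rho> (w x i) * (\<zeta> x i * q i 0)) \<simeq> (\<lambda>x. \<zeta> x i * q i 0)" by simp
    then show ?thesis
    proof (rule approx_cong)
      show "\<forall>\<^sub>F x in \<Phi>. \<rho> (w x i) * (\<zeta> x i * q i 0) = q' x i 0"
        using approx_const_ne[OF w one_neq_zero]
      proof eventually_elim
        case (elim x)
        have "\<rho> (w x i) \<noteq> 0" by (simp add: \<rho>_def)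
        with elim lead[OF i] show ?case by (simp add: \<zeta>_def)
      qed
    qed simp
  qed
  have "(\<lambda>x. q' x i j) \<simeq> (\<lambda>x. \<zeta> x i * q i j)" if i: "i < r" and j: "j \<le> n" for i j
  proof (cases "j = 0")
    case True
    then show ?thesis using lead_root[OF i] by simp
  next
    case False
    have "(\<lambda>x. v' x i j * q' x i 0) \<simeq> (\<lambda>x. v i j * (\<zeta> x i * q i 0))"
      using False j by (intro approx_mult all_ratio lead_root i) auto
    then show ?thesis
    proof (rule approx_cong)
      show "\<forall>\<^sub>F x in \<Phi>. v' x i j * q' x i 0 = q' x i j"
        using lead' by eventually_elim (use i in \<open>simp add: v'_def\<close>)
    qed (use lead[OF i] in \<open>simp add: v_def\<close>)
  qed
  with \<zeta> show ?thesis by blast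
qed


text \<open>
  The entries at \<open>{f} \<union> S \<union> T\<close> with \<open>S \<in> \<B>\<close>, \<open>T \<in> \<O> l\<close> and \<open>f = 0\<close> or \<open>f = l\<close> have pairwise distinct
  indices. Contracting them with functionals dual to \<open>q\<close> produces exactly the matrices required by
  \<open>simultaneous_diagonalization\<close>. The competitors \<open>q'\<close> are arbitrary; in particular their leading
  entries may vanish at first.
\<close>
lemma decomposition_stability:
  fixes q :: "nat \<Rightarrow> nat \<Rightarrow> complex" and q' :: "'x \<Rightarrow> nat \<Rightarrow> nat \<Rightarrow> complex"
  assumes near: "\<And>S. S \<subseteq> {..n} \<Longrightarrow> card S = m \<Longrightarrow>
      (\<lambda>x. \<Sum>i<r. prod (q' x i) S) \<simeq> (\<lambda>_. \<Sum>i<r. prod (q i) S)"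
    and lead: "\<And>i. i < r \<Longrightarrow> q i 0 \<noteq> 0"
    and p: "1 \<le> p" "p + 2 \<le> m" and "k < n"
    and B: "\<B> \<subseteq> {S. S \<subseteq> {1..k} \<and> card S = p}" "lin_indep r \<B> (\<lambda>i S. prod (q i) S)"
    and O: "\<And>l. l \<in> {k+1..n} \<Longrightarrow>
      lin_indep r {T. T \<subseteq> {k+1..n} - {l} \<and> card T = m - p - 1} (\<lambda>i T. prod (q i) T)"
    and distinct: "inj_on (\<lambda>i. \<Sum>l=k+1..n. \<xi> l * (q i l / q i 0)) {..<r}"
  shows "\<exists>\<pi> \<zeta>. (\<forall>x. \<pi> x permutes {..<r}) \<and> (\<forall>x i. \<zeta> x i ^ m = 1) \<and>
    (\<forall>i<r. \<forall>j\<le>n. (\<lambda>x. q' x (\<pi> x i) j) \<simeq> (\<lambda>x. \<zeta> x i * q i j))"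
proof -
  define \<O> where "\<O> l = {T. T \<subseteq> {k+1..n} - {l} \<and> card T = m - p - 1}" for l
  have finB: "finite \<B>" using B(1) by (rule finite_subset) simp
  have finO: "finite (\<O> l)" for l unfolding \<O>_def by (rule finite_subset[of _ "Pow {k+1..n}"]) auto
  obtain \<psi> where \<psi>: "\<And>i j. i < r \<Longrightarrow> j < r \<Longrightarrow> (\<Sum>S\<in>\<B>. \<psi> j S * prod (q i) S) = (if i = j then 1 else 0)"
    using dual_functionals[OF finB B(2)] by blast
  have "\<forall>l\<in>{k+1..n}. \<exists>\<phi>. \<forall>i<r. \<forall>j<r. (\<Sum>T\<in>\<O> l. \<phi> j T * prod (q i) T) = (if i = j then 1 else 0)"
    using dual_functionals[OF finO O[folded \<O>_def]] by blast
  from bchoice[OF this] obtain \<phi> where \<phi>: "\<And>l i j. l \<in> {k+1..n} \<Longrightarrow> i < r \<Longrightarrow> j < r \<Longrightarrow>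
      (\<Sum>T\<in>\<O> l. \<phi> l j T * prod (q i) T) = (if i = j then 1 else 0)"
    by blast
  define a where "a Q i j = (\<Sum>S\<in>\<B>. \<psi> j S * prod (Q i) S) / q j 0" for Q :: "nat \<Rightarrow> nat \<Rightarrow> complex" and i j
  define b where "b l Q i h = (\<Sum>T\<in>\<O> l. \<phi> l h T * prod (Q i) T)" for l and Q :: "nat \<Rightarrow> nat \<Rightarrow> complex" and i h
  have pairing: "(\<lambda>x. \<Sum>i<r. q' x i f * a (q' x) i j * b l (q' x) i h) \<simeq> (\<lambda>_. if j = h then q j f / q j 0 else 0)"
    if l: "l \<in> {k+1..n}" and f: "f = 0 \<or> f = l" and jh: "j < r" "h < r" for l f j h
  proof -
    let ?U = "\<lambda>S T. insert f (S \<union> T)"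
    have U: "?U S T \<subseteq> {..n}" "card (?U S T) = m" "\<And>g :: nat \<Rightarrow> complex. prod g (?U S T) = g f * prod g S * prod g T"
      if "S \<in> \<B>" "T \<in> \<O> l" for S T
    proof -
      have S: "S \<subseteq> {1..k}" "card S = p" and T: "T \<subseteq> {k+1..n} - {l}" "card T = m - p - 1"
        using that B(1) by (auto simp: \<O>_def)
      have fin: "finite S" "finite T" using S T by (auto intro: finite_subset)
      have "{1..k} \<inter> {k+1..n} = {}" by auto
      then have disj: "S \<inter> T = {}" using S T by blast
      have nf: "f \<notin> S \<union> T" using S T f l by fastforce
      show "?U S T \<subseteq> {..n}" using S T f l \<open>k < n\<close> by auto
      show "card (?U S T) = m" using fin disj nf S T p by (simp add: card_Un_disjoint)
      show "prod g (?U S T) = g f * prod g S * prod g T" for g :: "nat \<Rightarrow> complex"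
        using fin disj nf by (simp add: prod.union_disjoint mult.assoc)
    qed
    have expand: "(\<Sum>S\<in>\<B>. \<Sum>T\<in>\<O> l. \<psi> j S / q j 0 * \<phi> l h T * (\<Sum>i<r. prod (Q i) (?U S T)))
       = (\<Sum>i<r. Q i f * a Q i j * b l Q i h)" for Q
    proof -
      have "(\<Sum>S\<in>\<B>. \<Sum>T\<in>\<O> l. \<psi> j S / q j 0 * \<phi> l h T * (\<Sum>i<r. prod (Q i) (?U S T)))
        = (\<Sum>S\<in>\<B>. \<Sum>T\<in>\<O> l. \<Sum>i<r. Q i f * (\<psi> j S * prod (Q i) S / q j 0 * (\<phi> l h T * prod (Q i) T)))"
        unfolding sum_distrib_left by (intro sum.cong refl) (simp add: U(3) del: insert_iff)
      also have "\<dots> = (\<Sum>S\<in>\<B>. \<Sum>i<r. \<Sum>T\<in>\<O> l. Q i f * (\<psi> j S * prod (Q i) S / q j 0 * (\<phi> l h T * prod (Q i) T)))"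
        by (intro sum.cong refl sum.swap)
      also have "\<dots> = (\<Sum>i<r. \<Sum>S\<in>\<B>. \<Sum>T\<in>\<O> l. Q i f * (\<psi> j S * prod (Q i) S / q j 0 * (\<phi> l h T * prod (Q i) T)))"
        by (rule sum.swap)
      also have "\<dots> = (\<Sum>i<r. Q i f * a Q i j * b l Q i h)"
        unfolding a_def b_def sum_divide_distrib mult.assoc sum_product
        by (simp add: sum_distrib_left)
      finally show ?thesis .
    qed
    have "(\<lambda>x. \<Sum>S\<in>\<B>. \<Sum>T\<in>\<O> l. \<psi> j S / q j 0 * \<phi> l h T * (\<Sum>i<r. prod (q' x i) (?U S T))) \<simeq>
        (\<lambda>_. \<Sum>S\<in>\<B>. \<Sum>T\<in>\<O> l. \<psi> j S / q j 0 * \<phi> l h T * (\<Sum>i<r. prod (q i) (?U S T)))"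
      by (intro approx_sum approx_mult approx_const near U)
    moreover have "(\<Sum>i<r. q i f * a q i j * b l q i h) = (\<Sum>i<r. if i = j then (if j = h then q j f / q j 0 else 0) else 0)"
      using jh \<phi>[OF l] \<psi> by (intro sum.cong refl) (auto simp: a_def b_def)
    ultimately show ?thesis using jh unfolding expand by simp
  qed
  have diag_unit: "(\<lambda>x. \<Sum>i<r. q' x i 0 * a (q' x) i j * b l (q' x) i h) \<simeq> (\<lambda>_. if j = h then 1 else 0)"
    if "l \<in> {k+1..n}" "j < r" "h < r" for l j h
    using pairing[OF that(1) _ that(2,3), of 0] lead[OF that(2)] by (cases "j = h") simp_all
  have diag_act: "(\<lambda>x. \<Sum>i<r. q' x i l * a (q' x) i j * b l (q' x) i h) \<simeq> (\<lambda>_. if j = h then q j l / q j 0 else 0)"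
    if "l \<in> {k+1..n}" "j < r" "h < r" for l j h
    using pairing[OF that(1) _ that(2,3), of l] by simp
  have "{k+1..n} \<noteq> {}" using \<open>k < n\<close> by simp
  from simultaneous_diagonalization[where L = "{k+1..n}" and r = r and \<xi> = \<xi>
        and t = "\<lambda>j l. q j l / q j 0" and w = "\<lambda>x i. q' x i 0" and y = q'
        and a = "\<lambda>x. a (q' x)" and b = "\<lambda>l x. b l (q' x)", OF this diag_unit diag_act distinct]
  obtain \<pi> where \<pi>: "\<And>x. \<pi> x permutes {..<r}"
    and \<tau>: "\<And>i l. i < r \<Longrightarrow> l \<in> {k+1..n} \<Longrightarrow> (\<lambda>x. q' x (\<pi> x i) l / q' x (\<pi> x i) 0) \<simeq> (\<lambda>_. q i l / q i 0)"
    and lead': "\<forall>\<^sub>F x in \<Phi>. \<forall>i<r. q' x i 0 \<noteq> 0"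
    by blast
  have near_perm: "(\<lambda>x. \<Sum>i<r. prod (q' x (\<pi> x i)) S) \<simeq> (\<lambda>_. \<Sum>i<r. prod (q i) S)"
    if S: "S \<subseteq> {..n}" "card S = m" for S
  proof -
    have "(\<Sum>i<r. prod (q' x (\<pi> x i)) S) = (\<Sum>i<r. prod (q' x i) S)" for x
      using sum.permute[OF \<pi>[of x], of "\<lambda>i. prod (q' x i) S"] by (simp add: comp_def)
    with near[OF S] show ?thesis by simp
  qed
  have lead_perm: "\<forall>\<^sub>F x in \<Phi>. \<forall>i<r. q' x (\<pi> x i) 0 \<noteq> 0"
    using lead' by eventually_elim (use permutes_in_image[OF \<pi>] in auto)
  have nonzero: "\<exists>S. S \<subseteq> {1..k} \<and> card S = p \<and> prod (q i) S \<noteq> 0" if "i < r" for i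
    using lin_indep_nonzero[OF B(2) that] B(1) by blast
  from aligned_decomposition[where q' = "\<lambda>x i. q' x (\<pi> x i)" and q = q and r = r and n = n and m = m and k = k and p = p,
      OF near_perm lead lead_perm \<tau> p \<open>k < n\<close> nonzero O]
  show ?thesis using \<pi> by blast
qed

end

section \<open>Monomials and generating matrices\<close>
lemma tpow_sorted_list_of_multiset: "tpow v (sorted_list_of_multiset M) = mon_eval M v"
  unfolding tpow_def mon_eval_def
  by (metis mset_map mset_sorted_list_of_multiset prod_mset_prod_list)

lemma mon_eval_mset_set: "mon_eval (mset_set S) v = prod v S"
  by (simp add: mon_eval_def prod_unfold_prod_mset)

lemma mon_eval_add: "mon_eval (M + M') v = mon_eval M v * mon_eval M' v"
  by (simp add: mon_eval_def)

lemma mon_eval_add_mset: "mon_eval (add_mset j M) v = v j * mon_eval M v"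
  by (simp add: mon_eval_def)

lemma entry_weighted_sum:
  "entry s (\<lambda>is. \<Sum>i<r. c i * tpow (u i) is) \<alpha> = (\<Sum>i<r. c i * (u i 0 ^ (s - size \<alpha>) * mon_eval \<alpha> (u i)))"
proof -
  have "mon_eval (replicate_mset e 0) v = v 0 ^ e" for e and v :: "nat \<Rightarrow> 'a"
    by (induction e) (simp_all add: mon_eval_def)
  then show ?thesis by (simp add: entry_def tpow_sorted_list_of_multiset mon_eval_add)
qed

lemma finite_sqfree_mons: "finite A \<Longrightarrow> finite (sqfree_mons A s)"
  unfolding sqfree_mons_def by simp

lemma size_sqfree_mons: "f \<in> sqfree_mons A s \<Longrightarrow> size f = s"
  by (auto simp: sqfree_mons_def)

lemma lin_indep_sqfree_mons:
  assumes "lin_indep r (sqfree_mons A s) (\<lambda>i f. mon_eval f (v i))" "finite A"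
  shows "lin_indep r {S. S \<subseteq> A \<and> card S = s} (\<lambda>i S. prod (v i) S)"
proof -
  have "{S. S \<subseteq> A \<and> card S = s} = {S. S \<subseteq> A \<and> finite S \<and> card S = s}"
    using assms(2) by (auto intro: finite_subset)
  then show ?thesis
    using lin_indep_reindex[OF assms(1)[unfolded sqfree_mons_def]] by (simp add: mon_eval_mset_set)
qed

lemma grlex_before_irrefl: "\<not> grlex_before f f"
  by (simp add: grlex_before_def)

lemma grlex_before_trans:
  assumes "grlex_before f g" "grlex_before g h"
  shows "grlex_before f h"
proof (cases "size f = size g \<and> size g = size h")
  case True
  with assms obtain i j where
    i: "count g i < count f i" "\<forall>l<i. count f l = count g l" and
    j: "count h j < count g j" "\<forall>l<j. count g l = count h l"
    by (auto simp: grlex_before_def)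
  have "count h (min i j) < count f (min i j)"
  proof (cases i j rule: linorder_cases)
    case less
    with j(2) have "count g i = count h i" by blast
    with less i(1) show ?thesis by (simp add: min_absorb1)
  next
    case equal
    with i(1) j(1) show ?thesis by simp
  next
    case greater
    with i(2) have "count f j = count g j" by blast
    with greater j(1) show ?thesis by (simp add: min_absorb2)
  qed
  moreover have "\<forall>l<min i j. count f l = count h l"
    using i(2) j(2) by (metis min_less_iff_conj)
  ultimately show ?thesis using True unfolding grlex_before_def by auto
next
  case False
  with assms show ?thesis unfolding grlex_before_def by auto
qed

lemma grlex_before_total:
  assumes "f \<noteq> g" shows "grlex_before f g \<or> grlex_before g f"
proof -
  define i where "i = (LEAST i. count f i \<noteq> count g i)"
  have "\<exists>i. count f i \<noteq> count g i" using assms by (meson multiset_eqI)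
  then have ne: "count f i \<noteq> count g i" unfolding i_def by (rule LeastI_ex)
  have eq: "\<forall>j<i. count f j = count g j" unfolding i_def using not_less_Least by blast
  have "count f i < count g i \<or> count g i < count f i" using ne by linarith
  then have "\<exists>i. count f i < count g i \<and> (\<forall>j<i. count g j = count f j) \<or>
      count g i < count f i \<and> (\<forall>j<i. count f j = count g j)"
    using eq by (intro exI[of _ i]) simp
  then show ?thesis unfolding grlex_before_def by (metis linorder_neqE_nat)
qed

text \<open>
  The number of predecessors is an injective function on monomials, because the graded
  lexicographic order is a strict total order.
\<close>
lemma card_B0_le: "card (B0 k p r) \<le> r"
proof -
  define rank where "rank \<beta> = card {f \<in> J1 k p. grlex_before f \<beta>}" for \<beta>
  have fin: "finite (J1 k p)" by (simp add: J1_def finite_sqfree_mons)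
  have less: "rank f < rank g" if "grlex_before f g" "f \<in> J1 k p" for f g
    unfolding rank_def
  proof (rule psubset_card_mono)
    show "finite {h \<in> J1 k p. grlex_before h g}" using fin by simp
    show "{h \<in> J1 k p. grlex_before h f} \<subset> {h \<in> J1 k p. grlex_before h g}"
      using that grlex_before_trans grlex_before_irrefl by blast
  qed
  have "inj_on rank (B0 k p r)"
    by (intro inj_onI) (metis (no_types, lifting) B0_def grlex_before_total less mem_Collect_eq nat_neq_iff)
  moreover have "rank ` B0 k p r \<subseteq> {..<r}" by (auto simp: B0_def rank_def)
  ultimately show ?thesis using card_inj_on_le[of rank "B0 k p r" "{..<r}"] by simp
qed

text \<open>
  Linear independence on \<open>\<O>\<^sub>\<alpha>\<close> allows cancelling the factors \<open>[u\<^sub>i]\<^sub>\<gamma>\<close> in \<open>A[\<alpha>, F] G(:, \<alpha>) = b[\<alpha>, F]\<close>. Hence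
  \<open>[u\<^sub>i]\<close> on \<open>\<B>\<^sub>0\<close> is an eigenvector of \<open>N\<^sub>l(G)\<close> with eigenvalue \<open>u\<^sub>i\<^sub>l/u\<^sub>i\<^sub>0\<close>. As \<open>\<B>\<^sub>0\<close> has \<open>r\<close> elements,
  these vectors span, so \<open>N(\<xi>)\<close> has no further eigenvalues; if its eigenvalues are distinct, then so
  are the combined ratios of the components.
\<close>
lemma eigenvalues_of_generating_matrix:
  fixes u :: "nat \<Rightarrow> nat \<Rightarrow> complex" and c :: "nat \<Rightarrow> complex"
  assumes p: "p + 2 \<le> m"
    and c: "\<And>i. i < r \<Longrightarrow> c i \<noteq> 0" and lead: "\<And>i. i < r \<Longrightarrow> u i 0 \<noteq> 0"
    and B: "lin_indep r (B0 k p r) (\<lambda>i f. mon_eval f (u i))"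
    and O: "\<And>\<alpha>. \<alpha> \<in> B1 n p k \<Longrightarrow> lin_indep r (Oset n m p k \<alpha>) (\<lambda>i f. mon_eval f (u i))"
    and G: "\<And>\<alpha> \<gamma>. \<alpha> \<in> B1 n p k \<Longrightarrow> \<gamma> \<in> Oset n m p k \<alpha> \<Longrightarrow>
      gen_residual m (B0 k p r) (\<lambda>is. \<Sum>i<r. c i * tpow (u i) is) \<alpha> (\<lambda>\<beta>. G \<beta> \<alpha>) \<gamma> = 0"
    and distinct: "distinct_eigenvalues (B0 k p r) (Nxi n k \<xi> G)"
  shows "inj_on (\<lambda>i. \<Sum>l=k+1..n. \<xi> l * (u i l / u i 0)) {..<r}"
proof -
  have finB: "finite (B0 k p r)"
    by (rule finite_subset[of _ "J1 k p"]) (auto simp: B0_def J1_def finite_sqfree_mons)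
  have action: "(\<Sum>\<beta>\<in>B0 k p r. Nl G l \<nu> \<beta> * mon_eval \<beta> (u i)) = u i l / u i 0 * mon_eval \<nu> (u i)"
    if \<nu>: "\<nu> \<in> B0 k p r" and l: "l \<in> {k+1..n}" and i: "i < r" for \<nu> l i
  proof -
    define \<alpha> where "\<alpha> = \<nu> + {#l#}"
    have \<alpha>: "\<alpha> \<in> B1 n p k" using \<nu> l by (auto simp: \<alpha>_def B1_def B0_def)
    define e where "e i = c i * (u i 0 * (\<Sum>\<beta>\<in>B0 k p r. mon_eval \<beta> (u i) * G \<beta> \<alpha>) - mon_eval \<alpha> (u i))" for i
    have "e i = 0"
    proof (rule lin_indepD[OF O[OF \<alpha>] _ i])
      fix \<gamma> assume \<gamma>: "\<gamma> \<in> Oset n m p k \<alpha>"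
      have s\<gamma>: "size \<gamma> = m - p - 1" using \<gamma> by (auto simp: Oset_def size_sqfree_mons)
      have s: "size \<beta> = p" if "\<beta> \<in> B0 k p r" for \<beta> using that by (auto simp: B0_def J1_def size_sqfree_mons)
      have exp\<beta>: "m - size (\<beta> + \<gamma>) = 1" if "\<beta> \<in> B0 k p r" for \<beta> using s[OF that] s\<gamma> p by simp
      have exp\<alpha>: "m - size (\<alpha> + \<gamma>) = 0" using s[OF \<nu>] s\<gamma> p by (simp add: \<alpha>_def)
      have "0 = (\<Sum>\<beta>\<in>B0 k p r. (\<Sum>i<r. c i * (u i 0 * mon_eval (\<beta> + \<gamma>) (u i))) * G \<beta> \<alpha>) - (\<Sum>i<r. c i * mon_eval (\<alpha> + \<gamma>) (u i))"
        using G[OF \<alpha> \<gamma>] by (simp add: gen_residual_def entry_weighted_sum exp\<beta> exp\<alpha> del: size_union)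
      also have "(\<Sum>\<beta>\<in>B0 k p r. (\<Sum>i<r. c i * (u i 0 * mon_eval (\<beta> + \<gamma>) (u i))) * G \<beta> \<alpha>)
          = (\<Sum>i<r. c i * (u i 0 * (\<Sum>\<beta>\<in>B0 k p r. mon_eval \<beta> (u i) * G \<beta> \<alpha>)) * mon_eval \<gamma> (u i))"
        unfolding sum_distrib_right sum_distrib_left by (subst sum.swap) (simp add: mon_eval_add mult_ac)
      finally show "(\<Sum>i<r. e i * mon_eval \<gamma> (u i)) = 0"
        by (simp add: e_def mon_eval_add sum_subtractf right_diff_distrib left_diff_distrib mult.assoc)
    qed
    with c[OF i] have "u i 0 * (\<Sum>\<beta>\<in>B0 k p r. mon_eval \<beta> (u i) * G \<beta> \<alpha>) = u i l * mon_eval \<nu> (u i)"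
      by (simp add: e_def \<alpha>_def mon_eval_add_mset)
    then show ?thesis using lead[OF i] by (simp add: Nl_def \<alpha>_def field_simps)
  qed
  define \<tau> where "\<tau> i = (\<Sum>l=k+1..n. \<xi> l * (u i l / u i 0))" for i
  have eig: "(\<Sum>\<beta>\<in>B0 k p r. Nxi n k \<xi> G \<nu> \<beta> * mon_eval \<beta> (u i)) = \<tau> i * mon_eval \<nu> (u i)"
    if "\<nu> \<in> B0 k p r" "i < r" for \<nu> i
  proof -
    have "(\<Sum>\<beta>\<in>B0 k p r. Nxi n k \<xi> G \<nu> \<beta> * mon_eval \<beta> (u i))
        = (\<Sum>l=k+1..n. \<xi> l * (\<Sum>\<beta>\<in>B0 k p r. Nl G l \<nu> \<beta> * mon_eval \<beta> (u i)))"
      unfolding Nxi_def sum_distrib_right sum_distrib_left by (subst sum.swap) (simp add: mult.assoc)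
    also have "\<dots> = (\<Sum>l=k+1..n. \<xi> l * (u i l / u i 0 * mon_eval \<nu> (u i)))"
      using action that by (intro sum.cong refl) simp
    also have "\<dots> = \<tau> i * mon_eval \<nu> (u i)"
      unfolding \<tau>_def sum_distrib_right by (simp add: mult.assoc)
    finally show ?thesis .
  qed
  have "{e. \<exists>z. eigenvector_on (B0 k p r) (Nxi n k \<xi> G) z e} \<subseteq> \<tau> ` {..<r}"
  proof
    fix e assume "e \<in> {e. \<exists>z. eigenvector_on (B0 k p r) (Nxi n k \<xi> G) z e}"
    then obtain z where nz: "\<exists>\<nu>\<in>B0 k p r. z \<nu> \<noteq> 0"
      and z: "\<And>\<nu>. \<nu> \<in> B0 k p r \<Longrightarrow> (\<Sum>\<beta>\<in>B0 k p r. Nxi n k \<xi> G \<nu> \<beta> * z \<beta>) = e * z \<nu>"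
      by (auto simp: eigenvector_on_def)
    obtain a where a: "\<And>\<nu>. \<nu> \<in> B0 k p r \<Longrightarrow> z \<nu> = (\<Sum>i<r. a i * mon_eval \<nu> (u i))"
      using lin_indep_spans[OF finB B card_B0_le] by blast
    have "\<exists>i<r. a i \<noteq> 0"
    proof (rule ccontr)
      assume "\<not> ?thesis"
      then have "z \<nu> = 0" if "\<nu> \<in> B0 k p r" for \<nu> unfolding a[OF that] by simp
      with nz show False by blast
    qed
    then obtain i where i: "i < r" "a i \<noteq> 0" by blast
    have "a i * (\<tau> i - e) = 0"
    proof (rule lin_indepD[OF B _ i(1)])
      fix \<nu> assume \<nu>: "\<nu> \<in> B0 k p r"
      have "(\<Sum>i<r. a i * \<tau> i * mon_eval \<nu> (u i)) = (\<Sum>i<r. a i * (\<Sum>\<beta>\<in>B0 k p r. Nxi n k \<xi> G \<nu> \<beta> * mon_eval \<beta> (u i)))"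
        using eig[OF \<nu>] by (simp add: mult.assoc)
      also have "\<dots> = (\<Sum>\<beta>\<in>B0 k p r. Nxi n k \<xi> G \<nu> \<beta> * z \<beta>)"
        using a unfolding sum_distrib_left by (subst sum.swap) (simp add: sum_distrib_left mult_ac)
      also have "\<dots> = (\<Sum>i<r. a i * e * mon_eval \<nu> (u i))"
        using z[OF \<nu>] a[OF \<nu>] by (simp add: sum_distrib_left mult_ac)
      finally show "(\<Sum>i<r. a i * (\<tau> i - e) * mon_eval \<nu> (u i)) = 0"
        by (simp add: left_diff_distrib right_diff_distrib sum_subtractf)
    qed
    with i show "e \<in> \<tau> ` {..<r}" by auto
  qed
  then have "card (B0 k p r) \<le> card (\<tau> ` {..<r})"
    using distinct unfolding distinct_eigenvalues_def by (metis card_mono finite_imageI finite_lessThan)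
  with lin_indep_le_card[OF finB B] have "card {..<r} \<le> card (\<tau> ` {..<r})" by simp
  then have "card (\<tau> ` {..<r}) = card {..<r}" by (intro antisym card_image_le) auto
  then have "inj_on \<tau> {..<r}" by (rule eq_card_imp_inj_on[rotated]) simp
  then show ?thesis by (simp add: \<tau>_def[abs_def])
qed

lemma tpow_sorted_list_of_set: "finite S \<Longrightarrow> tpow v (sorted_list_of_set S) = prod v S"
  by (simp add: tpow_def prod.distinct_set_conv_list[symmetric])

text \<open>
  Any linear relation on the tuples of \<open>Lhat (n + 1) m j\<close> can be restricted to the tuples \<open>\<beta> \<union> T\<close> with
  fixed \<open>\<beta>\<close> of size \<open>p - 1\<close> in \<open>{1, \<dots>, k}\<close> and \<open>T\<close> of size \<open>m - p - 1\<close> above \<open>k\<close>, both avoiding \<open>j\<close>.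
  Independence on the sets \<open>T\<close> shows that the coefficient of component \<open>i\<close> vanishes as soon as
  \<open>\<beta>\<close> is chosen with nonzero product for this \<open>i\<close>.
\<close>
lemma lin_indep_Lhat:
  fixes u :: "nat \<Rightarrow> nat \<Rightarrow> 'a::field"
  assumes p: "1 \<le> p" "p + 2 \<le> m" and "k < n"
    and B: "\<And>i. i < r \<Longrightarrow> \<exists>S. S \<subseteq> {1..k} \<and> card S = p \<and> prod (u i) S \<noteq> 0"
    and O: "\<And>l. l \<in> {k+1..n} \<Longrightarrow>
      lin_indep r {T. T \<subseteq> {k+1..n} - {l} \<and> card T = m - p - 1} (\<lambda>i T. prod (u i) T)"
  shows "lin_indep r (Lhat (n + 1) m j) (\<lambda>i. tpow (u i))"
  unfolding lin_indep_def
proof (intro allI impI)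
  fix c i
  assume c: "\<forall>is\<in>Lhat (n + 1) m j. (\<Sum>i<r. c i * tpow (u i) is) = 0" and i: "i < r"
  obtain S where S: "S \<subseteq> {1..k}" "card S = p" "prod (u i) S \<noteq> 0" using B[OF i] by blast
  obtain \<beta> where \<beta>: "\<beta> \<subseteq> {1..k} - {j}" "card \<beta> + 1 = p" "prod (u i) \<beta> \<noteq> 0"
    using nonzero_product_avoiding[OF S p(1)] by blast
  \<comment> \<open>For \<open>j \<le> k\<close> every \<open>l > k\<close> would do, because then \<open>T\<close> avoids \<open>j\<close> anyway.\<close>
  define l where "l = (if k < j \<and> j \<le> n then j else k + 1)"
  have l: "l \<in> {k+1..n}" using \<open>k < n\<close> by (auto simp: l_def)
  have "c i * prod (u i) \<beta> = 0"
  proof (rule lin_indepD[OF O[OF l] _ i])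
    fix T assume T: "T \<in> {T. T \<subseteq> {k+1..n} - {l} \<and> card T = m - p - 1}"
    have fin: "finite \<beta>" "finite T" using \<beta>(1) T by (auto intro: finite_subset)
    have "{1..k} \<inter> {k+1..n} = {}" by auto
    then have disj: "\<beta> \<inter> T = {}" using \<beta>(1) T by blast
    have j: "j \<notin> \<beta> \<union> T" using \<beta>(1) T by (fastforce simp: l_def split: if_splits)
    have sub: "\<beta> \<union> T \<subseteq> {..<n+1}" using \<beta>(1) T \<open>k < n\<close> by fastforce
    have "card (\<beta> \<union> T) = m - 2" using disj fin \<beta>(2) T p by (simp add: card_Un_disjoint)
    with sub j fin have "sorted_list_of_set (\<beta> \<union> T) \<in> Lhat (n + 1) m j"
      by (auto simp: Lhat_def)
    with c have "(\<Sum>i<r. c i * tpow (u i) (sorted_list_of_set (\<beta> \<union> T))) = 0" by blast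
    then show "(\<Sum>i<r. c i * prod (u i) \<beta> * prod (u i) T) = 0"
      using fin disj by (simp add: tpow_sorted_list_of_set prod.union_disjoint mult.assoc)
  qed
  with \<beta>(3) show "c i = 0" by simp
qed

section \<open>Moments of diagonal Gaussian mixtures\<close>
lemma normal_density_abs: "normal_density a \<bar>s\<bar> = normal_density a s"
  by (simp add: normal_density_def fun_eq_iff)

lemma prob_space_normal_law: "prob_space (normal_law a s)"
  using prob_space_normal_density[of "\<bar>s\<bar>" a]
  by (simp add: normal_law_def normal_density_abs prob_space_return)

lemma sets_normal_law [simp, measurable_cong]: "sets (normal_law a s) = sets borel"
  by (simp add: normal_law_def)

lemma has_bochner_integral_normal_law:
  assumes "s \<noteq> 0" "has_bochner_integral lborel (\<lambda>x. normal_density a \<bar>s\<bar> x * f x) v"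
    and [measurable]: "f \<in> borel_measurable borel"
  shows "has_bochner_integral (normal_law a s) f v"
  using assms(1,2)
  by (simp add: normal_law_def has_bochner_integral_density normal_density_abs)

text \<open>
  The moments of order at most \<open>2\<close>; no index occurs more than twice in the tuples that the algorithm
  reads.
\<close>
definition normal_moment :: "real \<Rightarrow> real \<Rightarrow> nat \<Rightarrow> real" where
  "normal_moment a s e = (if e = 0 then 1 else if e = 1 then a else a\<^sup>2 + s\<^sup>2)"

lemma normal_law_moment:
  assumes "e \<le> 2"
  shows "has_bochner_integral (normal_law a s) (\<lambda>x. x ^ e) (normal_moment a s e)"
proof (cases "s = 0")
  case True
  have "has_bochner_integral (return borel a) (\<lambda>x. x ^ e) (a ^ e)"
  proof -
    interpret prob_space "return borel a" by (rule prob_space_return) simp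
    have "AE x in return borel a. x ^ e = a ^ e" by (simp add: AE_return)
    then have "integrable (return borel a) (\<lambda>x. x ^ e) \<longleftrightarrow> integrable (return borel a) (\<lambda>_. a ^ e)"
      by (intro integrable_cong_AE) simp_all
    then show ?thesis by (simp add: has_bochner_integral_iff integral_return)
  qed
  with True assms show ?thesis
    by (auto simp: normal_law_def normal_moment_def le_Suc_eq numeral_2_eq_2)
next
  case False
  then have s: "0 < \<bar>s\<bar>" by simp
  have 0: "has_bochner_integral lborel (\<lambda>x. normal_density a \<bar>s\<bar> x) 1"
    using normal_moment_even[OF s, of a 0] by simp
  note 1 = normal_moment_nz_1[OF s, of a]
  have "has_bochner_integral lborel (\<lambda>x. normal_density a \<bar>s\<bar> x * (x - a)\<^sup>2) (s\<^sup>2)"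
    using normal_moment_even[OF s, of a 1] by (simp add: power2_eq_square)
  from has_bochner_integral_add[OF this has_bochner_integral_diff[OF
      has_bochner_integral_mult_right[OF 1, of "2 * a"] has_bochner_integral_mult_right[OF 0, of "a\<^sup>2"]]]
  have 2: "has_bochner_integral lborel (\<lambda>x. normal_density a \<bar>s\<bar> x * x\<^sup>2) (a\<^sup>2 + s\<^sup>2)"
    by (simp add: power2_eq_square algebra_simps)
  have "has_bochner_integral lborel (\<lambda>x. normal_density a \<bar>s\<bar> x * x ^ e) (normal_moment a s e)"
    using assms 0 1 2 by (auto simp: normal_moment_def le_Suc_eq numeral_2_eq_2)
  then show ?thesis using False by (intro has_bochner_integral_normal_law) simp_all
qed

lemma sets_diag_gaussian: "sets (diag_gaussian d a s) = sets (PiM {..<d} (\<lambda>_. borel))"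
  unfolding diag_gaussian_def by (intro sets_PiM_cong) auto

lemma prob_space_diag_gaussian: "prob_space (diag_gaussian d a s)"
  unfolding diag_gaussian_def by (intro prob_space_PiM prob_space_normal_law)

lemma diag_gaussian_moment:
  assumes "\<And>j. j < d \<Longrightarrow> e j \<le> 2"
  shows "integrable (diag_gaussian d a s) (\<lambda>y. \<Prod>j<d. y j ^ e j)"
    and "(LINT y|diag_gaussian d a s. (\<Prod>j<d. y j ^ e j)) = (\<Prod>j<d. normal_moment (a j) (s j) (e j))"
proof -
  interpret product_prob_space "\<lambda>j. normal_law (a j) (s j)" "{..<d}"
    by (rule product_prob_spaceI) (rule prob_space_normal_law)
  have *: "has_bochner_integral (normal_law (a j) (s j)) (\<lambda>x. x ^ e j) (normal_moment (a j) (s j) (e j))"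
    if "j < d" for j using normal_law_moment assms that by blast
  show "integrable (diag_gaussian d a s) (\<lambda>y. \<Prod>j<d. y j ^ e j)"
    unfolding diag_gaussian_def
    using * by (intro product_integrable_prod) (auto simp: has_bochner_integral_iff)
  show "(LINT y|diag_gaussian d a s. (\<Prod>j<d. y j ^ e j)) = (\<Prod>j<d. normal_moment (a j) (s j) (e j))"
    unfolding diag_gaussian_def
    using * by (subst product_integral_prod) (auto simp: has_bochner_integral_iff)
qed

text \<open>
  For nonnegative functions integration against the monadic bind is iterated integration; the
  integrands here are unbounded polynomials, and splitting them into positive and negative part
  reduces to that case.
\<close>
lemma has_bochner_integral_mixture:
  assumes \<omega>: "\<And>i. i < r \<Longrightarrow> 0 \<le> \<omega> i"
    and f [measurable]: "f \<in> borel_measurable (PiM {..<d} (\<lambda>_. borel))"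
    and int: "\<And>i. i < r \<Longrightarrow> integrable (diag_gaussian d (\<mu> i) (\<sigma> i)) f"
  shows "has_bochner_integral (mixture d r \<omega> \<mu> \<sigma>) f (\<Sum>i<r. \<omega> i * (LINT y|diag_gaussian d (\<mu> i) (\<sigma> i). f y))"
proof -
  let ?P = "\<lambda>i. diag_gaussian d (\<mu> i) (\<sigma> i)"
  let ?B = "PiM {..<d} (\<lambda>_. borel :: real measure)"
  let ?W = "point_measure {..<r} (\<lambda>i. ennreal (\<omega> i))"
  have K: "?P \<in> measurable ?W (subprob_algebra ?B)"
    by (auto simp: space_subprob_algebra sets_diag_gaussian prob_space_diag_gaussian
        intro: prob_space_imp_subprob_space)
  have nn: "has_bochner_integral (mixture d r \<omega> \<mu> \<sigma>) g (\<Sum>i<r. \<omega> i * (LINT y|?P i. g y))"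
    if g [measurable]: "g \<in> borel_measurable ?B" and pos: "\<And>y. 0 \<le> g y"
      and int: "\<And>i. i < r \<Longrightarrow> integrable (?P i) g" for g :: "_ \<Rightarrow> real"
  proof (rule has_bochner_integral_nn_integral)
    show "0 \<le> (\<Sum>i<r. \<omega> i * (LINT y|?P i. g y))"
      using \<omega> pos by (intro sum_nonneg mult_nonneg_nonneg integral_nonneg) auto
    have "(\<integral>\<^sup>+ y. ennreal (g y) \<partial>mixture d r \<omega> \<mu> \<sigma>) = (\<integral>\<^sup>+ i. \<integral>\<^sup>+ y. ennreal (g y) \<partial>?P i \<partial>?W)"
      unfolding mixture_def by (rule nn_integral_bind[OF _ K]) simp
    also have "\<dots> = (\<Sum>i<r. ennreal (\<omega> i) * (\<integral>\<^sup>+ y. ennreal (g y) \<partial>?P i))"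
      by (subst nn_integral_point_measure_finite) (auto simp: mult.commute)
    also have "\<dots> = (\<Sum>i<r. ennreal (\<omega> i * (LINT y|?P i. g y)))"
      using \<omega> int pos by (intro sum.cong refl) (simp add: nn_integral_eq_integral ennreal_mult)
    also have "\<dots> = ennreal (\<Sum>i<r. \<omega> i * (LINT y|?P i. g y))"
      using \<omega> pos by (intro sum_ennreal mult_nonneg_nonneg integral_nonneg) auto
    finally show "(\<integral>\<^sup>+ y. ennreal (g y) \<partial>mixture d r \<omega> \<mu> \<sigma>) = ennreal (\<Sum>i<r. \<omega> i * (LINT y|?P i. g y))" .
    show "g \<in> borel_measurable (mixture d r \<omega> \<mu> \<sigma>)"
    proof (cases "r = 0")
      case True
      then have "mixture d r \<omega> \<mu> \<sigma> = count_space {}"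
        by (simp add: mixture_def bind_empty space_point_measure)
      then show ?thesis by simp
    next
      case False
      have "sets (mixture d r \<omega> \<mu> \<sigma>) = sets ?B"
        unfolding mixture_def using False
        by (intro sets_bind) (auto simp: sets_diag_gaussian space_point_measure)
      then show ?thesis using g by (simp cong: measurable_cong_sets)
    qed
  qed (use pos in auto)
  have [simp]: "integrable (?P i) (\<lambda>y. max (f y) 0)" "integrable (?P i) (\<lambda>y. max (- f y) 0)" if "i < r" for i
    using int[OF that] by auto
  have "has_bochner_integral (mixture d r \<omega> \<mu> \<sigma>) (\<lambda>y. max (f y) 0 - max (- f y) 0)
     ((\<Sum>i<r. \<omega> i * (LINT y|?P i. max (f y) 0)) - (\<Sum>i<r. \<omega> i * (LINT y|?P i. max (- f y) 0)))"
    by (intro has_bochner_integral_diff nn) auto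
  also have "(\<lambda>y. max (f y) 0 - max (- f y) 0) = f" by auto
  also have "(\<Sum>i<r. \<omega> i * (LINT y|?P i. max (f y) 0)) - (\<Sum>i<r. \<omega> i * (LINT y|?P i. max (- f y) 0))
     = (\<Sum>i<r. \<omega> i * (LINT y|?P i. max (f y) 0 - max (- f y) 0))"
    by (simp add: sum_subtractf[symmetric] right_diff_distrib)
  also have "\<dots> = (\<Sum>i<r. \<omega> i * (LINT y|?P i. f y))"
    by (intro sum.cong refl arg_cong2[where f = "(*)"] Bochner_Integration.integral_cong) auto
  finally show ?thesis .
qed

lemma count_list_distinct: "distinct is \<Longrightarrow> count_list is j \<le> 1"
  by (induction "is") (auto simp: count_list_0_iff)

lemma tpow_eq_prod_count:
  assumes "set is \<subseteq> {..<d}"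
  shows "tpow y is = (\<Prod>j<d. y j ^ count_list is j)"
  using assms
proof (induction "is")
  case Nil
  then show ?case by (simp add: tpow_def)
next
  case (Cons i "is")
  have "(\<Prod>j<d. y j ^ count_list (i # is) j) = (\<Prod>j<d. (if i = j then y j else 1) * y j ^ count_list is j)"
    by (intro prod.cong) auto
  also have "\<dots> = y i * (\<Prod>j<d. y j ^ count_list is j)"
    using Cons.prems by (simp add: prod.distrib)
  finally show ?case using Cons by (simp add: tpow_def)
qed

lemma mixture_moment:
  assumes \<omega>: "\<And>i. i < r \<Longrightarrow> 0 \<le> \<omega> i" and "set is \<subseteq> {..<d}" "\<And>j. j < d \<Longrightarrow> count_list is j \<le> 2"
  shows "moment (mixture d r \<omega> \<mu> \<sigma>) is =
    (\<Sum>i<r. \<omega> i * (\<Prod>j<d. normal_moment (\<mu> i j) (\<sigma> i j) (count_list is j)))"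
proof -
  have "has_bochner_integral (mixture d r \<omega> \<mu> \<sigma>) (\<lambda>y. \<Prod>j<d. y j ^ count_list is j)
    (\<Sum>i<r. \<omega> i * (LINT y|diag_gaussian d (\<mu> i) (\<sigma> i). (\<Prod>j<d. y j ^ count_list is j)))"
    using \<omega> by (rule has_bochner_integral_mixture) (use diag_gaussian_moment(1) assms(3) in auto)
  then show ?thesis
    unfolding moment_def using assms(2,3)
    by (simp add: tpow_eq_prod_count has_bochner_integral_iff diag_gaussian_moment(2))
qed

lemma mixture_moment_distinct:
  assumes \<omega>: "\<And>i. i < r \<Longrightarrow> 0 \<le> \<omega> i" and "is \<in> Omega d s"
  shows "moment (mixture d r \<omega> \<mu> \<sigma>) is = (\<Sum>i<r. \<omega> i * tpow (\<mu> i) is)"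
proof -
  from assms(2) have "is": "set is \<subseteq> {..<d}" "distinct is" by (auto simp: Omega_def tuples_def)
  then have c: "count_list is j \<le> 1" for j by (intro count_list_distinct)
  have "normal_moment a b (count_list is j) = a ^ count_list is j" for a b j
    using c[of j] by (cases "count_list is j") (auto simp: normal_moment_def)
  then show ?thesis
    using mixture_moment[of r \<omega> "is" d \<mu> \<sigma>, OF \<omega> "is"(1)] c
    by (simp add: tpow_eq_prod_count[OF "is"(1)] order.trans[OF c])
qed

lemma mixture_moment_double:
  assumes \<omega>: "\<And>i. i < r \<Longrightarrow> 0 \<le> \<omega> i" and "j < d" and "is": "is \<in> Lhat d m j"
  shows "moment (mixture d r \<omega> \<mu> \<sigma>) (j # j # is) =
    (\<Sum>i<r. \<omega> i * (((\<mu> i j)\<^sup>2 + (\<sigma> i j)\<^sup>2) * tpow (\<mu> i) is))"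
proof -
  from "is" have d: "distinct is" and S: "set is \<subseteq> {..<d}" and j: "j \<notin> set is"
    by (auto simp: Lhat_def strict_sorted_iff)
  from j have cj: "count_list is j = 0" by (simp add: count_list_0_iff)
  have c: "count_list is l \<le> 1" for l using d by (rule count_list_distinct)
  have nm: "normal_moment a b (count_list is l) = a ^ count_list is l" for a b l
    using c[of l] by (cases "count_list is l") (auto simp: normal_moment_def)
  have "(\<Prod>l<d. normal_moment (a l) (b l) (count_list (j # j # is) l)) = ((a j)\<^sup>2 + (b j)\<^sup>2) * tpow a is" for a b
  proof -
    have "(\<Prod>l<d. normal_moment (a l) (b l) (count_list (j # j # is) l))
        = normal_moment (a j) (b j) 2 * (\<Prod>l\<in>{..<d} - {j}. a l ^ count_list is l)"
      using \<open>j < d\<close> cj by (subst prod.remove[of _ j]) (auto simp: nm numeral_2_eq_2 intro!: prod.cong)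
    also have "(\<Prod>l\<in>{..<d} - {j}. a l ^ count_list is l) = tpow a is"
      using \<open>j < d\<close> cj by (simp add: tpow_eq_prod_count[OF S] prod.remove[of "{..<d}" j])
    finally show ?thesis by (simp add: normal_moment_def)
  qed
  moreover have "count_list (j # j # is) l \<le> 2" for l
    using c[of l] cj by auto
  ultimately show ?thesis
    using mixture_moment[of r \<omega> "j # j # is" d \<mu> \<sigma>, OF \<omega>] S \<open>j < d\<close> by simp
qed

section \<open>Minimizers and roots of unity along the error filter\<close>
lemma tpow_scale: "tpow (\<lambda>j. a * v j) is = a ^ length is * tpow v is"
  by (induction "is") (simp_all add: tpow_def mult_ac)

lemma tpow_of_real: "tpow (\<lambda>j. of_real (v j) :: 'a::{real_algebra_1, comm_semiring_1}) is = of_real (tpow v is)"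
  by (induction "is") (simp_all add: tpow_def)

lemma finite_tuples: "finite (tuples d s)"
  unfolding tuples_def using finite_lists_length_eq[of "{..<d}" s] by (simp add: conj_commute)

lemma finite_Omega: "finite (Omega d s)"
  by (rule finite_subset[OF _ finite_tuples[of d s]]) (auto simp: Omega_def)

lemma finite_Lhat: "finite (Lhat d m j)"
  by (rule finite_subset[OF _ finite_tuples[of d "m - 2"]]) (auto simp: Lhat_def tuples_def)

lemma norm_le_nrm: "finite I \<Longrightarrow> i \<in> I \<Longrightarrow> norm (f i) \<le> nrm I f"
  unfolding nrm_def by (rule member_le_L2_set)

lemma nrm_le_sum: "nrm I f \<le> (\<Sum>i\<in>I. norm (f i))"
  unfolding nrm_def by (rule L2_set_le_sum) simp

lemma nrm_nonneg: "0 \<le> nrm I f"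
  by (simp add: nrm_def)

lemma minimizer_nrm_le:
  assumes "is_arg_min (\<lambda>q. (nrm I (g q))\<^sup>2) P q" "P q0"
  shows "nrm I (g q) \<le> nrm I (g q0)"
  using assms by (intro power2_le_imp_le[OF _ nrm_nonneg]) (auto simp: is_arg_min_def not_less)

lemma minimizer_two_nrm_le:
  assumes "is_arg_min (\<lambda>q. (nrm I (g q))\<^sup>2 + (nrm J (h q))\<^sup>2) P q" "P q0"
  shows "nrm I (g q) \<le> nrm I (g q0) + nrm J (h q0)" and "nrm J (h q) \<le> nrm I (g q0) + nrm J (h q0)"
proof -
  have "(nrm I (g q))\<^sup>2 + (nrm J (h q))\<^sup>2 \<le> (nrm I (g q0))\<^sup>2 + (nrm J (h q0))\<^sup>2"
    using assms by (auto simp: is_arg_min_def not_less)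
  also have "\<dots> \<le> (nrm I (g q0) + nrm J (h q0))\<^sup>2"
    by (simp add: power2_sum nrm_nonneg)
  finally have *: "(nrm I (g q))\<^sup>2 + (nrm J (h q))\<^sup>2 \<le> (nrm I (g q0) + nrm J (h q0))\<^sup>2" .
  show "nrm I (g q) \<le> nrm I (g q0) + nrm J (h q0)"
    by (rule power2_le_imp_le) (use * zero_le_power2[of "nrm J (h q)"] in \<open>linarith, simp add: nrm_nonneg\<close>)
  show "nrm J (h q) \<le> nrm I (g q0) + nrm J (h q0)"
    by (rule power2_le_imp_le) (use * zero_le_power2[of "nrm I (g q)"] in \<open>linarith, simp add: nrm_nonneg\<close>)
qed

lemma abs_diff_power_ge:
  fixes x y :: real
  assumes "0 \<le> x" "0 \<le> y" "1 \<le> k"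
  shows "\<bar>x - y\<bar> * y ^ (k - 1) \<le> \<bar>x ^ k - y ^ k\<bar>"
proof -
  obtain l where k: "k = Suc l" using assms(3) by (cases k) auto
  have nonneg: "0 \<le> (\<Sum>i<Suc l. x ^ i * y ^ (l - i))"
    using assms by (intro sum_nonneg) simp
  have "x ^ k - y ^ k = (x - y) * (\<Sum>i<Suc l. x ^ i * y ^ (l - i))"
    unfolding k power_diff_sumr2 by (simp add: mult.commute)
  with nonneg have "\<bar>x ^ k - y ^ k\<bar> = \<bar>x - y\<bar> * (\<Sum>i<Suc l. x ^ i * y ^ (l - i))"
    by (simp only: abs_mult abs_of_nonneg)
  moreover have "y ^ l \<le> (\<Sum>i<Suc l. x ^ i * y ^ (l - i))"
    using member_le_sum[of 0 "{..<Suc l}" "\<lambda>i. x ^ i * y ^ (l - i)"] assms by simp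
  ultimately show ?thesis by (simp add: k mult_left_mono)
qed

context vanishing_error
begin

lemma approx_nrm_zero:
  assumes "\<And>i. i \<in> I \<Longrightarrow> (\<lambda>x. f x i) \<simeq> (\<lambda>_. 0)"
  shows "(\<lambda>x. nrm I (f x)) \<simeq> (\<lambda>_. 0)"
proof (rule approx_zero_mono)
  show "(\<lambda>x. \<Sum>i\<in>I. norm (f x i)) \<simeq> (\<lambda>_. 0)" by (rule approx_norm_sum_zero[OF assms])
  show "\<forall>\<^sub>F x in \<Phi>. norm (nrm I (f x)) \<le> norm (\<Sum>i\<in>I. norm (f x i))"
    by (simp add: nrm_nonneg sum_nonneg nrm_le_sum)
qed

text \<open>
  This is how minimality is used: the residual of a minimizer is bounded by the residual of the true
  parameters.
\<close>
lemma approx_zero_if_nrm_le: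
  assumes "finite I" "i \<in> I" "\<forall>\<^sub>F x in \<Phi>. nrm I (f x) \<le> g x" "g \<simeq> (\<lambda>_. 0)"
  shows "(\<lambda>x. f x i) \<simeq> (\<lambda>_. 0)"
proof (rule approx_zero_mono[OF assms(4)])
  show "\<forall>\<^sub>F x in \<Phi>. norm (f x i) \<le> norm (g x)"
    using assms(3)
  proof eventually_elim
    case (elim x)
    with norm_le_nrm[OF assms(1,2), of "f x"] show ?case by simp
  qed
qed

lemma approx_tpow:
  fixes f g :: "'x \<Rightarrow> nat \<Rightarrow> 'a::real_normed_field"
  assumes "\<And>j. j \<in> set is \<Longrightarrow> (\<lambda>x. f x j) \<simeq> (\<lambda>x. g x j)"
  shows "(\<lambda>x. tpow (f x) is) \<simeq> (\<lambda>x. tpow (g x) is)"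
  using assms by (induction "is") (auto simp: tpow_def intro: approx_mult)

text \<open>
  There are finitely many roots of unity, so the imaginary parts of the nonreal ones are bounded away
  from \<open>0\<close>.
\<close>
lemma root_of_unity_eventually_real:
  assumes root: "\<forall>\<^sub>F x in \<Phi>. z x ^ m = 1" and "0 < m" and Im: "(\<lambda>x. Im (z x)) \<simeq> (\<lambda>_. 0)"
  shows "\<forall>\<^sub>F x in \<Phi>. Im (z x) = 0"
proof -
  \<comment> \<open>The element \<open>1\<close> only serves to have a minimum when all roots are real.\<close>
  define V where "V = insert 1 ((\<lambda>z. \<bar>Im z\<bar>) ` {z. z ^ m = 1 \<and> Im z \<noteq> 0})"
  have "finite {z :: complex. z ^ m = 1}" using \<open>0 < m\<close> by (intro finite_roots_unity) simp
  then have fin: "finite V" unfolding V_def by (intro finite.insertI finite_imageI) (auto intro: rev_finite_subset)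
  then have "0 < Min V" by (auto simp: V_def)
  from root approx_dist_small[OF Im this] show ?thesis
  proof eventually_elim
    case (elim x)
    show ?case
    proof (rule ccontr)
      assume "Im (z x) \<noteq> 0"
      with elim(1) have "\<bar>Im (z x)\<bar> \<in> V" by (auto simp: V_def)
      then have "Min V \<le> \<bar>Im (z x)\<bar>" using fin by simp
      with elim(2) show False by simp
    qed
  qed
qed

lemma bdd_root_of_unity:
  assumes "\<forall>\<^sub>F x in \<Phi>. z x ^ m = (1 :: complex)" "0 < m"
  shows "bdd z"
  by (rule bddI[of _ 1]) (use assms norm_root_of_unity in \<open>auto elim!: eventually_mono\<close>)

text \<open>
  Extraction of a \<open>k\<close>-th root is Lipschitz near \<open>c > 0\<close> since
  \<open>|x - c| c\<^bsup>k-1\<^esup> \<le> |x\<^sup>k - c\<^sup>k|\<close> for \<open>x \<ge> 0\<close>.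
\<close>
lemma approx_power_cancel:
  assumes "(\<lambda>x. f x ^ k) \<simeq> (\<lambda>_. c ^ k)" "\<forall>\<^sub>F x in \<Phi>. 0 \<le> f x" "0 < c" "1 \<le> k"
  shows "f \<simeq> (\<lambda>_. c :: real)"
proof -
  have "(\<lambda>x. c ^ (k - 1) * (f x - c)) \<simeq> (\<lambda>_. 0)"
  proof (rule approx_zero_mono)
    show "(\<lambda>x. f x ^ k - c ^ k) \<simeq> (\<lambda>_. 0)" using assms(1) by (simp add: approx_diff_zero_iff)
    show "\<forall>\<^sub>F x in \<Phi>. norm (c ^ (k - 1) * (f x - c)) \<le> norm (f x ^ k - c ^ k)"
      using assms(2)
    proof eventually_elim
      case (elim x)
      then show ?case using abs_diff_power_ge[of "f x" c k] assms(3,4) by (simp add: abs_mult mult.commute)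
    qed
  qed
  then have "(\<lambda>x. c ^ (k - 1) * (f x - c)) \<simeq> (\<lambda>_. c ^ (k - 1) * 0)" by simp
  then have "(\<lambda>x. f x - c) \<simeq> (\<lambda>_. 0)"
    by (rule approx_cancel[OF approx_const, rotated]) (use assms(3) in simp)
  then show ?thesis by (simp add: approx_diff_zero_iff)
qed

end

section \<open>Stability of the learning algorithm\<close>

text \<open>
  The nondegeneracy conditions in the form in which the estimates use them: sets of indices replace
  squarefree monomials, the condition on \<open>\<O>\<^sub>\<alpha>\<close> is stated for the only index \<open>l > k\<close> of \<open>\<alpha>\<close>, and the
  condition on the eigenvalues of \<open>N(\<xi>)\<close> is replaced by what it says about the means.
\<close>
locale nondegenerate_mixture =
  fixes n m p k r :: nat and \<omega> :: "nat \<Rightarrow> real" and \<mu> :: "nat \<Rightarrow> nat \<Rightarrow> real"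
    and \<xi> :: "nat \<Rightarrow> complex" and \<B> :: "nat set set"
  assumes weights: "\<And>i. i < r \<Longrightarrow> 0 < \<omega> i"
    and lead: "\<And>i. i < r \<Longrightarrow> \<mu> i 0 \<noteq> 0"
    and p: "1 \<le> p" "p + 2 \<le> m" and kn: "k < n"
    and B_sub: "\<B> \<subseteq> {S. S \<subseteq> {1..k} \<and> card S = p}"
    and B_indep: "lin_indep r \<B> (\<lambda>i S. prod (\<mu> i) S)"
    and O_indep: "\<And>l. l \<in> {k+1..n} \<Longrightarrow>
      lin_indep r {T. T \<subseteq> {k+1..n} - {l} \<and> card T = m - p - 1} (\<lambda>i T. prod (\<mu> i) T)"
    and ratios: "inj_on (\<lambda>i. \<Sum>l=k+1..n. \<xi> l * complex_of_real (\<mu> i l / \<mu> i 0)) {..<r}"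

locale perturbed_mixture = vanishing_error \<Phi> \<epsilon> + nondegenerate_mixture n m p k r \<omega> \<mu> \<xi> \<B>
  for \<Phi> :: "'x filter" and \<epsilon> n m p k r \<omega> \<mu> \<xi> \<B>
begin

lemma m_pos: "0 < m" using p by simp

text \<open>
  The vector \<open>q\<^sub>i\<close>, whose \<open>m\<close>-th tensor power is \<open>\<omega>\<^sub>i \<mu>\<^sub>i\<^sup>\<otimes>\<^sup>m\<close>.
\<close>
definition scaled_mean :: "nat \<Rightarrow> nat \<Rightarrow> real" where "scaled_mean i j = root m (\<omega> i) * \<mu> i j"

lemma root_weight_pos: "i < r \<Longrightarrow> 0 < root m (\<omega> i)"
  using weights m_pos by simp

lemma root_weight_power: "i < r \<Longrightarrow> root m (\<omega> i) ^ m = \<omega> i"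
  using weights m_pos by (simp add: less_imp_le)

lemma weighted_decomposition_stability:
  fixes q' :: "'x \<Rightarrow> nat \<Rightarrow> nat \<Rightarrow> complex"
  assumes near: "\<And>is. is \<in> Omega (n + 1) m \<Longrightarrow>
    (\<lambda>x. \<Sum>i<r. tpow (q' x i) is) \<simeq> (\<lambda>_. complex_of_real (\<Sum>i<r. \<omega> i * tpow (\<mu> i) is))"
  shows "\<exists>\<pi> \<zeta>. (\<forall>x. \<pi> x permutes {..<r}) \<and> (\<forall>x i. \<zeta> x i ^ m = 1) \<and>
    (\<forall>i<r. \<forall>j\<le>n. (\<lambda>x. q' x (\<pi> x i) j) \<simeq> (\<lambda>x. \<zeta> x i * complex_of_real (scaled_mean i j)))"
proof -
  define q where "q i j = complex_of_real (scaled_mean i j)" for i j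
  have prod_q: "prod (q i) S = complex_of_real (root m (\<omega> i)) ^ card S * complex_of_real (prod (\<mu> i) S)" for i S
    by (simp add: q_def scaled_mean_def prod.distrib)
  have scale: "lin_indep r I (\<lambda>i S. prod (q i) S)"
    if "lin_indep r I (\<lambda>i S. prod (\<mu> i) S)" and "\<And>S. S \<in> I \<Longrightarrow> card S = s" for I s
    by (rule lin_indep_scale[OF lin_indep_complex[OF that(1)], where b = "\<lambda>i. complex_of_real (root m (\<omega> i)) ^ s"])
      (use that(2) root_weight_pos in \<open>auto simp: prod_q less_imp_neq[THEN not_sym]\<close>)
  have "\<exists>\<pi> \<zeta>. (\<forall>x. \<pi> x permutes {..<r}) \<and> (\<forall>x i. \<zeta> x i ^ m = 1) \<and>
    (\<forall>i<r. \<forall>j\<le>n. (\<lambda>x. q' x (\<pi> x i) j) \<simeq> (\<lambda>x. \<zeta> x i * q i j))"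
  proof (rule decomposition_stability[where k = k and p = p and \<B> = \<B> and \<xi> = \<xi>])
    fix S assume S: "S \<subseteq> {..n}" "card S = m"
    have fin: "finite S" using S(1) finite_subset by blast
    have "sorted_list_of_set S \<in> Omega (n + 1) m"
      using S fin by (auto simp: Omega_def tuples_def)
    from near[OF this] fin have "(\<lambda>x. \<Sum>i<r. prod (q' x i) S) \<simeq> (\<lambda>_. complex_of_real (\<Sum>i<r. \<omega> i * prod (\<mu> i) S))"
      by (simp add: tpow_sorted_list_of_set)
    moreover have "(\<Sum>i<r. prod (q i) S) = complex_of_real (\<Sum>i<r. \<omega> i * prod (\<mu> i) S)"
      unfolding prod_q S(2) of_real_sum
      by (intro sum.cong refl) (simp add: of_real_power[symmetric] root_weight_power del: of_real_power)
    ultimately show "(\<lambda>x. \<Sum>i<r. prod (q' x i) S) \<simeq> (\<lambda>_. \<Sum>i<r. prod (q i) S)" by simp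
  next
    show "q i 0 \<noteq> 0" if "i < r" for i
      using lead[OF that] root_weight_pos[OF that] by (simp add: q_def scaled_mean_def)
    show "lin_indep r \<B> (\<lambda>i S. prod (q i) S)" by (rule scale[of \<B> p, OF B_indep]) (use B_sub in auto)
    show "lin_indep r {T. T \<subseteq> {k + 1..n} - {l} \<and> card T = m - p - 1} (\<lambda>i T. prod (q i) T)"
      if "l \<in> {k + 1..n}" for l by (rule scale[of _ "m - p - 1", OF O_indep[OF that]]) auto
    have ratio: "q i l / q i 0 = complex_of_real (\<mu> i l / \<mu> i 0)" if "i < r" for i l
      using root_weight_pos[OF that] by (simp add: q_def scaled_mean_def)
    show "inj_on (\<lambda>i. \<Sum>l=k+1..n. \<xi> l * (q i l / q i 0)) {..<r}"
      by (rule inj_on_cong[THEN iffD2, OF _ ratios]) (simp only: ratio lessThan_iff)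
  qed (use p kn B_sub in auto)
  then show ?thesis by (simp add: q_def)
qed

text \<open>
  Rotating \<open>q\<^sup>*\<^sub>i\<close> by the inverse of the root of unity \<open>\<zeta>\<^sub>i\<close> makes its imaginary part \<open>O(\<epsilon>)\<close>, hence so
  does the optimal \<open>\<eta>\<^sub>i\<close>. The leading entry is real and nonzero, so \<open>\<eta>\<^sub>i \<zeta>\<^sub>i\<close> must be a real root of
  unity, which is invisible in tensor powers of order \<open>m\<close>. The
  statement is about the sum of the powers because the components are matched here by another
  permutation than in the final output.
\<close>
lemma corrected_power_sums:
  fixes qs :: "'x \<Rightarrow> nat \<Rightarrow> nat \<Rightarrow> complex"
  assumes near: "\<And>is. is \<in> Omega (n + 1) m \<Longrightarrow>
      (\<lambda>x. \<Sum>i<r. tpow (qs x i) is) \<simeq> (\<lambda>_. complex_of_real (\<Sum>i<r. \<omega> i * tpow (\<mu> i) is))"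
    and \<eta>: "\<forall>\<^sub>F x in \<Phi>. \<forall>i<r. is_arg_min (\<lambda>e. nrm {..<n+1} (\<lambda>j. Im (e * qs x i j))) (\<lambda>e. e ^ m = 1) (\<eta> x i)"
    and qc: "\<forall>\<^sub>F x in \<Phi>. \<forall>i<r. \<forall>j<n+1. qc x i j = Re (\<eta> x i * qs x i j)"
    and "is": "length is = m" "set is \<subseteq> {..<n+1}"
  shows "(\<lambda>x. \<Sum>i<r. tpow (qc x i) is) \<simeq> (\<lambda>_. \<Sum>i<r. \<omega> i * tpow (\<mu> i) is)"
proof -
  obtain \<pi> \<zeta> where \<pi>: "\<And>x. \<pi> x permutes {..<r}" and \<zeta>: "\<And>x i. \<zeta> x i ^ m = 1"
    and close: "\<And>i j. i < r \<Longrightarrow> j \<le> n \<Longrightarrow> (\<lambda>x. qs x (\<pi> x i) j) \<simeq> (\<lambda>x. \<zeta> x i * complex_of_real (scaled_mean i j))"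
    using weighted_decomposition_stability[OF near] by blast
  have \<pi>r: "\<pi> x i < r" if "i < r" for x i using permutes_in_image[OF \<pi>, of x i] that by simp
  have "(\<lambda>x. tpow (qc x (\<pi> x i)) is) \<simeq> (\<lambda>_. \<omega> i * tpow (\<mu> i) is)" if i: "i < r" for i
  proof -
    define \<rho> where "\<rho> x = \<eta> x (\<pi> x i) * \<zeta> x i" for x
    have \<eta>1: "\<forall>\<^sub>F x in \<Phi>. \<eta> x (\<pi> x i) ^ m = 1"
      using \<eta> by eventually_elim (use \<pi>r[OF i] in \<open>auto simp: is_arg_min_def\<close>)
    have rotated: "(\<lambda>x. \<eta> x (\<pi> x i) * qs x (\<pi> x i) j) \<simeq> (\<lambda>x. \<rho> x * complex_of_real (scaled_mean i j))" if "j \<le> n" for j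
      using approx_mult[OF approx_refl[OF bdd_root_of_unity[OF \<eta>1 m_pos]] close[OF i that]]
      by (simp add: \<rho>_def mult.assoc)
    have "bdd (\<lambda>x. cnj (\<zeta> x i))"
      by (rule bddI[of _ 1]) (simp add: norm_root_of_unity[OF \<zeta> m_pos])
    have unrotated: "(\<lambda>x. Im (cnj (\<zeta> x i) * qs x (\<pi> x i) j)) \<simeq> (\<lambda>_. 0)" if "j \<le> n" for j
    proof -
      have "cnj (\<zeta> x i) * \<zeta> x i = 1" for x
        using norm_root_of_unity[OF \<zeta> m_pos, of x i] by (metis complex_norm_square mult.commute of_real_1 power_one)
      then have cancel: "cnj (\<zeta> x i) * (\<zeta> x i * complex_of_real (scaled_mean i j)) = complex_of_real (scaled_mean i j)" for x
        by (simp add: mult.assoc[symmetric])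
      have "(\<lambda>x. cnj (\<zeta> x i) * qs x (\<pi> x i) j) \<simeq> (\<lambda>_. complex_of_real (scaled_mean i j))"
        using approx_mult[OF approx_refl[OF \<open>bdd (\<lambda>x. cnj (\<zeta> x i))\<close>] close[OF i that]] unfolding cancel .
      from approx_linear[OF this bounded_linear_Im] show ?thesis by simp
    qed
    have "(\<lambda>x. Im (\<eta> x (\<pi> x i) * qs x (\<pi> x i) 0)) \<simeq> (\<lambda>_. 0)"
    proof (rule approx_zero_if_nrm_le[where I = "{..<n+1}" and f = "\<lambda>x j. Im (\<eta> x (\<pi> x i) * qs x (\<pi> x i) j)"])
      show "(\<lambda>x. nrm {..<n+1} (\<lambda>j. Im (cnj (\<zeta> x i) * qs x (\<pi> x i) j))) \<simeq> (\<lambda>_. 0)"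
        by (intro approx_nrm_zero unrotated) simp
      show "\<forall>\<^sub>F x in \<Phi>. nrm {..<n+1} (\<lambda>j. Im (\<eta> x (\<pi> x i) * qs x (\<pi> x i) j)) \<le>
          nrm {..<n+1} (\<lambda>j. Im (cnj (\<zeta> x i) * qs x (\<pi> x i) j))"
        using \<eta>
      proof eventually_elim
        case (elim x)
        have "cnj (\<zeta> x i) ^ m = 1" using \<zeta>[of x i] by (metis complex_cnj_one complex_cnj_power)
        with elim \<pi>r[OF i] show ?case unfolding is_arg_min_def by (meson not_less)
      qed
    qed auto
    with approx_linear[OF rotated[of 0] bounded_linear_Im]
    have "(\<lambda>x. Im (\<rho> x * complex_of_real (scaled_mean i 0))) \<simeq> (\<lambda>_. 0)"
      using approx_trans approx_sym by blast
    then have "(\<lambda>x. scaled_mean i 0 * Im (\<rho> x)) \<simeq> (\<lambda>x. scaled_mean i 0 * 0)" by (simp add: mult.commute)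
    moreover have "scaled_mean i 0 \<noteq> 0" using lead[OF i] root_weight_pos[OF i] by (simp add: scaled_mean_def)
    ultimately have "(\<lambda>x. Im (\<rho> x)) \<simeq> (\<lambda>_. 0)" by (rule approx_cancel[OF approx_const, rotated])
    moreover have \<rho>1: "\<forall>\<^sub>F x in \<Phi>. \<rho> x ^ m = 1"
      using \<eta>1 by eventually_elim (simp add: \<rho>_def power_mult_distrib \<zeta>)
    ultimately have real: "\<forall>\<^sub>F x in \<Phi>. Im (\<rho> x) = 0" using root_of_unity_eventually_real m_pos by blast
    have qc_close: "(\<lambda>x. qc x (\<pi> x i) j) \<simeq> (\<lambda>x. Re (\<rho> x) * scaled_mean i j)" if "j \<le> n" for j
    proof (rule approx_cong[OF approx_linear[OF rotated[OF that] bounded_linear_Re]])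
      show "\<forall>\<^sub>F x in \<Phi>. Re (\<eta> x (\<pi> x i) * qs x (\<pi> x i) j) = qc x (\<pi> x i) j"
        using qc by eventually_elim (use that \<pi>r[OF i] in auto)
    qed simp
    have "(\<lambda>x. tpow (qc x (\<pi> x i)) is) \<simeq> (\<lambda>x. tpow (\<lambda>j. Re (\<rho> x) * scaled_mean i j) is)"
      using "is"(2) by (intro approx_tpow qc_close) auto
    then show ?thesis
    proof (rule approx_cong)
      show "\<forall>\<^sub>F x in \<Phi>. tpow (\<lambda>j. Re (\<rho> x) * scaled_mean i j) is = \<omega> i * tpow (\<mu> i) is"
        using real \<rho>1
      proof eventually_elim
        case (elim x)
        then have "\<rho> x = complex_of_real (Re (\<rho> x))" by (simp add: complex_eq_iff)
        then have "complex_of_real (Re (\<rho> x) ^ m) = 1" using elim(2) by (metis of_real_power)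
        then have "Re (\<rho> x) ^ m = 1" using of_real_eq_1_iff by blast
        then show ?case
          using "is"(1) root_weight_power[OF i] by (simp add: tpow_scale scaled_mean_def[abs_def])
      qed
    qed simp
  qed
  then have "(\<lambda>x. \<Sum>i<r. tpow (qc x (\<pi> x i)) is) \<simeq> (\<lambda>_. \<Sum>i<r. \<omega> i * tpow (\<mu> i) is)"
    by (intro approx_sum) simp
  moreover have "(\<Sum>i<r. tpow (qc x (\<pi> x i)) is) = (\<Sum>i<r. tpow (qc x i) is)" for x
    using sum.permute[OF \<pi>[of x], of "\<lambda>i. tpow (qc x i) is"] by (simp add: comp_def)
  ultimately show ?thesis by simp
qed

text \<open>
  The vectors \<open>\<omega>\<^sup>*\<^sub>i\<^bsup>1/m\<^esup> \<mu>\<^sup>*\<^sub>i\<close> are real competitors in \<open>weighted_decomposition_stability\<close>, so they are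
  close to \<open>s\<^sub>i q\<^sub>i\<close> with a sign \<open>s\<^sub>i\<close> satisfying \<open>s\<^sub>i\<^sup>m = 1\<close>. With \<open>R\<^sub>i = \<omega>\<^sup>*\<^sub>i\<^bsup>1/m\<^esup>\<close> the moments of order \<open>t\<close>
  are \<open>\<Sum>\<^sub>i R\<^sub>i\<^bsup>m-t\<^esup> (R\<^sub>i \<mu>\<^sup>*\<^sub>i)\<^sup>\<otimes>\<^sup>t\<close>; this form remains meaningful for vanishing weights. Linear independence of the
  \<open>t\<close>-th powers yields \<open>R\<^sub>i\<^bsup>m-t\<^esup> s\<^sub>i\<^sup>t \<simeq> \<omega>\<^sub>i\<^bsup>(m-t)/m\<^esup> > 0\<close>, which forces \<open>s\<^sub>i\<^sup>t = 1\<close> and determines the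
  weight, and then the mean.
\<close>
lemma weights_and_means_stability:
  fixes ws :: "'x \<Rightarrow> nat \<Rightarrow> real" and ms :: "'x \<Rightarrow> nat \<Rightarrow> nat \<Rightarrow> real"
  assumes near_m: "\<And>is. is \<in> Omega (n + 1) m \<Longrightarrow>
      (\<lambda>x. \<Sum>i<r. ws x i * tpow (ms x i) is) \<simeq> (\<lambda>_. \<Sum>i<r. \<omega> i * tpow (\<mu> i) is)"
    and near_t: "\<And>is. is \<in> Omega (n + 1) t \<Longrightarrow>
      (\<lambda>x. \<Sum>i<r. ws x i * tpow (ms x i) is) \<simeq> (\<lambda>_. \<Sum>i<r. \<omega> i * tpow (\<mu> i) is)"
    and ws: "\<forall>\<^sub>F x in \<Phi>. (\<Sum>i<r. ws x i) = 1 \<and> (\<forall>i<r. 0 \<le> ws x i)"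
    and "t < m" and indep_t: "lin_indep r (Omega (n + 1) t) (\<lambda>i. tpow (\<mu> i))"
  shows "\<exists>\<pi> s. (\<forall>x. \<pi> x permutes {..<r}) \<and>
    (\<forall>i<r. \<forall>\<^sub>F x in \<Phi>. s x i = 1 \<or> s x i = - 1 \<and> even m \<and> even t) \<and>
    (\<forall>i<r. (\<lambda>x. ws x (\<pi> x i)) \<simeq> (\<lambda>_. \<omega> i)) \<and>
    (\<forall>i<r. \<forall>j\<le>n. (\<lambda>x. ms x (\<pi> x i) j) \<simeq> (\<lambda>x. s x i * \<mu> i j))"
proof -
  define R where "R x i = root m (ws x i)" for x i
  have R: "\<forall>\<^sub>F x in \<Phi>. \<forall>i<r. 0 \<le> R x i \<and> R x i \<le> 1 \<and> R x i ^ m = ws x i"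
    using ws
  proof eventually_elim
    case (elim x)
    show ?case
    proof (intro allI impI)
      fix i assume i: "i < r"
      have "ws x i \<le> (\<Sum>i<r. ws x i)" using elim i by (intro member_le_sum) auto
      then show "0 \<le> R x i \<and> R x i \<le> 1 \<and> R x i ^ m = ws x i"
        using elim i m_pos by (simp add: R_def)
    qed
  qed
  have near_q: "(\<lambda>x. \<Sum>i<r. tpow (\<lambda>j. complex_of_real (R x i * ms x i j)) is) \<simeq>
      (\<lambda>_. complex_of_real (\<Sum>i<r. \<omega> i * tpow (\<mu> i) is))" if "is": "is \<in> Omega (n + 1) m" for "is"
  proof (rule approx_cong[OF approx_linear[OF near_m[OF "is"] bounded_linear_of_real]])
    have "length is = m" using "is" by (simp add: Omega_def tuples_def)
    then show "\<forall>\<^sub>F x in \<Phi>. complex_of_real (\<Sum>i<r. ws x i * tpow (ms x i) is) =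
        (\<Sum>i<r. tpow (\<lambda>j. complex_of_real (R x i * ms x i j)) is)"
      using R by (auto elim!: eventually_mono simp only: tpow_of_real tpow_scale of_real_sum intro!: sum.cong)
  qed simp
  obtain \<pi> \<zeta> where \<pi>: "\<And>x. \<pi> x permutes {..<r}" and \<zeta>: "\<And>x i. \<zeta> x i ^ m = 1"
    and close: "\<And>i j. i < r \<Longrightarrow> j \<le> n \<Longrightarrow>
      (\<lambda>x. complex_of_real (R x (\<pi> x i) * ms x (\<pi> x i) j)) \<simeq> (\<lambda>x. \<zeta> x i * complex_of_real (scaled_mean i j))"
    using weighted_decomposition_stability[OF near_q] by blast
  have \<pi>r: "\<pi> x i < r" if "i < r" for x i using permutes_in_image[OF \<pi>, of x i] that by simp
  define s where "s x i = Re (\<zeta> x i)" for x i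
  have sign: "\<forall>\<^sub>F x in \<Phi>. s x i = 1 \<or> s x i = - 1 \<and> even m" if i: "i < r" for i
  proof -
    have "(\<lambda>x. scaled_mean i 0 * Im (\<zeta> x i)) \<simeq> (\<lambda>x. scaled_mean i 0 * 0)"
      using approx_sym[OF approx_linear[OF close[OF i, of 0] bounded_linear_Im]] by (simp add: mult.commute)
    moreover have "scaled_mean i 0 \<noteq> 0" using lead[OF i] root_weight_pos[OF i] by (simp add: scaled_mean_def)
    ultimately have "(\<lambda>x. Im (\<zeta> x i)) \<simeq> (\<lambda>_. 0)" by (rule approx_cancel[OF approx_const, rotated])
    then have "\<forall>\<^sub>F x in \<Phi>. Im (\<zeta> x i) = 0"
      by (intro root_of_unity_eventually_real[OF _ m_pos]) (simp_all add: \<zeta>)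
    then show ?thesis
    proof eventually_elim
      case (elim x)
      then have eq: "\<zeta> x i = complex_of_real (s x i)" by (simp add: complex_eq_iff s_def)
      then have "complex_of_real (s x i ^ m) = 1" using \<zeta>[of x i] by simp
      then have sm: "s x i ^ m = 1" using of_real_eq_1_iff by blast
      have "\<bar>s x i\<bar> = 1" using norm_root_of_unity[OF \<zeta> m_pos, of x i] eq by simp
      then have "s x i = 1 \<or> s x i = - 1" by linarith
      with sm show ?case by (cases "even m") auto
    qed
  qed
  have bdd_s: "bdd (\<lambda>x. s x i)" if "i < r" for i
    by (rule bddI[of _ 1]) (use sign[OF that] in \<open>auto elim!: eventually_mono\<close>)
  have scaled_means: "(\<lambda>x. R x (\<pi> x i) * ms x (\<pi> x i) j) \<simeq> (\<lambda>x. s x i * scaled_mean i j)" if "i < r" "j \<le> n" for i j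
    using approx_linear[OF close[OF that] bounded_linear_Re] by (simp add: s_def)
  have bdd_R: "bdd (\<lambda>x. R x (\<pi> x i) ^ e)" if "i < r" for i e
  proof (rule bddI[of _ 1])
    show "\<forall>\<^sub>F x in \<Phi>. norm (R x (\<pi> x i) ^ e) \<le> 1"
      using R by eventually_elim (use \<pi>r[OF that] in \<open>simp add: power_le_one\<close>)
  qed
  have coefficient: "(\<lambda>x. R x (\<pi> x i) ^ (m - t) * s x i ^ t) \<simeq> (\<lambda>_. root m (\<omega> i) ^ (m - t))" if i: "i < r" for i
  proof -
    define c where "c x i = R x (\<pi> x i) ^ (m - t) * s x i ^ t - root m (\<omega> i) ^ (m - t)" for x i
    have "(\<lambda>x. c x i) \<simeq> (\<lambda>_. 0)"
    proof (rule approx_coefficients[where I = "Omega (n + 1) t" and u = "\<lambda>i. tpow (scaled_mean i)" and v = "\<lambda>x i. tpow (scaled_mean i)", OF finite_Omega])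
      show "lin_indep r (Omega (n + 1) t) (\<lambda>i. tpow (scaled_mean i))"
        by (rule lin_indep_scale[OF indep_t, where b = "\<lambda>i. root m (\<omega> i) ^ t"])
          (use root_weight_pos in \<open>auto simp: scaled_mean_def[abs_def] tpow_scale Omega_def tuples_def less_imp_neq[THEN not_sym]\<close>)
    next
      fix "is" assume "is": "is \<in> Omega (n + 1) t"
      then have len: "length is = t" and sub: "set is \<subseteq> {..n}" by (auto simp: Omega_def tuples_def)
      have summand: "(\<lambda>x. R x (\<pi> x i) ^ (m - t) * tpow (\<lambda>j. R x (\<pi> x i) * ms x (\<pi> x i) j) is) \<simeq>
          (\<lambda>x. R x (\<pi> x i) ^ (m - t) * tpow (\<lambda>j. s x i * scaled_mean i j) is)" if "i < r" for i
        using sub that by (intro approx_mult approx_refl bdd_R approx_tpow scaled_means) auto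
      have powers: "\<forall>\<^sub>F x in \<Phi>. (\<Sum>i<r. R x (\<pi> x i) ^ (m - t) * tpow (\<lambda>j. R x (\<pi> x i) * ms x (\<pi> x i) j) is)
          = (\<Sum>i<r. ws x i * tpow (ms x i) is)"
        using R
      proof eventually_elim
        case (elim x)
        have "(\<Sum>i<r. R x (\<pi> x i) ^ (m - t) * tpow (\<lambda>j. R x (\<pi> x i) * ms x (\<pi> x i) j) is)
            = (\<Sum>i<r. ws x (\<pi> x i) * tpow (ms x (\<pi> x i)) is)"
        proof (intro sum.cong refl)
          fix i assume "i \<in> {..<r}"
          then have "ws x (\<pi> x i) = R x (\<pi> x i) ^ (m - t) * R x (\<pi> x i) ^ t"
            using elim \<pi>r \<open>t < m\<close> by (simp add: power_add[symmetric])
          then show "R x (\<pi> x i) ^ (m - t) * tpow (\<lambda>j. R x (\<pi> x i) * ms x (\<pi> x i) j) is = ws x (\<pi> x i) * tpow (ms x (\<pi> x i)) is"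
            by (simp add: tpow_scale len)
        qed
        also have "\<dots> = (\<Sum>i<r. ws x i * tpow (ms x i) is)"
          using sum.permute[OF \<pi>[of x], of "\<lambda>i. ws x i * tpow (ms x i) is"] by (simp add: comp_def)
        finally show ?case .
      qed
      have limit: "(\<Sum>i<r. \<omega> i * tpow (\<mu> i) is) = (\<Sum>i<r. root m (\<omega> i) ^ (m - t) * tpow (scaled_mean i) is)"
      proof (intro sum.cong refl)
        fix i assume "i \<in> {..<r}"
        then have "\<omega> i = root m (\<omega> i) ^ (m - t) * root m (\<omega> i) ^ t"
          using root_weight_power[of i] \<open>t < m\<close> by (simp add: power_add[symmetric])
        then show "\<omega> i * tpow (\<mu> i) is = root m (\<omega> i) ^ (m - t) * tpow (scaled_mean i) is"
          unfolding scaled_mean_def[abs_def] tpow_scale len by (metis mult.assoc)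
      qed
      have "(\<lambda>x. \<Sum>i<r. R x (\<pi> x i) ^ (m - t) * tpow (\<lambda>j. s x i * scaled_mean i j) is) \<simeq>
          (\<lambda>x. \<Sum>i<r. R x (\<pi> x i) ^ (m - t) * tpow (\<lambda>j. R x (\<pi> x i) * ms x (\<pi> x i) j) is)"
        by (rule approx_sym[OF approx_sum]) (use summand in simp)
      also have "\<dots> \<simeq> (\<lambda>_. \<Sum>i<r. root m (\<omega> i) ^ (m - t) * tpow (scaled_mean i) is)"
        by (rule approx_cong[OF near_t[OF "is"]]) (use powers in \<open>auto simp: limit elim: eventually_mono\<close>)
      finally have "(\<lambda>x. (\<Sum>i<r. R x (\<pi> x i) ^ (m - t) * tpow (\<lambda>j. s x i * scaled_mean i j) is) -
          (\<Sum>i<r. root m (\<omega> i) ^ (m - t) * tpow (scaled_mean i) is)) \<simeq> (\<lambda>_. 0)"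
        by (simp add: approx_diff_zero_iff)
      then show "(\<lambda>x. \<Sum>i<r. c x i * tpow (scaled_mean i) is) \<simeq> (\<lambda>_. 0)"
        by (simp add: c_def tpow_scale len left_diff_distrib sum_subtractf mult.assoc)
    qed (use i in auto)
    then show ?thesis by (simp add: c_def approx_diff_zero_iff)
  qed
  have s_even: "\<forall>\<^sub>F x in \<Phi>. s x i = 1 \<or> s x i = - 1 \<and> even m \<and> even t" if i: "i < r" for i
  proof -
    have pos: "0 < root m (\<omega> i) ^ (m - t)" using root_weight_pos[OF i] by simp
    from R sign[OF i] approx_dist_small[OF coefficient[OF i] pos] show ?thesis
    proof eventually_elim
      case (elim x)
      have "0 \<le> R x (\<pi> x i) ^ (m - t)" using elim(1) \<pi>r[OF i] by simp
      moreover have "0 < R x (\<pi> x i) ^ (m - t) * s x i ^ t" using elim(3) by (simp add: abs_less_iff)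
      ultimately have "0 < s x i ^ t" by (metis not_less zero_less_mult_iff)
      with elim(2) show ?case by (cases "even t") auto
    qed
  qed
  have root_close: "(\<lambda>x. R x (\<pi> x i)) \<simeq> (\<lambda>_. root m (\<omega> i))" if i: "i < r" for i
  proof (rule approx_power_cancel)
    show "(\<lambda>x. R x (\<pi> x i) ^ (m - t)) \<simeq> (\<lambda>_. root m (\<omega> i) ^ (m - t))"
    proof (rule approx_cong[OF coefficient[OF i]])
      show "\<forall>\<^sub>F x in \<Phi>. R x (\<pi> x i) ^ (m - t) * s x i ^ t = R x (\<pi> x i) ^ (m - t)"
        using s_even[OF i] by eventually_elim auto
    qed simp
    show "\<forall>\<^sub>F x in \<Phi>. 0 \<le> R x (\<pi> x i)" using R by eventually_elim (use \<pi>r[OF i] in auto)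
  qed (use root_weight_pos[OF i] \<open>t < m\<close> in auto)
  have ws_close: "(\<lambda>x. ws x (\<pi> x i)) \<simeq> (\<lambda>_. \<omega> i)" if i: "i < r" for i
  proof (rule approx_cong[OF approx_power[OF root_close[OF i], of m]])
    show "\<forall>\<^sub>F x in \<Phi>. R x (\<pi> x i) ^ m = ws x (\<pi> x i)" using R by eventually_elim (use \<pi>r[OF i] in auto)
  qed (simp add: root_weight_power[OF i])
  have ms_close: "(\<lambda>x. ms x (\<pi> x i) j) \<simeq> (\<lambda>x. s x i * \<mu> i j)" if "i < r" "j \<le> n" for i j
    by (rule approx_cancel[OF root_close[OF that(1)]])
      (use root_weight_pos[OF that(1)] scaled_means[OF that] in \<open>auto simp: scaled_mean_def mult_ac\<close>)
  show ?thesis using \<pi> s_even ws_close ms_close by blast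
qed

text \<open>
  The true variances, permuted like the components, are feasible and have residual \<open>O(\<epsilon>)\<close>: the
  means contribute \<open>\<mu>\<^sub>i\<^sub>j\<^sup>2\<close>, which the corrected powers remove, and the sign \<open>s\<^sub>i\<close> drops out of the powers
  of order \<open>m - 2\<close> because it can be negative only for even \<open>m\<close>. So the difference between the
  computed and the true variances solves a homogeneous system up to \<open>O(\<epsilon>)\<close>.
\<close>
lemma covariance_stability:
  fixes \<sigma> :: "nat \<Rightarrow> nat \<Rightarrow> real"
  assumes \<pi>: "\<And>x. \<pi> x permutes {..<r}"
    and s: "\<And>i. i < r \<Longrightarrow> \<forall>\<^sub>F x in \<Phi>. s x i = 1 \<or> s x i = - 1 \<and> even m"
    and ws: "\<And>i. i < r \<Longrightarrow> (\<lambda>x. ws x (\<pi> x i)) \<simeq> (\<lambda>_. \<omega> i)"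
    and ms: "\<And>i j. i < r \<Longrightarrow> j \<le> n \<Longrightarrow> (\<lambda>x. ms x (\<pi> x i) j) \<simeq> (\<lambda>x. s x i * \<mu> i j)"
    and moment: "\<And>is. is \<in> Lhat (n + 1) m j \<Longrightarrow> (\<lambda>x. M x (j # j # is)) \<simeq>
      (\<lambda>_. \<Sum>i<r. \<omega> i * (((\<mu> i j)\<^sup>2 + (\<sigma> i j)\<^sup>2) * tpow (\<mu> i) is))"
    and qc: "\<And>is. is \<in> Lhat (n + 1) m j \<Longrightarrow>
      (\<lambda>x. \<Sum>i<r. tpow (qc x i) (j # j # is)) \<simeq> (\<lambda>_. \<Sum>i<r. \<omega> i * tpow (\<mu> i) (j # j # is))"
    and \<theta>: "\<forall>\<^sub>F x in \<Phi>. is_arg_min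
        (\<lambda>c. (nrm (Lhat (n + 1) m j) (\<lambda>is. (M x (j # j # is) - (\<Sum>i<r. tpow (qc x i) (j # j # is))) -
              (\<Sum>i<r. c i * ws x i * tpow (ms x i) is)))\<^sup>2)
        (\<lambda>c. \<forall>i<r. 0 \<le> c i) (\<theta> x)"
    and "i < r"
  shows "(\<lambda>x. \<theta> x (\<pi> x i)) \<simeq> (\<lambda>_. (\<sigma> i j)\<^sup>2)"
proof -
  let ?L = "Lhat (n + 1) m j"
  define res where "res x c is = (M x (j # j # is) - (\<Sum>i<r. tpow (qc x i) (j # j # is))) -
      (\<Sum>i<r. c i * ws x i * tpow (ms x i) is)" for x c "is"
  define c0 where "c0 x i = (\<sigma> (inv (\<pi> x) i) j)\<^sup>2" for x i
  have component: "(\<lambda>x. ws x (\<pi> x i) * tpow (ms x (\<pi> x i)) is) \<simeq> (\<lambda>_. \<omega> i * tpow (\<mu> i) is)"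
    if i: "i < r" and "is": "is \<in> ?L" for i "is"
  proof -
    have len: "length is = m - 2" and sub: "set is \<subseteq> {..n}" using "is" by (auto simp: Lhat_def)
    have "(\<lambda>x. ws x (\<pi> x i) * tpow (ms x (\<pi> x i)) is) \<simeq> (\<lambda>x. \<omega> i * tpow (\<lambda>j. s x i * \<mu> i j) is)"
      using sub i by (intro approx_mult ws approx_tpow ms) auto
    then show ?thesis
    proof (rule approx_cong)
      show "\<forall>\<^sub>F x in \<Phi>. \<omega> i * tpow (\<lambda>j. s x i * \<mu> i j) is = \<omega> i * tpow (\<mu> i) is"
        using s[OF i] by eventually_elim (auto simp: tpow_scale len)
    qed simp
  qed
  have reindex: "(\<Sum>i<r. c i * ws x i * tpow (ms x i) is) = (\<Sum>i<r. c (\<pi> x i) * (ws x (\<pi> x i) * tpow (ms x (\<pi> x i)) is))"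
    for x c "is"
    using sum.permute[OF \<pi>[of x], of "\<lambda>i. c i * ws x i * tpow (ms x i) is"] by (simp add: comp_def mult.assoc)
  have c0\<pi>: "c0 x (\<pi> x i) = (\<sigma> i j)\<^sup>2" for x i
    by (simp add: c0_def permutes_inverses(2)[OF \<pi>])
  have res0: "(\<lambda>x. res x (c0 x) is) \<simeq> (\<lambda>_. 0)" if "is": "is \<in> ?L" for "is"
  proof -
    have "(\<lambda>x. res x (c0 x) is) \<simeq> (\<lambda>_. ((\<Sum>i<r. \<omega> i * (((\<mu> i j)\<^sup>2 + (\<sigma> i j)\<^sup>2) * tpow (\<mu> i) is)) -
        (\<Sum>i<r. \<omega> i * tpow (\<mu> i) (j # j # is))) - (\<Sum>i<r. (\<sigma> i j)\<^sup>2 * (\<omega> i * tpow (\<mu> i) is)))"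
      unfolding res_def reindex c0\<pi>
      by (intro approx_diff moment qc "is" approx_sum approx_mult approx_const component) auto
    also have "((\<Sum>i<r. \<omega> i * (((\<mu> i j)\<^sup>2 + (\<sigma> i j)\<^sup>2) * tpow (\<mu> i) is)) -
        (\<Sum>i<r. \<omega> i * tpow (\<mu> i) (j # j # is))) - (\<Sum>i<r. (\<sigma> i j)\<^sup>2 * (\<omega> i * tpow (\<mu> i) is)) = 0"
      unfolding sum_subtractf[symmetric]
      by (intro sum.neutral) (auto simp: tpow_def power2_eq_square algebra_simps)
    finally show ?thesis .
  qed
  have min: "\<forall>\<^sub>F x in \<Phi>. nrm ?L (res x (\<theta> x)) \<le> nrm ?L (res x (c0 x))"
    using \<theta>
  proof eventually_elim
    case (elim x)
    have "\<forall>i<r. 0 \<le> c0 x i" by (simp add: c0_def)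
    then show ?case
      by (rule minimizer_nrm_le[where g = "res x" and P = "\<lambda>c. \<forall>i<r. 0 \<le> c i", rotated]) (use elim in \<open>simp add: res_def[abs_def]\<close>)
  qed
  have res\<theta>: "(\<lambda>x. res x (\<theta> x) is) \<simeq> (\<lambda>_. 0)" if "is \<in> ?L" for "is"
    by (rule approx_zero_if_nrm_le[OF finite_Lhat that min approx_nrm_zero[OF res0]])
  have "(\<lambda>x. \<theta> x (\<pi> x i) - (\<sigma> i j)\<^sup>2) \<simeq> (\<lambda>_. 0)"
  proof (rule approx_coefficients[where I = ?L and u = "\<lambda>i is. \<omega> i * tpow (\<mu> i) is"
        and v = "\<lambda>x i is. ws x (\<pi> x i) * tpow (ms x (\<pi> x i)) is", OF finite_Lhat _ component _ \<open>i < r\<close>])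
    have "\<exists>S. S \<subseteq> {1..k} \<and> card S = p \<and> prod (\<mu> i) S \<noteq> 0" if "i < r" for i
      using lin_indep_nonzero[OF B_indep that] B_sub by blast
    from lin_indep_Lhat[OF p kn this O_indep] have "lin_indep r ?L (\<lambda>i. tpow (\<mu> i))" .
    then show "lin_indep r ?L (\<lambda>i is. \<omega> i * tpow (\<mu> i) is)"
      by (rule lin_indep_scale[where b = \<omega>]) (use weights in \<open>auto simp: less_imp_neq[THEN not_sym]\<close>)
  next
    fix "is" assume "is": "is \<in> ?L"
    have "(\<lambda>x. res x (c0 x) is - res x (\<theta> x) is) \<simeq> (\<lambda>_. 0 - 0)"
      by (intro approx_diff res0 res\<theta> "is")
    moreover have "res x (c0 x) is - res x (\<theta> x) is =
        (\<Sum>i<r. (\<theta> x (\<pi> x i) - (\<sigma> i j)\<^sup>2) * (ws x (\<pi> x i) * tpow (ms x (\<pi> x i)) is))" for x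
      unfolding res_def reindex c0\<pi> by (simp add: left_diff_distrib sum_subtractf)
    ultimately show "(\<lambda>x. \<Sum>i<r. (\<theta> x (\<pi> x i) - (\<sigma> i j)\<^sup>2) * (ws x (\<pi> x i) * tpow (ms x (\<pi> x i)) is)) \<simeq> (\<lambda>_. 0)"
      by simp
  qed
  then show ?thesis by (simp add: approx_diff_zero_iff)
qed

end

lemma mon_eval_of_real: "mon_eval f (\<lambda>j. complex_of_real (v j)) = complex_of_real (mon_eval f v)"
  unfolding mon_eval_def by (induction f) simp_all

text \<open>
  Translation of a statement along the error filter into one with an explicit threshold.
\<close>
lemma eventually_vanishingD:
  fixes e :: "'x \<Rightarrow> real"
  assumes "eventually P (inf (filtercomap e (nhds 0)) (principal S))"
  shows "\<exists>\<delta>>0. \<forall>x\<in>S. \<bar>e x\<bar> \<le> \<delta> \<longrightarrow> P x"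
proof -
  from assms obtain Q where Q: "eventually Q (nhds 0)" "\<And>x. Q (e x) \<Longrightarrow> x \<in> S \<Longrightarrow> P x"
    unfolding eventually_inf_principal eventually_filtercomap by blast
  then obtain \<delta> where "0 < \<delta>" "\<And>y. \<bar>y\<bar> < \<delta> \<Longrightarrow> Q y"
    unfolding eventually_nhds_metric dist_real_def by auto
  with Q(2) show ?thesis by (intro exI[of _ "\<delta> / 2"]) auto
qed

text \<open>
  The steps of the algorithm that constrain its output, with their intermediate results as
  parameters. Naming these makes a run a single point, along which a filter can be taken.
\<close>
definition learning_run ::
    "nat \<Rightarrow> nat \<Rightarrow> nat \<Rightarrow> nat \<Rightarrow> (nat list \<Rightarrow> real) \<Rightarrow> (nat \<Rightarrow> real) \<Rightarrow> (nat \<Rightarrow> nat \<Rightarrow> real) \<Rightarrow>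
     (nat \<Rightarrow> nat \<Rightarrow> complex) \<Rightarrow> (nat \<Rightarrow> complex) \<Rightarrow> (nat \<Rightarrow> nat \<Rightarrow> real) \<Rightarrow> (nat \<Rightarrow> nat \<Rightarrow> real) \<Rightarrow> bool"
where
  "learning_run d m t r M ws ms qs \<eta> qc \<theta> \<longleftrightarrow>
     is_arg_min (\<lambda>q. (nrm (Omega d m) (\<lambda>is. complex_of_real (M is) - (\<Sum>i<r. tpow (q i) is)))\<^sup>2) (\<lambda>_. True) qs \<and>
     (\<forall>i<r. is_arg_min (\<lambda>e. nrm {..<d} (\<lambda>j. Im (e * qs i j))) (\<lambda>e. e ^ m = 1) (\<eta> i)) \<and>
     (\<forall>i<r. \<forall>j<d. qc i j = Re (\<eta> i * qs i j)) \<and>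
     is_arg_min
       (\<lambda>(w, u). (nrm (Omega d m) (\<lambda>is. M is - (\<Sum>i<r. w i * tpow (u i) is)))\<^sup>2 +
                 (nrm (Omega d t) (\<lambda>is. M is - (\<Sum>i<r. w i * tpow (u i) is)))\<^sup>2)
       (\<lambda>(w, u). (\<Sum>i<r. w i) = 1 \<and> (\<forall>i<r. 0 \<le> w i)) (ws, ms) \<and>
     (\<forall>j<d. is_arg_min
        (\<lambda>c. (nrm (Lhat d m j)
           (\<lambda>is. (M (j # j # is) - (\<Sum>i<r. tpow (qc i) (j # j # is))) -
                 (\<Sum>i<r. c i * ws i * tpow (ms i) is)))\<^sup>2)
        (\<lambda>c. \<forall>i<r. 0 \<le> c i) (\<lambda>i. \<theta> i j))"

lemma learning_output_run:
  assumes "0 < d" "learning_output d m t p k r \<xi> M M ws ms Ss"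
  shows "\<exists>qs \<eta> qc \<theta>. learning_run d m t r M ws ms qs \<eta> qc \<theta> \<and> (\<forall>i<r. Ss i = diagm (\<theta> i))"
  using assms unfolding learning_output_def subroutine_output_def learning_run_def by auto

context perturbed_mixture
begin

text \<open>
  Each fitting step is compared with the true parameters: the scaled means for the subroutine, and
  weights and means for the joint refinement, where both residuals are bounded by the sum of the two
  true ones.
\<close>
lemma learning_stability:
  fixes M :: "'x \<Rightarrow> nat list \<Rightarrow> real" and \<sigma> :: "nat \<Rightarrow> nat \<Rightarrow> real"
  assumes total: "(\<Sum>i<r. \<omega> i) = 1" and "t < m"
    and indep_t: "lin_indep r (Omega (n + 1) t) (\<lambda>i. tpow (\<mu> i))"
    and near: "\<And>is. is \<in> tuples (n + 1) m \<union> tuples (n + 1) t \<Longrightarrow>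
      (\<lambda>x. M x is) \<simeq> (\<lambda>_. moment (mixture (n + 1) r \<omega> \<mu> \<sigma>) is)"
    and run: "\<forall>\<^sub>F x in \<Phi>. learning_run (n + 1) m t r (M x) (ws x) (ms x) (qs x) (\<eta> x) (qc x) (\<theta> x)"
  shows "\<exists>\<pi> s. (\<forall>x. \<pi> x permutes {..<r}) \<and>
    (\<forall>i<r. \<forall>\<^sub>F x in \<Phi>. s x i = 1 \<or> s x i = - 1 \<and> even m \<and> even t) \<and>
    (\<forall>i<r. (\<lambda>x. ws x (\<pi> x i)) \<simeq> (\<lambda>_. \<omega> i)) \<and>
    (\<forall>i<r. \<forall>j\<le>n. (\<lambda>x. ms x (\<pi> x i) j) \<simeq> (\<lambda>x. s x i * \<mu> i j)) \<and>
    (\<forall>i<r. \<forall>j\<le>n. (\<lambda>x. \<theta> x (\<pi> x i) j) \<simeq> (\<lambda>_. (\<sigma> i j)\<^sup>2))"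
proof -
  define F where "F is = (\<Sum>i<r. \<omega> i * tpow (\<mu> i) is)" for "is"
  have \<omega>0: "0 \<le> \<omega> i" if "i < r" for i using weights[OF that] by simp
  have M_m: "(\<lambda>x. M x is) \<simeq> (\<lambda>_. F is)" if "is \<in> Omega (n + 1) m" for "is"
    using near[of "is"] that mixture_moment_distinct[of r \<omega> "is" "n + 1" m \<mu> \<sigma>, OF \<omega>0 that]
    by (auto simp: F_def Omega_def)
  have M_t: "(\<lambda>x. M x is) \<simeq> (\<lambda>_. F is)" if "is \<in> Omega (n + 1) t" for "is"
    using near[of "is"] that mixture_moment_distinct[of r \<omega> "is" "n + 1" t \<mu> \<sigma>, OF \<omega>0 that]
    by (auto simp: F_def Omega_def)
  have tensor: "(\<lambda>x. \<Sum>i<r. tpow (qs x i) is) \<simeq> (\<lambda>_. complex_of_real (F is))" if "is": "is \<in> Omega (n + 1) m" for "is"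
  proof -
    define res where "res x q is = complex_of_real (M x is) - (\<Sum>i<r. tpow (q i) is)" for x q "is"
    define q0 where "q0 i j = complex_of_real (scaled_mean i j)" for i j
    have q0: "(\<Sum>i<r. tpow (q0 i) is) = complex_of_real (F is)" if "is \<in> Omega (n + 1) m" for "is"
    proof -
      have "length is = m" using that by (simp add: Omega_def tuples_def)
      then show ?thesis
        unfolding F_def of_real_sum q0_def[abs_def] tpow_of_real scaled_mean_def[abs_def] tpow_scale
        by (intro sum.cong refl arg_cong[where f = of_real]) (simp add: root_weight_power)
    qed
    have M_of_real: "(\<lambda>x. complex_of_real (M x is)) \<simeq> (\<lambda>_. complex_of_real (F is))" if "is \<in> Omega (n + 1) m" for "is"
      by (rule approx_linear[OF M_m[OF that] bounded_linear_of_real])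
    have "(\<lambda>x. res x (qs x) is) \<simeq> (\<lambda>_. 0)"
    proof (rule approx_zero_if_nrm_le[OF finite_Omega "is"])
      show "\<forall>\<^sub>F x in \<Phi>. nrm (Omega (n + 1) m) (res x (qs x)) \<le> nrm (Omega (n + 1) m) (res x q0)"
        using run
      proof eventually_elim
        case (elim x)
        show ?case
          by (rule minimizer_nrm_le[where g = "res x" and P = "\<lambda>_. True"])
            (use elim in \<open>simp_all add: learning_run_def res_def[abs_def]\<close>)
      qed
      show "(\<lambda>x. nrm (Omega (n + 1) m) (res x q0)) \<simeq> (\<lambda>_. 0)"
        using M_of_real q0 by (intro approx_nrm_zero) (simp add: res_def approx_diff_zero_iff)
    qed
    from approx_diff[OF M_of_real[OF "is"] this] show ?thesis by (simp add: res_def)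
  qed
  define res where "res x = (\<lambda>(w, u) is. M x is - (\<Sum>i<r. w i * tpow (u i) is))"
    for x and "is" :: "nat list"
  let ?A = "Omega (n + 1) m" and ?B = "Omega (n + 1) t"
  define E where "E x = nrm ?A (res x (\<omega>, \<mu>)) + nrm ?B (res x (\<omega>, \<mu>))" for x
  have "(\<lambda>x. E x) \<simeq> (\<lambda>_. 0 + 0)"
    unfolding E_def using M_m M_t
    by (intro approx_add approx_nrm_zero) (simp_all add: res_def F_def approx_diff_zero_iff)
  then have E: "E \<simeq> (\<lambda>_. 0)" by simp
  have refined: "\<forall>\<^sub>F x in \<Phi>. (\<Sum>i<r. ws x i) = 1 \<and> (\<forall>i<r. 0 \<le> ws x i) \<and>
      nrm ?A (res x (ws x, ms x)) \<le> E x \<and> nrm ?B (res x (ws x, ms x)) \<le> E x"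
    using run
  proof eventually_elim
    case (elim x)
    then have min: "is_arg_min (\<lambda>q. (nrm ?A (res x q))\<^sup>2 + (nrm ?B (res x q))\<^sup>2)
        (\<lambda>(w, u). (\<Sum>i<r. w i) = 1 \<and> (\<forall>i<r. 0 \<le> w i)) (ws x, ms x)"
      by (simp add: learning_run_def res_def case_prod_beta')
    have feasible: "case (\<omega>, \<mu>) of (w, u) \<Rightarrow> (\<Sum>i<r. w i) = 1 \<and> (\<forall>i<r. 0 \<le> w i)"
      using total \<omega>0 by simp
    from minimizer_two_nrm_le[where g = "res x" and h = "res x", OF min feasible] min
    show ?case by (simp add: E_def is_arg_min_def)
  qed
  have res_m: "(\<lambda>x. res x (ws x, ms x) is) \<simeq> (\<lambda>_. 0)" if "is \<in> ?A" for "is"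
    by (rule approx_zero_if_nrm_le[OF finite_Omega that _ E]) (use refined in \<open>auto elim: eventually_mono\<close>)
  have res_t: "(\<lambda>x. res x (ws x, ms x) is) \<simeq> (\<lambda>_. 0)" if "is \<in> ?B" for "is"
    by (rule approx_zero_if_nrm_le[OF finite_Omega that _ E]) (use refined in \<open>auto elim: eventually_mono\<close>)
  have near_m: "(\<lambda>x. \<Sum>i<r. ws x i * tpow (ms x i) is) \<simeq> (\<lambda>_. F is)" if "is \<in> ?A" for "is"
    using approx_diff[OF M_m[OF that] res_m[OF that]] by (simp add: res_def)
  have near_t: "(\<lambda>x. \<Sum>i<r. ws x i * tpow (ms x i) is) \<simeq> (\<lambda>_. F is)" if "is \<in> ?B" for "is"
    using approx_diff[OF M_t[OF that] res_t[OF that]] by (simp add: res_def)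
  have ws: "\<forall>\<^sub>F x in \<Phi>. (\<Sum>i<r. ws x i) = 1 \<and> (\<forall>i<r. 0 \<le> ws x i)"
    using refined by (auto elim: eventually_mono)
  obtain \<pi> s where \<pi>: "\<And>x. \<pi> x permutes {..<r}"
    and s: "\<forall>i<r. \<forall>\<^sub>F x in \<Phi>. s x i = 1 \<or> s x i = - 1 \<and> even m \<and> even t"
    and ws_close: "\<forall>i<r. (\<lambda>x. ws x (\<pi> x i)) \<simeq> (\<lambda>_. \<omega> i)"
    and ms_close: "\<forall>i<r. \<forall>j\<le>n. (\<lambda>x. ms x (\<pi> x i) j) \<simeq> (\<lambda>x. s x i * \<mu> i j)"
    using weights_and_means_stability[OF near_m[unfolded F_def] near_t[unfolded F_def] ws \<open>t < m\<close> indep_t]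
    by blast
  have "(\<lambda>x. \<theta> x (\<pi> x i) j) \<simeq> (\<lambda>_. (\<sigma> i j)\<^sup>2)" if i: "i < r" and j: "j \<le> n" for i j
  proof (rule covariance_stability[where \<theta> = "\<lambda>x i. \<theta> x i j" and ws = ws and ms = ms and s = s and M = M and qc = qc,
        OF \<pi> _ _ _ _ _ _ i])
    show "\<forall>\<^sub>F x in \<Phi>. s x i = 1 \<or> s x i = - 1 \<and> even m" if "i < r" for i
      using s that by (auto elim: eventually_mono)
    show "\<forall>\<^sub>F x in \<Phi>. is_arg_min
        (\<lambda>c. (nrm (Lhat (n + 1) m j) (\<lambda>is. (M x (j # j # is) - (\<Sum>i<r. tpow (qc x i) (j # j # is))) -
              (\<Sum>i<r. c i * ws x i * tpow (ms x i) is)))\<^sup>2)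
        (\<lambda>c. \<forall>i<r. 0 \<le> c i) (\<lambda>i. \<theta> x i j)"
      using run by eventually_elim (use j in \<open>simp add: learning_run_def\<close>)
  next
    fix "is" assume "is": "is \<in> Lhat (n + 1) m j"
    then have tuple: "length (j # j # is) = m" "set (j # j # is) \<subseteq> {..<n+1}"
      using j p by (auto simp: Lhat_def)
    then show "(\<lambda>x. M x (j # j # is)) \<simeq> (\<lambda>_. \<Sum>i<r. \<omega> i * (((\<mu> i j)\<^sup>2 + (\<sigma> i j)\<^sup>2) * tpow (\<mu> i) is))"
      using near[of "j # j # is"] mixture_moment_double[of r \<omega> j "n + 1" "is" m \<mu> \<sigma>, OF \<omega>0 _ "is"] j
      by (simp add: tuples_def)
    have \<eta>: "\<forall>\<^sub>F x in \<Phi>. \<forall>i<r. is_arg_min (\<lambda>e. nrm {..<n+1} (\<lambda>j. Im (e * qs x i j))) (\<lambda>e. e ^ m = 1) (\<eta> x i)"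
      using run by eventually_elim (simp add: learning_run_def)
    have qc: "\<forall>\<^sub>F x in \<Phi>. \<forall>i<r. \<forall>j<n+1. qc x i j = Re (\<eta> x i * qs x i j)"
      using run by eventually_elim (simp add: learning_run_def)
    show "(\<lambda>x. \<Sum>i<r. tpow (qc x i) (j # j # is)) \<simeq> (\<lambda>_. \<Sum>i<r. \<omega> i * tpow (\<mu> i) (j # j # is))"
      by (rule corrected_power_sums[OF tensor[unfolded F_def] \<eta> qc tuple])
  qed (use ws_close ms_close in auto)
  with \<pi> s ws_close ms_close show ?thesis by blast
qed

end

text \<open>
  The moments and the results \<open>\<omega>\<^sup>*\<close>, \<open>\<mu>\<^sup>*\<close>, \<open>q\<^sup>*\<close>, \<open>\<eta>\<close>, the real vectors obtained from \<open>q\<^sup>*\<close>, \<open>\<theta>\<^sup>*\<close> of a run, in this order.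
\<close>
type_synonym run_data =
  "(nat list \<Rightarrow> real) \<times> (nat \<Rightarrow> real) \<times> (nat \<Rightarrow> nat \<Rightarrow> real) \<times>
    (nat \<Rightarrow> nat \<Rightarrow> complex) \<times> (nat \<Rightarrow> complex) \<times> (nat \<Rightarrow> nat \<Rightarrow> real) \<times> (nat \<Rightarrow> nat \<Rightarrow> real)"

theorem theorem5p2:
  fixes d n m t p k r :: nat
    and \<omega> :: "nat \<Rightarrow> real" and \<mu> \<sigma> :: "nat \<Rightarrow> nat \<Rightarrow> real" and \<xi> :: "nat \<Rightarrow> complex"
    and F :: "nat list \<Rightarrow> real"
  assumes weights: "\<And>i. i < r \<Longrightarrow> 0 < \<omega> i" "(\<Sum>i<r. \<omega> i) = 1"
    and sd: "\<And>i j. i < r \<Longrightarrow> j < d \<Longrightarrow> 0 \<le> \<sigma> i j"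
    and n: "n = d - 1"
    and m: "3 \<le> m"
    and r_bound: "r \<le> r_max n m"
    and t: "t = (LEAST s. r \<le> d choose s)"
    and pk: "1 \<le> p" "p \<le> m - 2" "p \<le> k" "k + m \<le> n + p"
      "r \<le> min (k choose p) ((n - k - 1) choose (m - p - 1))"
    and indep_t: "lin_indep r (Omega d t) (\<lambda>i. tpow (\<mu> i))"
    and F: "F = (\<lambda>is. \<Sum>i<r. \<omega> i * tpow (\<mu> i) is)"
    and cond_i: "\<And>i. i < r \<Longrightarrow> \<omega> i \<noteq> 0 \<and> \<mu> i 0 \<noteq> 0"
    and cond_ii: "lin_indep r (B0 k p r) (\<lambda>i f. mon_eval f (\<mu> i))"
    and cond_iii: "\<And>\<alpha>. \<alpha> \<in> B1 n p k \<Longrightarrow> lin_indep r (Oset n m p k \<alpha>) (\<lambda>i f. mon_eval f (\<mu> i))"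
    and cond_iv: "\<exists>G. (\<forall>\<alpha>\<in>B1 n p k. \<forall>\<gamma>\<in>Oset n m p k \<alpha>.
          gen_residual m (B0 k p r) (\<lambda>is. complex_of_real (F is)) \<alpha> (\<lambda>\<beta>. G \<beta> \<alpha>) \<gamma> = 0) \<and>
        distinct_eigenvalues (B0 k p r) (Nxi n k \<xi> G)"
  shows "\<exists>\<epsilon>0>0. \<exists>C. \<forall>N>0. \<forall>y ws ms Ss \<epsilon>.
    \<epsilon> = max
        (nrm (tuples d m) (\<lambda>is. sample_moment N y is - moment (mixture d r \<omega> \<mu> \<sigma>) is))
        (nrm (tuples d t) (\<lambda>is. sample_moment N y is - moment (mixture d r \<omega> \<mu> \<sigma>) is)) \<longrightarrow>
    \<epsilon> \<le> \<epsilon>0 \<longrightarrow>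
    learning_output d m t p k r \<xi> (sample_moment N y) (sample_moment N y) ws ms Ss \<longrightarrow>
    (\<exists>\<pi> s. \<pi> permutes {..<r} \<and>
       (\<forall>i<r. s i = 1 \<or> s i = - 1 \<and> even m \<and> even t) \<and>
       (\<forall>i<r.
          nrm {..<d} (\<lambda>j. ms (\<pi> i) j - s i * \<mu> i j) \<le> C * \<epsilon> \<and>
          \<bar>ws (\<pi> i) - \<omega> i\<bar> \<le> C * \<epsilon> \<and>
          nrm ({..<d} \<times> {..<d}) (\<lambda>(j, l). Ss (\<pi> i) j l - diagm (\<lambda>j. (\<sigma> i j)\<^sup>2) j l) \<le> C * \<epsilon>))"
proof -
  have pm: "p + 2 \<le> m" and kn: "k < n" using pk m by linarith+
  have d: "d = n + 1" using n kn by simp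
  have "r \<le> d choose p"
    using pk(5) binomial_right_mono[of k d p] kn d by simp
  then have "t \<le> p" unfolding t by (rule Least_le)
  with pm have tm: "t < m" by simp
  note total = weights(2)

  define \<B> where "\<B> = {S. S \<subseteq> {1..k} \<and> card S = p \<and> mset_set S \<in> B0 k p r}"
  have "B0 k p r \<subseteq> mset_set ` \<B>" by (auto simp: \<B>_def B0_def J1_def sqfree_mons_def)
  then have image_B: "B0 k p r = mset_set ` \<B>" by (auto simp: \<B>_def)
  have B_indep: "lin_indep r \<B> (\<lambda>i S. prod (\<mu> i) S)"
    using lin_indep_reindex[OF cond_ii[unfolded image_B]] by (simp add: mon_eval_mset_set)
  have O_indep: "lin_indep r {T. T \<subseteq> {k+1..n} - {l} \<and> card T = m - p - 1} (\<lambda>i T. prod (\<mu> i) T)"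
    if l: "l \<in> {k+1..n}" for l
  proof -
    \<comment> \<open>The set \<open>\<O>\<^sub>\<alpha>\<close> depends only on the index of \<open>\<alpha>\<close> above \<open>k\<close>, so any \<open>\<alpha>\<close> containing \<open>l\<close> will do.\<close>
    define \<alpha> where "\<alpha> = mset_set {1..p} + {#l#}"
    have "mset_set {1..p} \<in> J1 k p" using pk(3) by (auto simp: J1_def sqfree_mons_def)
    then have "\<alpha> \<in> B1 n p k" using l by (auto simp: B1_def \<alpha>_def)
    from cond_iii[OF this] have "lin_indep r (sqfree_mons ({k+1..n} - set_mset \<alpha>) (m - p - 1)) (\<lambda>i f. mon_eval f (\<mu> i))"
      by (simp only: Oset_def)
    moreover have "{k+1..n} - set_mset \<alpha> = {k+1..n} - {l}" using pk(3) by (auto simp: \<alpha>_def)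
    ultimately show ?thesis by (intro lin_indep_sqfree_mons) simp_all
  qed
  obtain G where G: "\<forall>\<alpha>\<in>B1 n p k. \<forall>\<gamma>\<in>Oset n m p k \<alpha>.
      gen_residual m (B0 k p r) (\<lambda>is. complex_of_real (F is)) \<alpha> (\<lambda>\<beta>. G \<beta> \<alpha>) \<gamma> = 0"
    "distinct_eigenvalues (B0 k p r) (Nxi n k \<xi> G)"
    using cond_iv by blast
  have F_complex: "(\<lambda>is. complex_of_real (F is)) =
      (\<lambda>is. \<Sum>i<r. complex_of_real (\<omega> i) * tpow (\<lambda>j. complex_of_real (\<mu> i j)) is)"
    by (simp add: F tpow_of_real)
  have "inj_on (\<lambda>i. \<Sum>l=k+1..n. \<xi> l * (complex_of_real (\<mu> i l) / complex_of_real (\<mu> i 0))) {..<r}"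
  proof (rule eigenvalues_of_generating_matrix[where c = "\<lambda>i. complex_of_real (\<omega> i)" and G = G])
    show "lin_indep r (B0 k p r) (\<lambda>i f. mon_eval f (\<lambda>l. complex_of_real (\<mu> i l)))"
      unfolding mon_eval_of_real by (rule lin_indep_complex[OF cond_ii])
    show "lin_indep r (Oset n m p k \<alpha>) (\<lambda>i f. mon_eval f (\<lambda>l. complex_of_real (\<mu> i l)))" if "\<alpha> \<in> B1 n p k" for \<alpha>
      unfolding mon_eval_of_real by (rule lin_indep_complex[OF cond_iii[OF that]])
  qed (use pm cond_i G in \<open>auto simp: F_complex\<close>)
  then have ratios: "inj_on (\<lambda>i. \<Sum>l=k+1..n. \<xi> l * complex_of_real (\<mu> i l / \<mu> i 0)) {..<r}"
    by simp

  let ?mom = "moment (mixture d r \<omega> \<mu> \<sigma>)"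
  define M where "M x = fst x" for x :: run_data
  define W where "W x = fst (snd x)" for x :: run_data
  define U where "U x = fst (snd (snd x))" for x :: run_data
  define \<Theta> where "\<Theta> x = snd (snd (snd (snd (snd (snd x)))))" for x :: run_data
  define \<epsilon> where "\<epsilon> x = max (nrm (tuples d m) (\<lambda>is. M x is - ?mom is)) (nrm (tuples d t) (\<lambda>is. M x is - ?mom is))" for x
  define runs where "runs = {(M, ws, ms, qs, \<eta>, qc, \<theta>). learning_run d m t r M ws ms qs \<eta> qc \<theta>}"
  \<comment> \<open>The runs of the algorithm, as their moment error tends to \<open>0\<close>; runs with error exactly \<open>0\<close> are
    included, so \<open>nhds 0\<close> is not punctured.\<close>
  define \<Phi> where "\<Phi> = inf (filtercomap \<epsilon> (nhds 0)) (principal runs)"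
  have \<epsilon>0: "0 \<le> \<epsilon> x" for x by (simp add: \<epsilon>_def le_max_iff_disj nrm_nonneg)
  interpret perturbed_mixture \<Phi> \<epsilon> n m p k r \<omega> \<mu> \<xi> \<B>
  proof
    show "(\<epsilon> \<longlongrightarrow> 0) \<Phi>"
      unfolding \<Phi>_def by (rule tendsto_mono[OF inf_le1 filterlim_filtercomap])
  qed (use \<epsilon>0 weights cond_i pk pm kn B_indep O_indep ratios in \<open>auto simp: \<B>_def\<close>)
  have run: "\<forall>\<^sub>F x in \<Phi>. learning_run (n + 1) m t r (M x) (W x) (U x)
      (fst (snd (snd (snd x)))) (fst (snd (snd (snd (snd x))))) (fst (snd (snd (snd (snd (snd x)))))) (\<Theta> x)"
    unfolding \<Phi>_def eventually_inf_principal runs_def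
    by (rule always_eventually) (auto simp: M_def W_def U_def \<Theta>_def d)
  have near: "approx (\<lambda>x. M x is) (\<lambda>_. moment (mixture (n + 1) r \<omega> \<mu> \<sigma>) is)"
    if "is": "is \<in> tuples (n + 1) m \<union> tuples (n + 1) t" for "is"
  proof (rule approxI[of _ _ 1])
    have "norm (M x is - ?mom is) \<le> \<epsilon> x" for x
      using "is" norm_le_nrm[OF finite_tuples, of "is" _ _ "\<lambda>is. M x is - ?mom is"]
      by (auto simp: \<epsilon>_def d le_max_iff_disj)
    then show "\<forall>\<^sub>F x in \<Phi>. norm (M x is - moment (mixture (n + 1) r \<omega> \<mu> \<sigma>) is) \<le> 1 * \<epsilon> x"
      by (simp add: d)
  qed simp
  obtain \<pi> s where \<pi>: "\<And>x. \<pi> x permutes {..<r}"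
    and s: "\<forall>i<r. \<forall>\<^sub>F x in \<Phi>. s x i = 1 \<or> s x i = - 1 \<and> even m \<and> even t"
    and W_close: "\<forall>i<r. approx (\<lambda>x. W x (\<pi> x i)) (\<lambda>_. \<omega> i)"
    and U_close: "\<forall>i<r. \<forall>j\<le>n. approx (\<lambda>x. U x (\<pi> x i) j) (\<lambda>x. s x i * \<mu> i j)"
    and \<Theta>_close: "\<forall>i<r. \<forall>j\<le>n. approx (\<lambda>x. \<Theta> x (\<pi> x i) j) (\<lambda>_. (\<sigma> i j)\<^sup>2)"
    using learning_stability[OF total tm indep_t[unfolded d] near run] by blast
  \<comment> \<open>Adding up all errors gives one constant \<open>C\<close> for all components and parameters.\<close>
  define err where "err x i = nrm {..<d} (\<lambda>j. U x (\<pi> x i) j - s x i * \<mu> i j) + norm (W x (\<pi> x i) - \<omega> i) +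
      nrm ({..<d} \<times> {..<d}) (\<lambda>(j, l). diagm (\<Theta> x (\<pi> x i)) j l - diagm (\<lambda>j. (\<sigma> i j)\<^sup>2) j l)" for x i
  have "approx (\<lambda>x. err x i) (\<lambda>_. 0 + 0 + 0)" if i: "i < r" for i
    unfolding err_def
  proof (intro approx_add approx_nrm_zero)
    show "approx (\<lambda>x. U x (\<pi> x i) j - s x i * \<mu> i j) (\<lambda>_. 0)" if "j \<in> {..<d}" for j
    proof -
      have U: "approx (\<lambda>x. U x (\<pi> x i) j) (\<lambda>x. s x i * \<mu> i j)" using U_close i that d by simp
      show ?thesis unfolding approx_diff_zero_iff[OF approx_bddD[OF U]] by (rule U)
    qed
    have "approx (\<lambda>x. W x (\<pi> x i) - \<omega> i) (\<lambda>_. 0)" using W_close i by (simp add: approx_diff_zero_iff)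
    then show "approx (\<lambda>x. norm (W x (\<pi> x i) - \<omega> i)) (\<lambda>_. 0)" by (simp only: approx_norm_zero[symmetric])
    show "approx (\<lambda>x. case jl of (j, l) \<Rightarrow> diagm (\<Theta> x (\<pi> x i)) j l - diagm (\<lambda>j. (\<sigma> i j)\<^sup>2) j l) (\<lambda>_. 0)"
      if "jl \<in> {..<d} \<times> {..<d}" for jl
      using \<Theta>_close i that d by (cases jl) (auto simp: diagm_def approx_diff_zero_iff)
  qed
  then have "approx (\<lambda>x. \<Sum>i<r. err x i) (\<lambda>_. \<Sum>i<r. 0)" by (intro approx_sum) simp
  then obtain C where C: "\<forall>\<^sub>F x in \<Phi>. norm ((\<Sum>i<r. err x i) - (\<Sum>i<r. 0)) \<le> C * \<epsilon> x" by (rule approxE)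
  have err0: "0 \<le> err x i" for x i by (simp add: err_def nrm_nonneg)
  have "\<forall>\<^sub>F x in \<Phi>. \<forall>i\<in>{..<r}. s x i = 1 \<or> s x i = - 1 \<and> even m \<and> even t"
    using s by (intro eventually_ball_finite) auto
  with C have "\<forall>\<^sub>F x in \<Phi>. \<forall>i<r. (s x i = 1 \<or> s x i = - 1 \<and> even m \<and> even t) \<and> err x i \<le> C * \<epsilon> x"
  proof eventually_elim
    case (elim x)
    have "err x i \<le> (\<Sum>i<r. err x i)" if "i < r" for i using that err0 by (intro member_le_sum) auto
    with elim show ?case by fastforce
  qed
  from eventually_vanishingD[OF this[unfolded \<Phi>_def]] obtain \<delta> where "0 < \<delta>" and
    "\<forall>x\<in>runs. \<bar>\<epsilon> x\<bar> \<le> \<delta> \<longrightarrow> (\<forall>i<r. (s x i = 1 \<or> s x i = - 1 \<and> even m \<and> even t) \<and> err x i \<le> C * \<epsilon> x)"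
    by blast
  then have \<delta>: "\<forall>i<r. (s x i = 1 \<or> s x i = - 1 \<and> even m \<and> even t) \<and> err x i \<le> C * \<epsilon> x"
    if "x \<in> runs" "\<epsilon> x \<le> \<delta>" for x
    using that \<epsilon>0[of x] by simp
  show ?thesis
  proof (rule exI[of _ \<delta>], rule conjI[OF \<open>0 < \<delta>\<close>], rule exI[of _ C], intro allI impI)
    fix N y ws ms Ss \<epsilon>'
    assume \<epsilon>': "\<epsilon>' = max (nrm (tuples d m) (\<lambda>is. sample_moment N y is - ?mom is))
        (nrm (tuples d t) (\<lambda>is. sample_moment N y is - ?mom is))"
      and small: "\<epsilon>' \<le> \<delta>"
      and out: "learning_output d m t p k r \<xi> (sample_moment N y) (sample_moment N y) ws ms Ss"
    have "0 < d" by (simp add: d)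
    from learning_output_run[OF this out] obtain qs \<eta> qc \<theta>
      where run: "learning_run d m t r (sample_moment N y) ws ms qs \<eta> qc \<theta>"
      and Ss: "\<forall>i<r. Ss i = diagm (\<theta> i)"
      by blast
    define x where "x = (sample_moment N y, ws, ms, qs, \<eta>, qc, \<theta>)"
    have x: "x \<in> runs" "\<epsilon> x = \<epsilon>'" "M x = sample_moment N y" "W x = ws" "U x = ms" "\<Theta> x = \<theta>"
      using run by (simp_all add: x_def runs_def M_def W_def U_def \<Theta>_def \<epsilon>_def \<epsilon>')
    show "\<exists>\<pi> s. \<pi> permutes {..<r} \<and>
       (\<forall>i<r. s i = 1 \<or> s i = - 1 \<and> even m \<and> even t) \<and>
       (\<forall>i<r.
          nrm {..<d} (\<lambda>j. ms (\<pi> i) j - s i * \<mu> i j) \<le> C * \<epsilon>' \<and>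
          \<bar>ws (\<pi> i) - \<omega> i\<bar> \<le> C * \<epsilon>' \<and>
          nrm ({..<d} \<times> {..<d}) (\<lambda>(j, l). Ss (\<pi> i) j l - diagm (\<lambda>j. (\<sigma> i j)\<^sup>2) j l) \<le> C * \<epsilon>')"
    proof -
      have signs: "\<forall>i<r. s x i = 1 \<or> s x i = - 1 \<and> even m \<and> even t"
        using \<delta>[OF x(1)] small x(2) by simp
      have bounds: "nrm {..<d} (\<lambda>j. ms (\<pi> x i) j - s x i * \<mu> i j) \<le> C * \<epsilon>' \<and>
          \<bar>ws (\<pi> x i) - \<omega> i\<bar> \<le> C * \<epsilon>' \<and>
          nrm ({..<d} \<times> {..<d}) (\<lambda>(j, l). Ss (\<pi> x i) j l - diagm (\<lambda>j. (\<sigma> i j)\<^sup>2) j l) \<le> C * \<epsilon>'"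
        if i: "i < r" for i
      proof -
        have "\<pi> x i < r" using permutes_in_image[OF \<pi>, of x i] i by simp
        then have "err x i = nrm {..<d} (\<lambda>j. ms (\<pi> x i) j - s x i * \<mu> i j) + \<bar>ws (\<pi> x i) - \<omega> i\<bar> +
            nrm ({..<d} \<times> {..<d}) (\<lambda>(j, l). Ss (\<pi> x i) j l - diagm (\<lambda>j. (\<sigma> i j)\<^sup>2) j l)"
          using Ss by (simp add: err_def x)
        moreover have "err x i \<le> C * \<epsilon>'" using \<delta>[OF x(1)] i small x(2) by simp
        ultimately show ?thesis
          using nrm_nonneg[of "{..<d}" "\<lambda>j. ms (\<pi> x i) j - s x i * \<mu> i j"] abs_ge_zero[of "ws (\<pi> x i) - \<omega> i"]
            nrm_nonneg[of "{..<d} \<times> {..<d}" "\<lambda>(j, l). Ss (\<pi> x i) j l - diagm (\<lambda>j. (\<sigma> i j)\<^sup>2) j l"]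
          by linarith
      qed
      show ?thesis using \<pi>[of x] signs bounds by blast
    qed
  qed
qed

end
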